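(* Consider the product structure, the regular local likelihood process $X=\sum_{m=1}^{M_n}X_m^{(n)}$, the product data-generating law $P_\theta=\bigotimes_{m}P^{(n)}_{\theta,m}$, and the associated Gaussian location counterpart $Y$ determined by the local operators $A_m^{(n)},\Sigma_m^{(n)},K_m^{(n)}$, as defined in the context. Suppose that the local moment bounds stated in the context hold with $\delta_n(\theta)$, and that $r_n\lesssim\sqrt{n/M_n}$. Then, for every $\theta\in\Theta_n$, $$\bigl|F_n(\theta)-F_n^{\mathrm G}(\theta)\bigr|\lesssim\delta_n(\theta)\{1+\delta_n(\theta)\},$$ with implied constant independent of $n$ and $\theta$.
   Context: For each $n$: $\Theta_n$ is a compact parameter space, $T_n\subseteq\Theta_n$ a compact metric space with a Borel probability measure $\pi$ (prior), $M_n$ a number of local components, $\Omega=\prod_{m=1}^{M_n}\Omega_m$ the sample space; all may depend on $n$. For $m\le M_n$, $\mathcal H_m$ is a real separable Hilbert space and $\eta_m:\Theta_n\to\mathcal H_m$ a continuous feature map. The feature radius is $r_n=\max_{m\le M_n}\sup_{u\in\Theta_n}\|\eta_m(u)\|_{\mathcal H_m}$, with $r_n>0$. The notation $\lesssim$ means $\le$ up to a finite constant independent of $n$, $m$, $\theta$. Likelihood process: $X(t,\omega)=\sum_{m=1}^{M_n}X_m^{(n)}(t,\omega_m)$, $t\in T_n$, with continuous sample paths, where $$X_m^{(n)}(t,\omega_m)=\langle U_m^{(n)}(\omega_m),\eta_m(t)\rangle_{\mathcal H_m}-\tfrac12\langle V_m^{(n)}(\omega_m)\eta_m(t),\eta_m(t)\rangle_{\mathcal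 H_m}+R_m^{(n)}(t,\omega_m),$$ $U_m^{(n)}$ is a random element of $\mathcal H_m$, $V_m^{(n)}$ a random (bounded) self-adjoint operator on $\mathcal H_m$, and $R_m^{(n)}$ a remainder. Data-generating laws: $P_0=\bigotimes_mP_{0,m}^{(n)}$ is a null product probability measure independent of $\theta$, $P_\theta=\bigotimes_mP_{\theta,m}^{(n)}$, and $$\log\frac{\mathrm dP_{\theta,m}^{(n)}}{\mathrm dP_{0,m}^{(n)}}(\omega_m)=\langle S_m^{(n)}(\omega_m),\eta_m(\theta)\rangle_{\mathcal H_m}+\Delta_m^{(n)}(\theta,\omega_m),\qquad\theta\in\Theta_n,$$ with $S_m^{(n)}$ a random element of $\mathcal H_m$ and $\Delta_m^{(n)}$ a (real-valued) remainder. $\mathbb E_0,\mathbb E_\theta$ denote expectation under $P_{0,m}^{(n)}$ and $P_{\theta,m}^{(n)}$. Local moment bounds (superscripts $(n)$ dropped). Put $\mathsf L_{m,n}=\mathbb E_0\|U_m\|^2+\mathbb E_0\|S_m\|^2$, $$\mathcal E^U_{m,n}(\theta)=r_n(\mathbb E_0\|U_m\|^3+\mathbb E_\theta\|U_m\|^3),\qquad\mathcal E^S_{m,n}(\theta)=r_n(\mathbb E_0\|S_m\|^3+\mathbb E_\theta\|S_m\|^3),$$ $$\mathcal E^V_{m,n}(\theta)=r_n\sqrt{\mathbb E_0\|V_m\|_{\mathrm{op}}^2}+r_n^4(\mathbb E_0\|V_m\|_{\mathrm{op}}^3+\mathbb E_\theta\|V_m\|_{\mathrm{op}}^3),$$ $$\mathcal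 E^R_{m,n}(\theta)=\sup_{t\in T_n}\Bigl\{r_n^{-2}|\mathbb E_0R_m(t)|+r_n^{-1}\sqrt{\mathbb E_0|R_m(t)|^2}+r_n^{-2}\mathbb E_0|R_m(t)|^3\Bigr\}+r_n^{-2}\mathbb E_\theta\Bigl[\sup_{t\in T_n}|R_m(t)|^3\Bigr],$$ $$\mathcal E^\Delta_{m,n}(\theta)=r_n^{-1}\sqrt{\mathbb E_0|\Delta_m(\theta)|^2}+r_n^{-2}(\mathbb E_0|\Delta_m(\theta)|^3+\mathbb E_\theta|\Delta_m(\theta)|^3).$$ The assumption is: $\delta_n(\theta)\ge0$ is a (finite) deterministic quantity such that, uniformly over $m\le M_n$ and $\theta\in\Theta_n$, $$\mathbb E_0[U_m]=0,\qquad\mathsf L_{m,n}\lesssim1,\qquad\mathcal E^U_{m,n}(\theta)+\mathcal E^S_{m,n}(\theta)+\mathcal E^V_{m,n}(\theta)+\mathcal E^R_{m,n}(\theta)+\mathcal E^\Delta_{m,n}(\theta)\lesssim\delta_n(\theta).$$ Gaussian counterpart: bounded operators on $\mathcal H_m$ are defined by $$\langle A_mh,g\rangle=\mathbb E_0[\langle S_m,h\rangle\langle U_m,g\rangle],\quad\langle\Sigma_mh,g\rangle=\mathbb E_0[\langle U_m,h\rangle\langle U_m,g\rangle],\quad\langle K_mh,g\rangle=\mathbb E_0[\langle V_mh,g\rangle].$$ Under $Q_\theta$, $Y(t)=\sum_{m=1}^{M_n}Y_m(t)$ with $Y_1,\dots,Y_{M_n}$ independent Gaussian processes with continuous paths and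 $$\mathbb E_{Q_\theta}[Y_m(t)]=\langle A_m\eta_m(\theta),\eta_m(t)\rangle-\tfrac12\langle K_m\eta_m(t),\eta_m(t)\rangle,\qquad\mathrm{Cov}_{Q_\theta}(Y_m(s),Y_m(t))=\langle\Sigma_m\eta_m(s),\eta_m(t)\rangle.$$ Normalized free energies: $F_n(\theta)=\frac1n\mathbb E_{P_\theta}[\log\int_{T_n}e^{X(t)}\pi(\mathrm dt)]$, $F_n^{\mathrm G}(\theta)=\frac1n\mathbb E_{Q_\theta}[\log\int_{T_n}e^{Y(t)}\pi(\mathrm dt)]$. *)

theory Defs
  imports "HOL-Probability.Probability"
begin

text \<open>
  The spaces \<open>\<Theta>\<^sub>n\<close>, \<open>\<Omega>\<^sub>m\<close> and \<open>\<H>\<^sub>m\<close> vary with \<open>n\<close> and \<open>m\<close>, which types cannot do. They are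
  therefore carriers inside one type of each kind: \<open>\<Theta>\<^sub>n\<close> is a compact subset of a topological
  space, \<open>\<Omega>\<^sub>m\<close> is the space of a measure, and \<open>\<H>\<^sub>m\<close> is a closed subspace of a separable Hilbert
  space \<open>'h\<close> (any countable family of separable Hilbert spaces embeds into a single one).
\<close>


section \<open>Bounded operators on a subspace\<close>

text \<open>Operators on \<open>H\<close> are functions on the ambient type, of which only the values on \<open>H\<close> count.\<close>

definition bounded_operator_on :: "'h::real_normed_vector set \<Rightarrow> ('h \<Rightarrow> 'h) \<Rightarrow> bool" where
  "bounded_operator_on H A \<longleftrightarrow>
     A ` H \<subseteq> H \<and>
     (\<forall>x\<in>H. \<forall>y\<in>H. A (x + y) = A x + A y) \<and>
     (\<forall>c. \<forall>x\<in>H. A (c *\<^sub>R x) = c *\<^sub>R A x) \<and>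
     (\<exists>B. \<forall>x\<in>H. norm (A x) \<le> B * norm x)"

definition self_adjoint_on :: "'h::real_inner set \<Rightarrow> ('h \<Rightarrow> 'h) \<Rightarrow> bool" where
  "self_adjoint_on H A \<longleftrightarrow> (\<forall>x\<in>H. \<forall>y\<in>H. A x \<bullet> y = x \<bullet> A y)"

definition op_norm_on :: "'h::real_normed_vector set \<Rightarrow> ('h \<Rightarrow> 'h) \<Rightarrow> ennreal" where
  "op_norm_on H A = (SUP x\<in>H \<inter> cball 0 1. ennreal (norm (A x)))"


section \<open>The local likelihood process\<close>

definition feature_radius ::
    "'p set \<Rightarrow> nat \<Rightarrow> (nat \<Rightarrow> 'p \<Rightarrow> 'h::real_normed_vector) \<Rightarrow> real" where
  "feature_radius \<Theta> M \<eta> = (MAX m\<in>{1..M}. SUP u\<in>\<Theta>. norm (\<eta> m u))"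

definition local_component ::
    "(nat \<Rightarrow> 'w \<Rightarrow> 'h::real_inner) \<Rightarrow> (nat \<Rightarrow> 'w \<Rightarrow> 'h \<Rightarrow> 'h) \<Rightarrow> (nat \<Rightarrow> 'p \<Rightarrow> 'w \<Rightarrow> real) \<Rightarrow>
     (nat \<Rightarrow> 'p \<Rightarrow> 'h) \<Rightarrow> nat \<Rightarrow> 'p \<Rightarrow> 'w \<Rightarrow> real" where
  "local_component U V R \<eta> m t \<omega> =
     U m \<omega> \<bullet> \<eta> m t - 1 / 2 * (V m \<omega> (\<eta> m t) \<bullet> \<eta> m t) + R m t \<omega>"

definition likelihood_process ::
    "nat \<Rightarrow> (nat \<Rightarrow> 'w \<Rightarrow> 'h::real_inner) \<Rightarrow> (nat \<Rightarrow> 'w \<Rightarrow> 'h \<Rightarrow> 'h) \<Rightarrow> (nat \<Rightarrow> 'p \<Rightarrow> 'w \<Rightarrow> real) \<Rightarrow>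
     (nat \<Rightarrow> 'p \<Rightarrow> 'h) \<Rightarrow> 'p \<Rightarrow> (nat \<Rightarrow> 'w) \<Rightarrow> real" where
  "likelihood_process M U V R \<eta> t \<omega> = (\<Sum>m\<in>{1..M}. local_component U V R \<eta> m t (\<omega> m))"

text \<open>
  The setting at one fixed \<open>n\<close>. \<open>V\<close> is a random operator in the strong sense (\<open>\<omega> \<mapsto> V m \<omega> h\<close> is
  measurable for every \<open>h\<close>). Since \<open>\<H>\<^sub>m\<close> is separable, \<open>\<omega> \<mapsto> \<parallel>V m \<omega>\<parallel>\<close> is then measurable.
\<close>

locale local_likelihood_model =
  fixes \<Theta> T :: "'p::topological_space set"
    and \<pi> :: "'p measure"
    and M :: nat
    and H :: "nat \<Rightarrow> 'h::{real_inner, banach, second_countable_topology} set"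
    and \<eta> :: "nat \<Rightarrow> 'p \<Rightarrow> 'h"
    and P0 :: "nat \<Rightarrow> 'w measure"
    and P :: "'p \<Rightarrow> nat \<Rightarrow> 'w measure"
    and U :: "nat \<Rightarrow> 'w \<Rightarrow> 'h"
    and V :: "nat \<Rightarrow> 'w \<Rightarrow> 'h \<Rightarrow> 'h"
    and R :: "nat \<Rightarrow> 'p \<Rightarrow> 'w \<Rightarrow> real"
    and S :: "nat \<Rightarrow> 'w \<Rightarrow> 'h"
    and \<Delta> :: "nat \<Rightarrow> 'p \<Rightarrow> 'w \<Rightarrow> real"
  assumes compact_Theta: "compact \<Theta>"
    and T_subset: "T \<subseteq> \<Theta>"
    and compact_T: "compact T"
    and metrizable_T: "metrizable_space (top_of_set T)"
    and sets_prior: "sets \<pi> = sets (restrict_space borel T)"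
    and prob_prior: "prob_space \<pi>"
    and M_pos: "M \<ge> 1"
    and subspace_H: "\<And>m. m \<in> {1..M} \<Longrightarrow> subspace (H m)"
    and closed_H: "\<And>m. m \<in> {1..M} \<Longrightarrow> closed (H m)"
    and feature_in: "\<And>m. m \<in> {1..M} \<Longrightarrow> \<eta> m ` \<Theta> \<subseteq> H m"
    and feature_cont: "\<And>m. m \<in> {1..M} \<Longrightarrow> continuous_on \<Theta> (\<eta> m)"
    and radius_pos: "feature_radius \<Theta> M \<eta> > 0"
    and prob_P0: "\<And>m. m \<in> {1..M} \<Longrightarrow> prob_space (P0 m)"
    and prob_P: "\<And>\<theta> m. \<theta> \<in> \<Theta> \<Longrightarrow> m \<in> {1..M} \<Longrightarrow> prob_space (P \<theta> m)"
    and P_density: "\<And>\<theta> m. \<theta> \<in> \<Theta> \<Longrightarrow> m \<in> {1..M} \<Longrightarrow>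
          P \<theta> m = density (P0 m) (\<lambda>\<omega>. ennreal (exp (S m \<omega> \<bullet> \<eta> m \<theta> + \<Delta> m \<theta> \<omega>)))"
    and U_in: "\<And>m \<omega>. m \<in> {1..M} \<Longrightarrow> \<omega> \<in> space (P0 m) \<Longrightarrow> U m \<omega> \<in> H m"
    and U_measurable: "\<And>m. m \<in> {1..M} \<Longrightarrow> U m \<in> borel_measurable (P0 m)"
    and S_in: "\<And>m \<omega>. m \<in> {1..M} \<Longrightarrow> \<omega> \<in> space (P0 m) \<Longrightarrow> S m \<omega> \<in> H m"
    and S_measurable: "\<And>m. m \<in> {1..M} \<Longrightarrow> S m \<in> borel_measurable (P0 m)"
    and V_bounded: "\<And>m \<omega>. m \<in> {1..M} \<Longrightarrow> \<omega> \<in> space (P0 m) \<Longrightarrow> bounded_operator_on (H m) (V m \<omega>)"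
    and V_self_adjoint: "\<And>m \<omega>. m \<in> {1..M} \<Longrightarrow> \<omega> \<in> space (P0 m) \<Longrightarrow> self_adjoint_on (H m) (V m \<omega>)"
    and V_measurable: "\<And>m h. m \<in> {1..M} \<Longrightarrow> h \<in> H m \<Longrightarrow> (\<lambda>\<omega>. V m \<omega> h) \<in> borel_measurable (P0 m)"
    and R_measurable: "\<And>m t. m \<in> {1..M} \<Longrightarrow> t \<in> T \<Longrightarrow> R m t \<in> borel_measurable (P0 m)"
    and Delta_measurable: "\<And>m \<theta>. m \<in> {1..M} \<Longrightarrow> \<theta> \<in> \<Theta> \<Longrightarrow> \<Delta> m \<theta> \<in> borel_measurable (P0 m)"
    and X_continuous: "\<And>\<omega>. \<omega> \<in> space (PiM {1..M} P0) \<Longrightarrow>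
          continuous_on T (\<lambda>t. likelihood_process M U V R \<eta> t \<omega>)"


section \<open>Local moment bounds\<close>

text \<open>
  Moments of nonnegative quantities are \<open>ennreal\<close>-valued integrals, so that a finite upper bound on
  them includes integrability.
\<close>

definition ennreal_sqrt :: "ennreal \<Rightarrow> ennreal" where
  "ennreal_sqrt x = (if x = \<top> then \<top> else ennreal (sqrt (enn2real x)))"

definition second_moments :: "'w measure \<Rightarrow> ('w \<Rightarrow> 'h::real_normed_vector) \<Rightarrow> ('w \<Rightarrow> 'h) \<Rightarrow> ennreal" where
  "second_moments P0 U S =
     (\<integral>\<^sup>+\<omega>. ennreal (norm (U \<omega>) ^ 2) \<partial>P0) + (\<integral>\<^sup>+\<omega>. ennreal (norm (S \<omega>) ^ 2) \<partial>P0)"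

definition score_error ::
    "real \<Rightarrow> 'w measure \<Rightarrow> 'w measure \<Rightarrow> ('w \<Rightarrow> 'h::real_normed_vector) \<Rightarrow> ennreal" where
  "score_error r P0 P U =
     ennreal r * ((\<integral>\<^sup>+\<omega>. ennreal (norm (U \<omega>) ^ 3) \<partial>P0) + (\<integral>\<^sup>+\<omega>. ennreal (norm (U \<omega>) ^ 3) \<partial>P))"

definition curvature_error ::
    "real \<Rightarrow> 'w measure \<Rightarrow> 'w measure \<Rightarrow> 'h::real_normed_vector set \<Rightarrow> ('w \<Rightarrow> 'h \<Rightarrow> 'h) \<Rightarrow> ennreal" where
  "curvature_error r P0 P H V =
     ennreal r * ennreal_sqrt (\<integral>\<^sup>+\<omega>. op_norm_on H (V \<omega>) ^ 2 \<partial>P0) +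
     ennreal (r ^ 4) *
       ((\<integral>\<^sup>+\<omega>. op_norm_on H (V \<omega>) ^ 3 \<partial>P0) + (\<integral>\<^sup>+\<omega>. op_norm_on H (V \<omega>) ^ 3 \<partial>P))"

definition remainder_error ::
    "real \<Rightarrow> 'w measure \<Rightarrow> 'w measure \<Rightarrow> 'p set \<Rightarrow> ('p \<Rightarrow> 'w \<Rightarrow> real) \<Rightarrow> ennreal" where
  "remainder_error r P0 P T R =
     (SUP t\<in>T.
        ennreal (1 / r ^ 2) * ennreal \<bar>\<integral>\<omega>. R t \<omega> \<partial>P0\<bar> +
        ennreal (1 / r) * ennreal_sqrt (\<integral>\<^sup>+\<omega>. ennreal (\<bar>R t \<omega>\<bar> ^ 2) \<partial>P0) +
        ennreal (1 / r ^ 2) * (\<integral>\<^sup>+\<omega>. ennreal (\<bar>R t \<omega>\<bar> ^ 3) \<partial>P0)) +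
     ennreal (1 / r ^ 2) * (\<integral>\<^sup>+\<omega>. (SUP t\<in>T. ennreal (\<bar>R t \<omega>\<bar> ^ 3)) \<partial>P)"

definition density_error :: "real \<Rightarrow> 'w measure \<Rightarrow> 'w measure \<Rightarrow> ('w \<Rightarrow> real) \<Rightarrow> ennreal" where
  "density_error r P0 P D =
     ennreal (1 / r) * ennreal_sqrt (\<integral>\<^sup>+\<omega>. ennreal (\<bar>D \<omega>\<bar> ^ 2) \<partial>P0) +
     ennreal (1 / r ^ 2) *
       ((\<integral>\<^sup>+\<omega>. ennreal (\<bar>D \<omega>\<bar> ^ 3) \<partial>P0) + (\<integral>\<^sup>+\<omega>. ennreal (\<bar>D \<omega>\<bar> ^ 3) \<partial>P))"


section \<open>Gaussian processes and the Gaussian counterpart\<close>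

text \<open>Point masses count as Gaussian, as the covariances below may be degenerate.\<close>

definition gaussian_rv :: "'y measure \<Rightarrow> ('y \<Rightarrow> real) \<Rightarrow> bool" where
  "gaussian_rv Q Z \<longleftrightarrow>
     Z \<in> borel_measurable Q \<and>
     (\<exists>\<mu>. (AE \<omega> in Q. Z \<omega> = \<mu>) \<or>
           (\<exists>\<sigma>>0. distributed Q lborel Z (\<lambda>x. ennreal (normal_density \<mu> \<sigma> x))))"

definition gaussian_process :: "'y measure \<Rightarrow> 'p set \<Rightarrow> ('p \<Rightarrow> 'y \<Rightarrow> real) \<Rightarrow> bool" where
  "gaussian_process Q T Z \<longleftrightarrow>
     (\<forall>F c. finite F \<longrightarrow> F \<subseteq> T \<longrightarrow> gaussian_rv Q (\<lambda>\<omega>. \<Sum>t\<in>F. c t * Z t \<omega>))"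

text \<open>
  The operators \<open>A\<close>, \<open>\<Sigma>\<close>, \<open>K\<close> are parameters subject to their defining identities, which determine
  them on \<open>H m\<close>. The processes \<open>Y m\<close> are indexed by \<open>T\<close>; their independence is that of the
  random elements \<open>Y m\<close> of the product space of real functions on \<open>T\<close>.
\<close>

locale gaussian_counterpart =
  fixes \<Theta> T :: "'p::topological_space set"
    and M :: nat
    and H :: "nat \<Rightarrow> 'h::{real_inner, banach, second_countable_topology} set"
    and \<eta> :: "nat \<Rightarrow> 'p \<Rightarrow> 'h"
    and P0 :: "nat \<Rightarrow> 'w measure"
    and U :: "nat \<Rightarrow> 'w \<Rightarrow> 'h"
    and V :: "nat \<Rightarrow> 'w \<Rightarrow> 'h \<Rightarrow> 'h"
    and S :: "nat \<Rightarrow> 'w \<Rightarrow> 'h"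
    and A \<Sigma> K :: "nat \<Rightarrow> 'h \<Rightarrow> 'h"
    and Q :: "'p \<Rightarrow> 'y measure"
    and Y :: "nat \<Rightarrow> 'p \<Rightarrow> 'y \<Rightarrow> real"
  assumes A_bounded: "\<And>m. m \<in> {1..M} \<Longrightarrow> bounded_operator_on (H m) (A m)"
    and A_form: "\<And>m h g. m \<in> {1..M} \<Longrightarrow> h \<in> H m \<Longrightarrow> g \<in> H m \<Longrightarrow>
          A m h \<bullet> g = (\<integral>\<omega>. (S m \<omega> \<bullet> h) * (U m \<omega> \<bullet> g) \<partial>P0 m)"
    and Sigma_bounded: "\<And>m. m \<in> {1..M} \<Longrightarrow> bounded_operator_on (H m) (\<Sigma> m)"
    and Sigma_form: "\<And>m h g. m \<in> {1..M} \<Longrightarrow> h \<in> H m \<Longrightarrow> g \<in> H m \<Longrightarrow>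
          \<Sigma> m h \<bullet> g = (\<integral>\<omega>. (U m \<omega> \<bullet> h) * (U m \<omega> \<bullet> g) \<partial>P0 m)"
    and K_bounded: "\<And>m. m \<in> {1..M} \<Longrightarrow> bounded_operator_on (H m) (K m)"
    and K_form: "\<And>m h g. m \<in> {1..M} \<Longrightarrow> h \<in> H m \<Longrightarrow> g \<in> H m \<Longrightarrow>
          K m h \<bullet> g = (\<integral>\<omega>. V m \<omega> h \<bullet> g \<partial>P0 m)"
    and prob_Q: "\<And>\<theta>. \<theta> \<in> \<Theta> \<Longrightarrow> prob_space (Q \<theta>)"
    and Y_gaussian: "\<And>\<theta> m. \<theta> \<in> \<Theta> \<Longrightarrow> m \<in> {1..M} \<Longrightarrow> gaussian_process (Q \<theta>) T (Y m)"
    and Y_continuous: "\<And>\<theta> m \<omega>. \<theta> \<in> \<Theta> \<Longrightarrow> m \<in> {1..M} \<Longrightarrow> \<omega> \<in> space (Q \<theta>) \<Longrightarrow>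
          continuous_on T (\<lambda>t. Y m t \<omega>)"
    and Y_indep: "\<And>\<theta>. \<theta> \<in> \<Theta> \<Longrightarrow>
          prob_space.indep_vars (Q \<theta>) (\<lambda>_. PiM T (\<lambda>_. borel)) (\<lambda>m \<omega>. \<lambda>t\<in>T. Y m t \<omega>) {1..M}"
    and Y_mean: "\<And>\<theta> m t. \<theta> \<in> \<Theta> \<Longrightarrow> m \<in> {1..M} \<Longrightarrow> t \<in> T \<Longrightarrow>
          (\<integral>\<omega>. Y m t \<omega> \<partial>Q \<theta>) = A m (\<eta> m \<theta>) \<bullet> \<eta> m t - 1 / 2 * (K m (\<eta> m t) \<bullet> \<eta> m t)"
    and Y_cov: "\<And>\<theta> m s t. \<theta> \<in> \<Theta> \<Longrightarrow> m \<in> {1..M} \<Longrightarrow> s \<in> T \<Longrightarrow> t \<in> T \<Longrightarrow>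
          (\<integral>\<omega>. (Y m s \<omega> - (\<integral>\<omega>'. Y m s \<omega>' \<partial>Q \<theta>)) * (Y m t \<omega> - (\<integral>\<omega>'. Y m t \<omega>' \<partial>Q \<theta>)) \<partial>Q \<theta>)
            = \<Sigma> m (\<eta> m s) \<bullet> \<eta> m t"


section \<open>Normalized free energy\<close>

definition free_energy :: "nat \<Rightarrow> 'p measure \<Rightarrow> 'a measure \<Rightarrow> ('p \<Rightarrow> 'a \<Rightarrow> real) \<Rightarrow> real" where
  "free_energy n \<pi> P Z = 1 / real n * (\<integral>\<omega>. ln (\<integral>t. exp (Z t \<omega>) \<partial>\<pi>) \<partial>P)"

end

theory Submission
  imports Defs
begin

text \<open>
  The idea is a Lindeberg exchange: the components of the likelihood process are replaced by their
  Gaussian counterparts one at a time. For one exchange all other components are frozen. They turn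
  the prior into a Gibbs measure \<open>\<nu>\<close> (\<open>log_partition_add\<close>), and it remains to compare
  \<open>E (ln (\<integral> exp X d\<nu>))\<close> with \<open>E (ln (\<integral> exp Y d\<nu>))\<close> for single components \<open>X\<close> and \<open>Y\<close>, uniformly over all
  probability measures \<open>\<nu>\<close>; the costs then add up (\<open>lindeberg_exchange\<close>).

  A mean shared by \<open>X\<close> and \<open>Y\<close> is absorbed into \<open>\<nu>\<close> as well. For centred fields,
  \<open>ln (\<integral> exp X d\<nu>)\<close> is the mean of \<open>X\<close> plus half its variance under \<open>\<nu>\<close>, up to a third-order remainder
  (\<open>cumulant_remainder_le\<close>), and the expectation of the second-order term depends on the covariance
  of the field alone (\<open>log_partition_expansion\<close>). So three quantities have to be bounded by a multiple
  of \<open>r\<^sup>2 * \<delta> * (1 + \<delta>)\<close>, where \<open>r\<close> is the feature radius; summing over \<open>M\<close> components and dividing by \<open>n\<close>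
  then gives the claim, as \<open>M * r\<^sup>2\<close> is at most of the order of \<open>n\<close>.

  The first is the third-order remainder. For the likelihood component it is bounded by the third
  moment of the supremum. For a Gaussian component exponential moments of the single values suffice
  when the standard deviation \<open>x\<close> is at most one, and otherwise Jensen's inequality gives the even
  smaller order \<open>x\<^sup>2\<close> (\<open>subgaussian_field.expansion\<close>). The resulting \<open>x ^ 3\<close> is bounded by the third moment
  of the score (\<open>score_variance\<close>).

  The second and third are the differences of the means and of the covariances. They come from
  expanding the density of \<open>P \<theta> m\<close> with respect to \<open>P0 m\<close>: the leading terms are those that define the
  operators \<open>A\<close>, \<open>K\<close> and \<open>\<Sigma>\<close>. In the errors, products of two factors under \<open>P0 m\<close> contain a factor
  that is small in mean square, and products of three factors are controlled by third moments under
  both measures (\<open>mean_expansion\<close>, \<open>covariance_expansion\<close>). The delicate term is the product of the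
  means in the covariance, which is not small by size alone (\<open>mean_square_le\<close>).

  There is one measure-theoretic obstacle. Only the sum of the components has continuous paths; a
  single component may contain a deterministic drift that is not even measurable in the parameter.
  Replacing its mean by that of the Gaussian component removes the drift, leaving jointly measurable
  fields, and changes the sum by a small deterministic function.
\<close>


section \<open>Log-partition functions and Gibbs measures\<close>

definition log_partition :: "'t measure \<Rightarrow> ('t \<Rightarrow> real) \<Rightarrow> real" where
  "log_partition \<nu> w = ln (\<integral>t. exp (w t) \<partial>\<nu>)"

definition gibbs :: "'t measure \<Rightarrow> ('t \<Rightarrow> real) \<Rightarrow> 't measure" where
  "gibbs \<nu> w = density \<nu> (\<lambda>t. ennreal (exp (w t) / (\<integral>t. exp (w t) \<partial>\<nu>)))"

lemma sets_gibbs [simp, measurable_cong]: "sets (gibbs \<nu> w) = sets \<nu>"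
  and space_gibbs [simp]: "space (gibbs \<nu> w) = space \<nu>"
  by (simp_all add: gibbs_def)

definition bounded_on_space :: "'t measure \<Rightarrow> ('t \<Rightarrow> real) \<Rightarrow> bool" where
  "bounded_on_space \<nu> w \<longleftrightarrow> (\<exists>B. \<forall>t\<in>space \<nu>. \<bar>w t\<bar> \<le> B)"

lemma bounded_on_spaceI: "(\<And>t. t \<in> space \<nu> \<Longrightarrow> \<bar>w t\<bar> \<le> B) \<Longrightarrow> bounded_on_space \<nu> w"
  by (auto simp: bounded_on_space_def)

lemma bounded_on_space_add:
  assumes "bounded_on_space \<nu> v" "bounded_on_space \<nu> w"
  shows "bounded_on_space \<nu> (\<lambda>t. v t + w t)"
proof -
  obtain B C where "\<forall>t\<in>space \<nu>. \<bar>v t\<bar> \<le> B" "\<forall>t\<in>space \<nu>. \<bar>w t\<bar> \<le> C"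
    using assms by (auto simp: bounded_on_space_def)
  then have "\<And>t. t \<in> space \<nu> \<Longrightarrow> \<bar>v t + w t\<bar> \<le> B + C" by fastforce
  then show ?thesis by (rule bounded_on_spaceI)
qed

lemma (in prob_space) integrable_of_bounded:
  assumes "w \<in> borel_measurable M" "bounded_on_space M w"
  shows "integrable M (w :: 'a \<Rightarrow> real)"
  using assms by (auto simp: bounded_on_space_def intro!: integrable_const_bound AE_I2)

lemma bounded_on_space_exp:
  "bounded_on_space \<nu> w \<Longrightarrow> bounded_on_space \<nu> (\<lambda>t. exp (w t))"
proof -
  assume "bounded_on_space \<nu> w"
  then obtain B where "\<forall>t\<in>space \<nu>. \<bar>w t\<bar> \<le> B" by (auto simp: bounded_on_space_def)
  then show ?thesis by (intro bounded_on_spaceI[where B="exp B"]) fastforce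
qed

lemma (in prob_space) integrable_exp_bounded:
  assumes "w \<in> borel_measurable M" "bounded_on_space M w"
  shows "integrable M (\<lambda>t. exp (w t :: real))"
  by (rule integrable_of_bounded[OF _ bounded_on_space_exp]) (use assms in measurable)

lemma (in prob_space) integral_between:
  fixes w :: "'a \<Rightarrow> real"
  assumes "integrable M w" "\<And>t. t \<in> space M \<Longrightarrow> a \<le> w t" "\<And>t. t \<in> space M \<Longrightarrow> w t \<le> b"
  shows "a \<le> (\<integral>t. w t \<partial>M)" "(\<integral>t. w t \<partial>M) \<le> b"
  using assms integral_mono[of M "\<lambda>_. a" w] integral_mono[of M w "\<lambda>_. b"]
  by (simp_all add: prob_space)

lemma (in prob_space) exp_integral_between:
  assumes "w \<in> borel_measurable M" and B: "\<And>t. t \<in> space M \<Longrightarrow> \<bar>w t\<bar> \<le> B"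
  shows "exp (- B) \<le> (\<integral>t. exp (w t :: real) \<partial>M)" "(\<integral>t. exp (w t) \<partial>M) \<le> exp B"
proof -
  have "exp (- B) \<le> exp (w t)" "exp (w t) \<le> exp B" if "t \<in> space M" for t
    using B[OF that] by auto
  note integral_between[OF integrable_exp_bounded[OF assms(1) bounded_on_spaceI[OF B]] this]
  then show "exp (- B) \<le> (\<integral>t. exp (w t) \<partial>M)" "(\<integral>t. exp (w t) \<partial>M) \<le> exp B" by auto
qed

lemma (in prob_space) exp_integral_pos:
  assumes "w \<in> borel_measurable M" "bounded_on_space M w"
  shows "0 < (\<integral>t. exp (w t :: real) \<partial>M)"
proof -
  obtain B where "\<And>t. t \<in> space M \<Longrightarrow> \<bar>w t\<bar> \<le> B" using assms by (auto simp: bounded_on_space_def)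
  from exp_integral_between(1)[OF assms(1) this] show ?thesis by (smt (verit) exp_gt_zero)
qed

lemma (in prob_space) abs_log_partition_le:
  assumes "w \<in> borel_measurable M" and B: "\<And>t. t \<in> space M \<Longrightarrow> \<bar>w t\<bar> \<le> B"
  shows "\<bar>log_partition M w\<bar> \<le> B"
proof -
  have bd: "bounded_on_space M w" using B by (rule bounded_on_spaceI)
  note 1 = exp_integral_between[OF assms]
  have pos: "0 < (\<integral>t. exp (w t) \<partial>M)" by (rule exp_integral_pos[OF assms(1) bd])
  have "- B \<le> log_partition M w" "log_partition M w \<le> B"
    using 1 pos unfolding log_partition_def by (metis ln_exp ln_le_cancel_iff exp_gt_zero)+
  then show ?thesis by simp
qed

lemma (in prob_space) prob_space_gibbs:
  assumes [measurable]: "w \<in> borel_measurable M" and "bounded_on_space M w"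
  shows "prob_space (gibbs M w)"
proof
  let ?Z = "\<integral>t. exp (w t) \<partial>M"
  have Z: "0 < ?Z" by (rule exp_integral_pos[OF assms])
  have int: "integrable M (\<lambda>t. exp (w t) / ?Z)"
    by (intro integrable_divide integrable_exp_bounded assms)
  have "emeasure (gibbs M w) (space (gibbs M w)) = (\<integral>\<^sup>+t. ennreal (exp (w t) / ?Z) \<partial>M)"
    unfolding gibbs_def by (simp add: emeasure_density cong: nn_integral_cong)
  also have "\<dots> = ennreal (\<integral>t. exp (w t) / ?Z \<partial>M)"
    by (rule nn_integral_eq_integral[OF int]) (use Z in auto)
  also have "\<dots> = 1" using Z by simp
  finally show "emeasure (gibbs M w) (space (gibbs M w)) = 1" .
qed

text \<open>
  Tilting by part of the exponent turns the rest into a log-partition function of its own. This is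
  what lets one summand of the process be exchanged while all the others are absorbed in the base
  measure.
\<close>

lemma (in prob_space) log_partition_add:
  assumes [measurable]: "w \<in> borel_measurable M" "v \<in> borel_measurable M"
    and bd: "bounded_on_space M w" "bounded_on_space M v"
  shows "log_partition M (\<lambda>t. w t + v t) = log_partition M w + log_partition (gibbs M w) v"
proof -
  let ?Z = "\<integral>t. exp (w t) \<partial>M"
  have Z: "0 < ?Z" by (rule exp_integral_pos[OF assms(1) bd(1)])
  interpret g: prob_space "gibbs M w" by (rule prob_space_gibbs[OF assms(1) bd(1)])
  have pos: "0 < (\<integral>t. exp (v t) \<partial>gibbs M w)"
    by (rule g.exp_integral_pos) (use bd in \<open>auto simp: bounded_on_space_def\<close>)
  have eq: "(\<integral>t. exp (v t) \<partial>gibbs M w) = (\<integral>t. exp (w t + v t) \<partial>M) / ?Z"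
    unfolding gibbs_def by (subst integral_density) (use Z in \<open>auto simp: exp_add\<close>)
  then have "(\<integral>t. exp (w t + v t) \<partial>M) = ?Z * (\<integral>t. exp (v t) \<partial>gibbs M w)"
    using Z by simp
  then show ?thesis
    unfolding log_partition_def using Z pos by (simp only: ln_mult_pos)
qed

lemma (in prob_space) log_partition_lipschitz:
  assumes [measurable]: "w \<in> borel_measurable M" "v \<in> borel_measurable M"
    and bd: "bounded_on_space M v"
    and D: "\<And>t. t \<in> space M \<Longrightarrow> \<bar>w t - v t\<bar> \<le> D"
  shows "\<bar>log_partition M w - log_partition M v\<bar> \<le> D"
proof -
  interpret g: prob_space "gibbs M v" by (rule prob_space_gibbs[OF _ bd]) simp
  have "log_partition M (\<lambda>t. v t + (w t - v t))
      = log_partition M v + log_partition (gibbs M v) (\<lambda>t. w t - v t)"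
    by (rule log_partition_add[OF _ _ bd bounded_on_spaceI[OF D]]) simp_all
  moreover have "\<bar>log_partition (gibbs M v) (\<lambda>t. w t - v t)\<bar> \<le> D"
    by (rule g.abs_log_partition_le) (use D in auto)
  ultimately show ?thesis by simp
qed


section \<open>Lindeberg exchange for log-partition functions\<close>

text \<open>
  A random field on \<open>space \<tau>\<close> whose log-partition function has a first absolute moment bounded
  uniformly over all base measures; \<open>\<tau>\<close> stands for its measurable sets. By uniformity the sum of
  independent fields of this kind is again one: given the first summand, the second one is seen from
  a Gibbs measure, over which there is no control.
\<close>

definition tame_field :: "'t measure \<Rightarrow> 'a measure \<Rightarrow> ('a \<Rightarrow> 't \<Rightarrow> real) \<Rightarrow> bool" where
  "tame_field \<tau> A f \<longleftrightarrow>
     prob_space A \<and> case_prod f \<in> borel_measurable (A \<Otimes>\<^sub>M \<tau>) \<and>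
     (\<forall>a\<in>space A. bounded_on_space \<tau> (f a)) \<and>
     (\<exists>c. \<forall>\<nu>. prob_space \<nu> \<longrightarrow> sets \<nu> = sets \<tau> \<longrightarrow>
        (\<integral>\<^sup>+a. ennreal \<bar>log_partition \<nu> (f a)\<bar> \<partial>A) \<le> ennreal c)"

lemma measurable_log_partition:
  assumes f: "case_prod f \<in> borel_measurable (A \<Otimes>\<^sub>M \<tau>)"
    and \<nu>: "prob_space \<nu>" "sets \<nu> = sets \<tau>"
  shows "(\<lambda>a. log_partition \<nu> (f a)) \<in> borel_measurable A"
proof -
  interpret prob_space \<nu> by fact
  have "sets (A \<Otimes>\<^sub>M \<nu>) = sets (A \<Otimes>\<^sub>M \<tau>)"
    by (intro sets_pair_measure_cong refl \<nu>)
  then have [measurable]: "case_prod f \<in> borel_measurable (A \<Otimes>\<^sub>M \<nu>)"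
    using f by (simp cong: measurable_cong_sets)
  show ?thesis unfolding log_partition_def by measurable
qed

lemma tame_field_integrable:
  assumes "tame_field \<tau> A f" "prob_space \<nu>" "sets \<nu> = sets \<tau>"
  shows "integrable A (\<lambda>a. log_partition \<nu> (f a))"
proof (rule integrableI_bounded)
  show "(\<lambda>a. log_partition \<nu> (f a)) \<in> borel_measurable A"
    using assms by (intro measurable_log_partition) (auto simp: tame_field_def)
  obtain c where "(\<integral>\<^sup>+a. ennreal \<bar>log_partition \<nu> (f a)\<bar> \<partial>A) \<le> ennreal c"
    using assms unfolding tame_field_def by blast
  then show "(\<integral>\<^sup>+a. ennreal (norm (log_partition \<nu> (f a))) \<partial>A) < \<infinity>"
    by (simp add: order_le_less_trans)
qed

lemma tame_field_section:
  assumes "tame_field \<tau> A f" "a \<in> space A" "sets \<nu> = sets \<tau>"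
  shows "f a \<in> borel_measurable \<nu>" "bounded_on_space \<nu> (f a)"
proof -
  have "case_prod f \<in> borel_measurable (A \<Otimes>\<^sub>M \<tau>)" using assms by (simp add: tame_field_def)
  from measurable_Pair2[OF this assms(2)] have "f a \<in> borel_measurable \<tau>" by simp
  then show "f a \<in> borel_measurable \<nu>" using assms(3) by (simp cong: measurable_cong_sets)
  show "bounded_on_space \<nu> (f a)"
    using assms sets_eq_imp_space_eq[OF assms(3)] by (auto simp: tame_field_def bounded_on_space_def)
qed

lemma log_partition_add_fields:
  assumes "tame_field \<tau> A f" "a \<in> space A" "tame_field \<tau> B g" "b \<in> space B"
    and \<nu>: "prob_space \<nu>" "sets \<nu> = sets \<tau>"
  shows "log_partition \<nu> (\<lambda>t. f a t + g b t)
    = log_partition \<nu> (f a) + log_partition (gibbs \<nu> (f a)) (g b)"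
  by (intro prob_space.log_partition_add[OF \<nu>(1)] tame_field_section[OF assms(1,2) \<nu>(2)]
      tame_field_section[OF assms(3,4) \<nu>(2)])

lemma gibbs_of_field:
  assumes "tame_field \<tau> A f" "a \<in> space A" "prob_space \<nu>" "sets \<nu> = sets \<tau>"
  shows "prob_space (gibbs \<nu> (f a))" "sets (gibbs \<nu> (f a)) = sets \<tau>"
  using assms by (auto intro!: prob_space.prob_space_gibbs dest: tame_field_section)

lemma tame_field_pair:
  assumes f: "tame_field \<tau> A f" and g: "tame_field \<tau> B g"
  shows "tame_field \<tau> (A \<Otimes>\<^sub>M B) (\<lambda>(a, b) t. f a t + g b t)"
proof -
  let ?h = "\<lambda>(a, b) t. f a t + g b t"
  interpret A: prob_space A using f by (simp add: tame_field_def)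
  interpret B: prob_space B using g by (simp add: tame_field_def)
  interpret AB: pair_prob_space A B ..
  obtain c where c: "\<And>\<nu>. prob_space \<nu> \<Longrightarrow> sets \<nu> = sets \<tau> \<Longrightarrow>
      (\<integral>\<^sup>+a. ennreal \<bar>log_partition \<nu> (f a)\<bar> \<partial>A) \<le> ennreal c"
    using f unfolding tame_field_def by blast
  obtain d where d: "\<And>\<nu>. prob_space \<nu> \<Longrightarrow> sets \<nu> = sets \<tau> \<Longrightarrow>
      (\<integral>\<^sup>+b. ennreal \<bar>log_partition \<nu> (g b)\<bar> \<partial>B) \<le> ennreal d"
    using g unfolding tame_field_def by blast
  have [measurable]: "case_prod f \<in> borel_measurable (A \<Otimes>\<^sub>M \<tau>)"
    "case_prod g \<in> borel_measurable (B \<Otimes>\<^sub>M \<tau>)"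
    using f g by (auto simp: tame_field_def)
  have h_meas: "case_prod ?h \<in> borel_measurable ((A \<Otimes>\<^sub>M B) \<Otimes>\<^sub>M \<tau>)"
    unfolding split_beta' by measurable
  have "(\<integral>\<^sup>+p. ennreal \<bar>log_partition \<nu> (?h p)\<bar> \<partial>(A \<Otimes>\<^sub>M B)) \<le> ennreal (max 0 c + max 0 d)"
    if \<nu>: "prob_space \<nu>" "sets \<nu> = sets \<tau>" for \<nu>
  proof -
    have [measurable]: "(\<lambda>p. log_partition \<nu> (?h p)) \<in> borel_measurable (A \<Otimes>\<^sub>M B)"
      by (rule measurable_log_partition[OF h_meas \<nu>])
    have [measurable]: "(\<lambda>a. log_partition \<nu> (f a)) \<in> borel_measurable A"
      by (rule measurable_log_partition[OF _ \<nu>]) simp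
    have "(\<integral>\<^sup>+p. ennreal \<bar>log_partition \<nu> (?h p)\<bar> \<partial>(A \<Otimes>\<^sub>M B))
        = (\<integral>\<^sup>+a. (\<integral>\<^sup>+b. ennreal \<bar>log_partition \<nu> (?h (a, b))\<bar> \<partial>B) \<partial>A)"
      by (rule B.nn_integral_fst[symmetric]) measurable
    also have "\<dots> \<le> (\<integral>\<^sup>+a. ennreal \<bar>log_partition \<nu> (f a)\<bar> + ennreal d \<partial>A)"
    proof (rule nn_integral_mono)
      fix a assume a: "a \<in> space A"
      note gb = gibbs_of_field[OF f a \<nu>]
      have [measurable]: "(\<lambda>b. log_partition (gibbs \<nu> (f a)) (g b)) \<in> borel_measurable B"
        by (rule measurable_log_partition[OF _ gb]) simp
      have "(\<integral>\<^sup>+b. ennreal \<bar>log_partition \<nu> (?h (a, b))\<bar> \<partial>B)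
          \<le> (\<integral>\<^sup>+b. ennreal \<bar>log_partition \<nu> (f a)\<bar> + ennreal \<bar>log_partition (gibbs \<nu> (f a)) (g b)\<bar> \<partial>B)"
        by (intro nn_integral_mono)
          (simp add: log_partition_add_fields[OF f a g _ \<nu>] abs_triangle_ineq flip: ennreal_plus)
      also have "\<dots> = ennreal \<bar>log_partition \<nu> (f a)\<bar>
          + (\<integral>\<^sup>+b. ennreal \<bar>log_partition (gibbs \<nu> (f a)) (g b)\<bar> \<partial>B)"
        by (subst nn_integral_add) (auto simp: B.emeasure_space_1)
      also have "\<dots> \<le> ennreal \<bar>log_partition \<nu> (f a)\<bar> + ennreal d"
        by (intro add_left_mono d gb)
      finally show "(\<integral>\<^sup>+b. ennreal \<bar>log_partition \<nu> (?h (a, b))\<bar> \<partial>B)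
          \<le> ennreal \<bar>log_partition \<nu> (f a)\<bar> + ennreal d" .
    qed
    also have "\<dots> = (\<integral>\<^sup>+a. ennreal \<bar>log_partition \<nu> (f a)\<bar> \<partial>A) + ennreal d"
      by (subst nn_integral_add) (auto simp: A.emeasure_space_1)
    also have "\<dots> \<le> ennreal c + ennreal d" by (intro add_right_mono c \<nu>)
    also have "\<dots> \<le> ennreal (max 0 c + max 0 d)"
      by (auto simp: ennreal_plus max_def ennreal_neg not_le intro!: add_mono)
    finally show ?thesis .
  qed
  moreover have "bounded_on_space \<tau> (?h p)" if "p \<in> space (A \<Otimes>\<^sub>M B)" for p
    using that f g by (auto simp: space_pair_measure tame_field_def intro!: bounded_on_space_add)
  moreover have "prob_space (A \<Otimes>\<^sub>M B)"
    by (rule prob_space_pair) unfold_locales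
  ultimately show ?thesis using h_meas unfolding tame_field_def by blast
qed

lemma integral_pair_field:
  assumes f: "tame_field \<tau> A f" and g: "tame_field \<tau> B g" and \<nu>: "prob_space \<nu>" "sets \<nu> = sets \<tau>"
  defines "h \<equiv> \<lambda>a. log_partition \<nu> (f a) + (\<integral>b. log_partition (gibbs \<nu> (f a)) (g b) \<partial>B)"
  shows "(\<integral>p. log_partition \<nu> (\<lambda>t. f (fst p) t + g (snd p) t) \<partial>(A \<Otimes>\<^sub>M B)) = (\<integral>a. h a \<partial>A)"
    and "integrable A h"
proof -
  interpret A: prob_space A using f by (simp add: tame_field_def)
  interpret B: prob_space B using g by (simp add: tame_field_def)
  interpret AB: pair_prob_space A B ..
  have int: "integrable (A \<Otimes>\<^sub>M B) (\<lambda>p. log_partition \<nu> (\<lambda>t. f (fst p) t + g (snd p) t))"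
    using tame_field_integrable[OF tame_field_pair[OF f g] \<nu>] by (simp add: split_beta')
  have inner: "(\<integral>b. log_partition \<nu> (\<lambda>t. f a t + g b t) \<partial>B) = h a" if a: "a \<in> space A" for a
  proof -
    have "(\<integral>b. log_partition \<nu> (\<lambda>t. f a t + g b t) \<partial>B)
        = (\<integral>b. log_partition \<nu> (f a) + log_partition (gibbs \<nu> (f a)) (g b) \<partial>B)"
      by (intro Bochner_Integration.integral_cong refl log_partition_add_fields[OF f a g _ \<nu>])
    also have "\<dots> = h a"
      unfolding h_def by (subst Bochner_Integration.integral_add)
        (auto intro!: tame_field_integrable[OF g gibbs_of_field[OF f a \<nu>]] simp: B.prob_space)
    finally show ?thesis .
  qed
  have "integrable A (\<lambda>a. \<integral>b. log_partition \<nu> (\<lambda>t. f a t + g b t) \<partial>B)"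
    using AB.integrable_fst'[OF int] by simp
  then show "integrable A h" using inner by (simp cong: Bochner_Integration.integrable_cong)
  show "(\<integral>p. log_partition \<nu> (\<lambda>t. f (fst p) t + g (snd p) t) \<partial>(A \<Otimes>\<^sub>M B)) = (\<integral>a. h a \<partial>A)"
    using AB.integral_fst'[OF int] inner by (simp cong: Bochner_Integration.integral_cong)
qed

text \<open>
  Given the other component, the exchanged one only sees a Gibbs measure as its base measure, so the
  cost is the average of costs that are bounded uniformly.
\<close>

lemma exchange_second:
  assumes f: "tame_field \<tau> A f" and g: "tame_field \<tau> B g" and g': "tame_field \<tau> B' g'"
    and \<nu>: "prob_space \<nu>" "sets \<nu> = sets \<tau>"
    and cost: "\<And>\<nu>. prob_space \<nu> \<Longrightarrow> sets \<nu> = sets \<tau> \<Longrightarrow>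
      \<bar>(\<integral>b. log_partition \<nu> (g b) \<partial>B) - (\<integral>b. log_partition \<nu> (g' b) \<partial>B')\<bar> \<le> \<epsilon>"
  shows "\<bar>(\<integral>p. log_partition \<nu> (\<lambda>t. f (fst p) t + g (snd p) t) \<partial>(A \<Otimes>\<^sub>M B))
    - (\<integral>p. log_partition \<nu> (\<lambda>t. f (fst p) t + g' (snd p) t) \<partial>(A \<Otimes>\<^sub>M B'))\<bar> \<le> \<epsilon>"
proof -
  interpret A: prob_space A using f by (simp add: tame_field_def)
  let ?G = "\<lambda>a. \<integral>b. log_partition (gibbs \<nu> (f a)) (g b) \<partial>B"
  let ?G' = "\<lambda>a. \<integral>b. log_partition (gibbs \<nu> (f a)) (g' b) \<partial>B'"
  note i = integral_pair_field[OF f g \<nu>] and i' = integral_pair_field[OF f g' \<nu>]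
  have diff: "integrable A (\<lambda>a. ?G a - ?G' a)"
    using Bochner_Integration.integrable_diff[OF i(2) i'(2)] by simp
  have "\<bar>?G a - ?G' a\<bar> \<le> \<epsilon>" if "a \<in> space A" for a
    by (rule cost[OF gibbs_of_field[OF f that \<nu>]])
  then have "\<And>a. a \<in> space A \<Longrightarrow> - \<epsilon> \<le> ?G a - ?G' a" "\<And>a. a \<in> space A \<Longrightarrow> ?G a - ?G' a \<le> \<epsilon>"
    by (force simp: abs_le_iff)+
  from A.integral_between[OF diff this] have "\<bar>\<integral>a. ?G a - ?G' a \<partial>A\<bar> \<le> \<epsilon>" by (simp add: abs_le_iff)
  then show ?thesis
    unfolding i(1) i'(1) Bochner_Integration.integral_diff[OF i(2) i'(2), symmetric] by simp
qed

lemma exchange_first: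
  assumes f: "tame_field \<tau> A f" and g: "tame_field \<tau> B g" and g': "tame_field \<tau> B' g'"
    and \<nu>: "prob_space \<nu>" "sets \<nu> = sets \<tau>"
    and cost: "\<And>\<nu>. prob_space \<nu> \<Longrightarrow> sets \<nu> = sets \<tau> \<Longrightarrow>
      \<bar>(\<integral>b. log_partition \<nu> (g b) \<partial>B) - (\<integral>b. log_partition \<nu> (g' b) \<partial>B')\<bar> \<le> \<epsilon>"
  shows "\<bar>(\<integral>p. log_partition \<nu> (\<lambda>t. g (fst p) t + f (snd p) t) \<partial>(B \<Otimes>\<^sub>M A))
    - (\<integral>p. log_partition \<nu> (\<lambda>t. g' (fst p) t + f (snd p) t) \<partial>(B' \<Otimes>\<^sub>M A))\<bar> \<le> \<epsilon>"
proof -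
  have swap: "(\<integral>p. log_partition \<nu> (\<lambda>t. h (fst p) t + f (snd p) t) \<partial>(C \<Otimes>\<^sub>M A))
      = (\<integral>p. log_partition \<nu> (\<lambda>t. f (fst p) t + h (snd p) t) \<partial>(A \<Otimes>\<^sub>M C))"
    if h: "tame_field \<tau> C h" for C :: "'z measure" and h
  proof -
    interpret A: prob_space A using f by (simp add: tame_field_def)
    interpret C: prob_space C using h by (simp add: tame_field_def)
    interpret AC: pair_prob_space A C ..
    have "(\<lambda>p. log_partition \<nu> (\<lambda>t. f (fst p) t + h (snd p) t)) \<in> borel_measurable (A \<Otimes>\<^sub>M C)"
      using borel_measurable_integrable[OF tame_field_integrable[OF tame_field_pair[OF f h] \<nu>]]
      by (simp add: split_beta')
    from AC.integral_product_swap[OF this] show ?thesis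
      by (simp add: split_beta' add.commute)
  qed
  show ?thesis unfolding swap[OF g] swap[OF g'] by (rule exchange_second[OF assms])
qed

definition sum_field :: "'i set \<Rightarrow> ('i \<Rightarrow> 'a \<Rightarrow> 't \<Rightarrow> real) \<Rightarrow> ('i \<Rightarrow> 'a) \<Rightarrow> 't \<Rightarrow> real" where
  "sum_field I f x t = (\<Sum>i\<in>I. f i (x i) t)"

lemma sum_field_insert:
  assumes "finite I" "i \<notin> I"
  shows "sum_field (insert i I) f (x(i := a)) = (\<lambda>t. f i a t + sum_field I f x t)"
proof -
  have "(\<Sum>j\<in>I. f j ((x(i := a)) j) t) = (\<Sum>j\<in>I. f j (x j) t)" for t
    by (rule sum.cong) (use assms in auto)
  then show ?thesis using assms by (auto simp: sum_field_def fun_eq_iff)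
qed

lemma sum_field_PiM_insert:
  assumes "finite I" "i \<notin> I" and prob: "\<And>j. j \<in> insert i I \<Longrightarrow> tame_field \<tau> (A j) (f j)"
    and sum: "tame_field \<tau> (PiM I A) (sum_field I f)"
  shows tame_field_sum_insert: "tame_field \<tau> (PiM (insert i I) A) (sum_field (insert i I) f)"
    and integral_sum_insert: "prob_space \<nu> \<Longrightarrow> sets \<nu> = sets \<tau> \<Longrightarrow>
      (\<integral>x. log_partition \<nu> (sum_field (insert i I) f x) \<partial>PiM (insert i I) A)
      = (\<integral>p. log_partition \<nu> (\<lambda>t. f i (fst p) t + sum_field I f (snd p) t) \<partial>(A i \<Otimes>\<^sub>M PiM I A))"
proof -
  let ?J = "insert i I"
  let ?up = "\<lambda>(a, x). x(i := a)"
  have P: "PiM ?J A = distr (A i \<Otimes>\<^sub>M PiM I A) (PiM ?J A) ?up"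
    by (rule distr_pair_PiM_eq_PiM[symmetric]) (use prob in \<open>auto simp: tame_field_def\<close>)
  have up: "?up \<in> measurable (A i \<Otimes>\<^sub>M PiM I A) (PiM ?J A)"
    unfolding split_beta' by (intro measurable_fun_upd[where J=I]) auto
  have pJ: "prob_space (PiM ?J A)"
    by (rule prob_space_PiM) (use prob in \<open>auto simp: tame_field_def\<close>)
  have meas: "case_prod (sum_field ?J f) \<in> borel_measurable (PiM ?J A \<Otimes>\<^sub>M \<tau>)"
  proof -
    have "(\<lambda>p. \<Sum>j\<in>?J. f j (fst p j) (snd p)) \<in> borel_measurable (PiM ?J A \<Otimes>\<^sub>M \<tau>)"
    proof (rule borel_measurable_sum)
      fix j assume j: "j \<in> ?J"
      have [measurable]: "case_prod (f j) \<in> borel_measurable (A j \<Otimes>\<^sub>M \<tau>)"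
        using prob[OF j] by (simp add: tame_field_def)
      have [measurable]: "(\<lambda>x. x j) \<in> measurable (PiM ?J A) (A j)"
        by (rule measurable_component_singleton[OF j])
      show "(\<lambda>p. f j (fst p j) (snd p)) \<in> borel_measurable (PiM ?J A \<Otimes>\<^sub>M \<tau>)" by measurable
    qed
    then show ?thesis by (simp add: split_beta' sum_field_def)
  qed
  have LP: "(\<lambda>x. log_partition \<nu> (sum_field ?J f x)) \<in> borel_measurable (PiM ?J A)"
    if "prob_space \<nu>" "sets \<nu> = sets \<tau>" for \<nu>
    by (rule measurable_log_partition[OF meas that])
  have comp: "sum_field ?J f (?up p) = (\<lambda>t. f i (fst p) t + sum_field I f (snd p) t)" for p
    using sum_field_insert[OF assms(1,2)] by (simp add: split_beta')
  show "(\<integral>x. log_partition \<nu> (sum_field ?J f x) \<partial>PiM ?J A)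
      = (\<integral>p. log_partition \<nu> (\<lambda>t. f i (fst p) t + sum_field I f (snd p) t) \<partial>(A i \<Otimes>\<^sub>M PiM I A))"
    if "prob_space \<nu>" "sets \<nu> = sets \<tau>" for \<nu>
    by (subst P, subst integral_distr[OF up LP[OF that]]) (simp add: comp)
  have pair: "tame_field \<tau> (A i \<Otimes>\<^sub>M PiM I A) (\<lambda>(a, x) t. f i a t + sum_field I f x t)"
    by (rule tame_field_pair[OF prob sum]) simp
  then obtain c where c: "\<And>\<nu>. prob_space \<nu> \<Longrightarrow> sets \<nu> = sets \<tau> \<Longrightarrow>
      (\<integral>\<^sup>+p. ennreal \<bar>log_partition \<nu> ((\<lambda>(a, x) t. f i a t + sum_field I f x t) p)\<bar>
        \<partial>(A i \<Otimes>\<^sub>M PiM I A)) \<le> ennreal c"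
    unfolding tame_field_def by blast
  have "(\<integral>\<^sup>+x. ennreal \<bar>log_partition \<nu> (sum_field ?J f x)\<bar> \<partial>PiM ?J A) \<le> ennreal c"
    if \<nu>: "prob_space \<nu>" "sets \<nu> = sets \<tau>" for \<nu>
  proof -
    have "(\<integral>\<^sup>+x. ennreal \<bar>log_partition \<nu> (sum_field ?J f x)\<bar> \<partial>PiM ?J A)
        = (\<integral>\<^sup>+p. ennreal \<bar>log_partition \<nu> (sum_field ?J f (?up p))\<bar> \<partial>(A i \<Otimes>\<^sub>M PiM I A))"
      by (subst P, subst nn_integral_distr[OF up]) (use LP[OF \<nu>] in auto)
    then show ?thesis using c[OF \<nu>] by (simp only: comp) (simp add: split_beta')
  qed
  moreover have "bounded_on_space \<tau> (sum_field ?J f x)" if x: "x \<in> space (PiM ?J A)" for x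
  proof -
    have "\<exists>B. \<forall>t\<in>space \<tau>. \<bar>f j (x j) t\<bar> \<le> B" if j: "j \<in> ?J" for j
      using tame_field_section(2)[OF prob[OF j] _ refl, of "x j"] PiE_mem[OF x[unfolded space_PiM] j]
      by (simp add: bounded_on_space_def)
    then obtain B where B: "\<And>j t. j \<in> ?J \<Longrightarrow> t \<in> space \<tau> \<Longrightarrow> \<bar>f j (x j) t\<bar> \<le> B j" by metis
    show ?thesis unfolding sum_field_def
      by (rule bounded_on_spaceI[where B="\<Sum>j\<in>?J. B j"], rule order_trans[OF sum_abs sum_mono])
        (use B in auto)
  qed
  ultimately show "tame_field \<tau> (PiM ?J A) (sum_field ?J f)"
    using meas pJ unfolding tame_field_def by blast
qed

lemma tame_field_sum:
  assumes "finite I" "\<And>i. i \<in> I \<Longrightarrow> tame_field \<tau> (A i) (f i)"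
  shows "tame_field \<tau> (PiM I A) (sum_field I f)"
  using assms
proof (induction I rule: finite_induct)
  case empty
  have "log_partition \<nu> (\<lambda>t. 0) = 0" if "prob_space \<nu>" for \<nu>
    using that by (simp add: log_partition_def prob_space.prob_space)
  then show ?case
    by (auto simp: tame_field_def bounded_on_space_def split_beta' sum_field_def [abs_def]
        intro!: prob_space_PiM exI[of _ 0])
next
  case (insert i I)
  show ?case by (rule tame_field_sum_insert) (use insert in auto)
qed

text \<open>
  One component is exchanged at a time. In the induction the new component is exchanged against the
  unchanged sum of the others, and then the sum of the others, by the induction hypothesis at every
  base measure, against the already exchanged component.
\<close>

theorem lindeberg_exchange:
  assumes "finite I"
    and "\<And>i. i \<in> I \<Longrightarrow> tame_field \<tau> (A i) (f i)" "\<And>i. i \<in> I \<Longrightarrow> tame_field \<tau> (B i) (g i)"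
    and "\<And>i \<nu>. i \<in> I \<Longrightarrow> prob_space \<nu> \<Longrightarrow> sets \<nu> = sets \<tau> \<Longrightarrow>
      \<bar>(\<integral>a. log_partition \<nu> (f i a) \<partial>A i) - (\<integral>b. log_partition \<nu> (g i b) \<partial>B i)\<bar> \<le> \<epsilon> i"
    and "prob_space \<nu>" "sets \<nu> = sets \<tau>"
  shows "\<bar>(\<integral>x. log_partition \<nu> (sum_field I f x) \<partial>PiM I A)
    - (\<integral>y. log_partition \<nu> (sum_field I g y) \<partial>PiM I B)\<bar> \<le> (\<Sum>i\<in>I. \<epsilon> i)"
  using assms
proof (induction I arbitrary: \<nu> rule: finite_induct)
  case empty
  then show ?case by (simp add: log_partition_def sum_field_def prob_space.prob_space)
next
  case (insert i I)
  note \<nu> = insert.prems(4,5)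
  have f: "\<And>j. j \<in> insert i I \<Longrightarrow> tame_field \<tau> (A j) (f j)"
    and g: "\<And>j. j \<in> insert i I \<Longrightarrow> tame_field \<tau> (B j) (g j)" using insert.prems by auto
  have F: "tame_field \<tau> (PiM I A) (sum_field I f)" and G: "tame_field \<tau> (PiM I B) (sum_field I g)"
    using insert f g by (auto intro: tame_field_sum)
  let ?m = "\<integral>p. log_partition \<nu> (\<lambda>t. g i (fst p) t + sum_field I f (snd p) t) \<partial>(B i \<Otimes>\<^sub>M PiM I A)"
  have 1: "\<bar>(\<integral>p. log_partition \<nu> (\<lambda>t. f i (fst p) t + sum_field I f (snd p) t) \<partial>(A i \<Otimes>\<^sub>M PiM I A)) - ?m\<bar>
      \<le> \<epsilon> i"
    by (rule exchange_first[OF F f g \<nu> insert.prems(3)]) auto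
  have 2: "\<bar>?m - (\<integral>p. log_partition \<nu> (\<lambda>t. g i (fst p) t + sum_field I g (snd p) t) \<partial>(B i \<Otimes>\<^sub>M PiM I B))\<bar>
      \<le> (\<Sum>i\<in>I. \<epsilon> i)"
    by (rule exchange_second[OF g F G \<nu>]) (use insert in auto)
  show ?case
    unfolding integral_sum_insert[OF insert.hyps(1,2) f F \<nu>, simplified]
      integral_sum_insert[OF insert.hyps(1,2) g G \<nu>, simplified]
    using 1 2 insert.hyps by simp
qed


section \<open>Third-order expansions\<close>

lemma exp_taylor_bounds:
  fixes x :: real
  shows "\<bar>exp x - 1\<bar> \<le> \<bar>x\<bar> * exp \<bar>x\<bar>"
    and "\<bar>exp x - 1 - x\<bar> \<le> x\<^sup>2 * exp \<bar>x\<bar> / 2"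
    and "\<bar>exp x - 1 - x - x\<^sup>2 / 2\<bar> \<le> \<bar>x\<bar> ^ 3 * exp \<bar>x\<bar> / 6"
proof -
  have rem: "\<bar>exp x - (\<Sum>m<n. x ^ m / fact m)\<bar> \<le> \<bar>x\<bar> ^ n * exp \<bar>x\<bar> / fact n" for n
  proof -
    obtain t where t: "\<bar>t\<bar> \<le> \<bar>x\<bar>" "exp x = (\<Sum>m<n. x ^ m / fact m) + exp t / fact n * x ^ n"
      using Maclaurin_exp_le by blast
    have "exp t \<le> exp \<bar>x\<bar>" using t(1) by simp
    then have "\<bar>x\<bar> ^ n * exp t / fact n \<le> \<bar>x\<bar> ^ n * exp \<bar>x\<bar> / fact n"
      by (intro divide_right_mono mult_left_mono) auto
    then show ?thesis by (simp add: t(2) abs_mult power_abs mult.commute)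
  qed
  show "\<bar>exp x - 1\<bar> \<le> \<bar>x\<bar> * exp \<bar>x\<bar>"
    using rem[of 1] by simp
  show "\<bar>exp x - 1 - x\<bar> \<le> x\<^sup>2 * exp \<bar>x\<bar> / 2"
    using rem[of 2] by (simp add: eval_nat_numeral algebra_simps)
  show "\<bar>exp x - 1 - x - x\<^sup>2 / 2\<bar> \<le> \<bar>x\<bar> ^ 3 * exp \<bar>x\<bar> / 6"
    using rem[of 3] by (simp add: eval_nat_numeral algebra_simps)
qed

lemma nonpos_from_derivative_sign:
  fixes f f' :: "real \<Rightarrow> real"
  assumes "-1 < z" "f 0 = 0"
    and der: "\<And>y. -1 < y \<Longrightarrow> (f has_real_derivative f' y) (at y)"
    and neg: "\<And>y. 0 \<le> y \<Longrightarrow> f' y \<le> 0" and pos: "\<And>y. -1 < y \<Longrightarrow> y \<le> 0 \<Longrightarrow> 0 \<le> f' y"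
  shows "f z \<le> 0"
proof (cases "0 \<le> z")
  case True
  have "f z \<le> f 0"
    by (rule DERIV_nonpos_imp_nonincreasing[OF True])
      (meson der neg order_less_le_trans neg_less_0_iff_less zero_less_one)
  then show ?thesis using assms by simp
next
  case False
  have "f z \<le> f 0"
  proof (rule DERIV_nonneg_imp_nondecreasing[of z 0 f])
    show "z \<le> 0" using False by simp
    show "\<exists>d. (f has_real_derivative d) (at y) \<and> 0 \<le> d" if "z \<le> y" "y \<le> 0" for y
      using der[of y] pos[of y] that assms(1) by (intro exI[of _ "f' y"]) simp
  qed
  then show ?thesis using assms by simp
qed

text \<open>
  The factor \<open>1 / (1 + z)\<close> cannot be avoided as \<open>z\<close> approaches \<open>-1\<close>; for a partition function
  \<open>1 + z\<close> it is controlled by Jensen's inequality.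
\<close>

lemma ln_taylor_bound:
  fixes z :: real
  assumes z: "-1 < z"
  shows "\<bar>ln (1 + z) - z + z\<^sup>2 / 2\<bar> \<le> \<bar>z\<bar> ^ 3 * (1 + 1 / (1 + z)) / 3"
proof -
  have "ln (1 + z) - z + z\<^sup>2 / 2 - z ^ 3 / 3 \<le> 0"
  proof (rule nonpos_from_derivative_sign[where f'="\<lambda>y. - (y ^ 3) / (1 + y)", OF z])
    fix y :: real assume y: "-1 < y"
    show "((\<lambda>z. ln (1 + z) - z + z\<^sup>2 / 2 - z ^ 3 / 3) has_real_derivative - (y ^ 3) / (1 + y)) (at y)"
      using y by (auto intro!: derivative_eq_intros simp: field_simps power2_eq_square power3_eq_cube)
  qed (auto simp: divide_le_0_iff power_le_zero_eq)
  moreover have "z ^ 3 / (3 * (1 + z)) - (ln (1 + z) - z + z\<^sup>2 / 2) \<le> 0"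
  proof (rule nonpos_from_derivative_sign[where f'="\<lambda>y. - (y ^ 3) / (3 * (1 + y)\<^sup>2)", OF z])
    fix y :: real assume y: "-1 < y"
    have "((\<lambda>z. z ^ 3 / (3 * (1 + z)) - (ln (1 + z) - z + z\<^sup>2 / 2)) has_real_derivative
        (3 * y\<^sup>2 * (3 * (1 + y)) - y ^ 3 * 3) / (3 * (1 + y))\<^sup>2 - (1 / (1 + y) - 1 + y)) (at y)"
      using y by (auto intro!: derivative_eq_intros simp: power2_eq_square)
    moreover have "(3 * y\<^sup>2 * (3 * (1 + y)) - y ^ 3 * 3) / (3 * (1 + y))\<^sup>2 - (1 / (1 + y) - 1 + y)
        = - (y ^ 3) / (3 * (1 + y)\<^sup>2)"
    proof -
      define u where "u = 1 + y"
      have "u \<noteq> 0" "y = u - 1" using y by (auto simp: u_def)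
      then show ?thesis
        unfolding u_def[symmetric]
        by (simp add: divide_simps) (simp add: power2_eq_square power3_eq_cube algebra_simps)
    qed
    ultimately show "((\<lambda>z. z ^ 3 / (3 * (1 + z)) - (ln (1 + z) - z + z\<^sup>2 / 2)) has_real_derivative
        - (y ^ 3) / (3 * (1 + y)\<^sup>2)) (at y)" by simp
  qed (auto simp: divide_le_0_iff power_le_zero_eq)
  moreover have "\<bar>z ^ 3 / 3\<bar> + \<bar>z ^ 3 / (3 * (1 + z))\<bar> = \<bar>z\<bar> ^ 3 * (1 + 1 / (1 + z)) / 3"
    using z by (simp add: power_abs abs_mult divide_simps) (simp add: algebra_simps)
  ultimately show ?thesis by linarith
qed

lemma cubic_tangent:
  fixes x c :: real
  assumes "0 \<le> x" "0 \<le> c"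
  shows "3 * c\<^sup>2 * x \<le> x ^ 3 + 2 * c ^ 3"
proof -
  have "0 \<le> (x - c)\<^sup>2 * (x + 2 * c)" using assms by simp
  also have "\<dots> = x ^ 3 + 2 * c ^ 3 - 3 * c\<^sup>2 * x"
    by (simp add: power2_eq_square power3_eq_cube algebra_simps)
  finally show ?thesis by simp
qed

text \<open>
  Both are integrals of the tangent inequality at the mean; they stand in for the power mean and
  Lyapunov inequalities.
\<close>

lemma (in prob_space) cube_moment_inequalities:
  fixes f :: "'a \<Rightarrow> real"
  assumes f0: "\<And>t. t \<in> space M \<Longrightarrow> 0 \<le> f t"
    and int: "integrable M f" "integrable M (\<lambda>t. (f t)\<^sup>2)" "integrable M (\<lambda>t. f t ^ 3)"
  shows "(\<integral>t. f t \<partial>M) ^ 3 \<le> (\<integral>t. f t ^ 3 \<partial>M)"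
    and "(\<integral>t. (f t)\<^sup>2 \<partial>M) * (\<integral>t. f t \<partial>M) \<le> (\<integral>t. f t ^ 3 \<partial>M)"
proof -
  let ?c = "\<integral>t. f t \<partial>M"
  have c: "0 \<le> ?c" using f0 by (intro Bochner_Integration.integral_nonneg) auto
  have "(\<integral>t. 3 * ?c\<^sup>2 * f t \<partial>M) \<le> (\<integral>t. f t ^ 3 + 2 * ?c ^ 3 \<partial>M)"
    by (rule integral_mono) (use int cubic_tangent f0 c in auto)
  then show 1: "?c ^ 3 \<le> (\<integral>t. f t ^ 3 \<partial>M)"
    using int by (simp add: prob_space power3_eq_cube power2_eq_square)
  have "(\<integral>t. 3 * ?c * (f t)\<^sup>2 \<partial>M) \<le> (\<integral>t. ?c ^ 3 + 2 * f t ^ 3 \<partial>M)"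
  proof (rule integral_mono)
    fix t assume "t \<in> space M"
    then show "3 * ?c * (f t)\<^sup>2 \<le> ?c ^ 3 + 2 * f t ^ 3"
      using cubic_tangent[OF c f0[of t]] by (simp add: mult_ac)
  qed (use int in auto)
  then show "(\<integral>t. (f t)\<^sup>2 \<partial>M) * ?c \<le> (\<integral>t. f t ^ 3 \<partial>M)"
    using int 1 by (simp add: prob_space mult.commute)
qed

lemma (in prob_space) square_integral_le:
  fixes f :: "'a \<Rightarrow> real"
  assumes int: "integrable M f" "integrable M (\<lambda>t. (f t)\<^sup>2)"
  shows "(\<integral>t. f t \<partial>M)\<^sup>2 \<le> (\<integral>t. (f t)\<^sup>2 \<partial>M)"
proof -
  let ?c = "\<integral>t. f t \<partial>M"
  have "(\<integral>t. 2 * ?c * f t \<partial>M) \<le> (\<integral>t. ?c\<^sup>2 + (f t)\<^sup>2 \<partial>M)"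
  proof (rule integral_mono)
    show "2 * ?c * f t \<le> ?c\<^sup>2 + (f t)\<^sup>2" for t using sum_squares_bound[of ?c "f t"] by simp
  qed (use int in auto)
  then show ?thesis using int by (simp add: prob_space power2_eq_square)
qed

text \<open>
  The error of the expansion of the log-partition function by the first two cumulants of \<open>w\<close> under \<open>\<nu>\<close>.
\<close>

definition cumulant_remainder :: "'t measure \<Rightarrow> ('t \<Rightarrow> real) \<Rightarrow> real" where
  "cumulant_remainder \<nu> w =
     log_partition \<nu> w - (\<integral>t. w t \<partial>\<nu>) - ((\<integral>t. (w t)\<^sup>2 \<partial>\<nu>) - (\<integral>t. w t \<partial>\<nu>)\<^sup>2) / 2"

lemma (in prob_space) exp_mean_le:
  assumes [measurable]: "w \<in> borel_measurable M" and bd: "bounded_on_space M w"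
  shows "exp (\<integral>t. w t \<partial>M) \<le> (\<integral>t. exp (w t :: real) \<partial>M)"
proof -
  let ?m = "\<integral>t. w t \<partial>M"
  have w: "integrable M w" by (rule integrable_of_bounded[OF assms])
  have "(\<integral>t. exp ?m * (1 + (w t - ?m)) \<partial>M) \<le> (\<integral>t. exp (w t) \<partial>M)"
  proof (rule integral_mono)
    show "exp ?m * (1 + (w t - ?m)) \<le> exp (w t)" for t
      using mult_left_mono[OF exp_ge_add_one_self[of "w t - ?m"], of "exp ?m"]
      by (simp add: exp_diff)
  qed (use w integrable_exp_bounded[OF assms] in auto)
  then show ?thesis using w by (simp add: prob_space algebra_simps)
qed

text \<open>
  Only integrals over \<open>t\<close> enter, no supremum. For a Gaussian field this makes the bound a matter of
  one-dimensional exponential moments.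
\<close>

lemma (in prob_space) cumulant_remainder_le:
  assumes [measurable]: "w \<in> borel_measurable M" and bd: "bounded_on_space M w"
  shows "\<bar>cumulant_remainder M w\<bar>
    \<le> 2 * (\<integral>t. \<bar>w t\<bar> ^ 3 * exp (3 * \<bar>w t\<bar>) \<partial>M) * (\<integral>t. exp \<bar>w t\<bar> \<partial>M)"
proof -
  obtain B where B: "\<And>t. t \<in> space M \<Longrightarrow> \<bar>w t\<bar> \<le> B" using bd by (auto simp: bounded_on_space_def)
  obtain t0 where "t0 \<in> space M" using not_empty by auto
  then have B0: "0 \<le> B" using B[of t0] by simp
  \<comment> \<open>Every integrand below is a monomial in \<open>\<bar>w\<bar>\<close> times an exponential.\<close>
  have int: "integrable M (\<lambda>t. \<bar>w t\<bar> ^ i * exp (c * \<bar>w t\<bar>))" if "0 \<le> c" for i and c :: real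
  proof (rule integrable_of_bounded)
    show "bounded_on_space M (\<lambda>t. \<bar>w t\<bar> ^ i * exp (c * \<bar>w t\<bar>))"
      by (rule bounded_on_spaceI[where B="B ^ i * exp (c * B)"])
        (use B B0 that in \<open>auto simp: abs_mult intro!: mult_mono power_mono mult_left_mono\<close>)
  qed measurable
  let ?I = "\<integral>t. exp (w t) \<partial>M" and ?m = "\<integral>t. w t \<partial>M" and ?q = "\<integral>t. (w t)\<^sup>2 \<partial>M"
  define f where "f t = \<bar>w t\<bar> * exp \<bar>w t\<bar>" for t
  let ?J = "\<integral>t. \<bar>w t\<bar> ^ 3 * exp (3 * \<bar>w t\<bar>) \<partial>M" and ?K = "\<integral>t. exp \<bar>w t\<bar> \<partial>M"
  have fpow: "f t ^ i = \<bar>w t\<bar> ^ i * exp (real i * \<bar>w t\<bar>)" for t i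
    by (simp add: f_def power_mult_distrib exp_of_nat_mult)
  have intf: "integrable M (\<lambda>t. f t ^ i)" for i
    unfolding fpow by (rule int) simp
  have intw: "integrable M w" by (rule integrable_of_bounded[OF assms])
  have intw2: "integrable M (\<lambda>t. (w t)\<^sup>2)" using int[of 0 2] by simp
  have intE: "integrable M (\<lambda>t. exp (w t))" by (rule integrable_exp_bounded[OF assms])
  have intK: "integrable M (\<lambda>t. exp \<bar>w t\<bar>)" using int[of 1 0] by simp
  have f0: "0 \<le> f t" for t by (simp add: f_def)
  have J: "?J = (\<integral>t. f t ^ 3 \<partial>M)" by (simp add: fpow)
  have Ff: "integrable M f" using intf[of 1] by simp
  note cube = cube_moment_inequalities[OF f0 Ff intf intf]
  let ?F = "\<integral>t. f t \<partial>M"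
  have F0: "0 \<le> ?F" using f0 by simp
  have K1: "1 \<le> ?K"
    using integral_mono[OF _ intK, of "\<lambda>_. 1"] by (simp add: prob_space)
  have J0: "0 \<le> ?J" by simp
  define z where "z = ?I - 1"
  have I: "0 < ?I" by (rule exp_integral_pos[OF assms])
  have inv: "1 / ?I \<le> ?K"
  proof -
    have "1 / ?I \<le> 1 / exp ?m" using exp_mean_le[OF assms] by (simp add: frac_le)
    also have "\<dots> = exp (\<integral>t. - w t \<partial>M)" by (simp add: exp_minus divide_inverse)
    also have "\<dots> \<le> (\<integral>t. exp (- w t) \<partial>M)"
      by (rule exp_mean_le) (use bd in \<open>auto simp: bounded_on_space_def\<close>)
    also have "\<dots> \<le> ?K"
      by (rule integral_mono[OF integrable_exp_bounded intK])
        (use bd in \<open>auto simp: bounded_on_space_def\<close>)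
    finally show ?thesis .
  qed
  have zF: "\<bar>z\<bar> \<le> ?F"
  proof -
    have "z = (\<integral>t. exp (w t) - 1 \<partial>M)" using intE by (simp add: z_def prob_space)
    also have "\<bar>\<dots>\<bar> \<le> (\<integral>t. \<bar>exp (w t) - 1\<bar> \<partial>M)" by simp
    also have "\<dots> \<le> ?F"
    proof (rule integral_mono)
      show "\<bar>exp (w t) - 1\<bar> \<le> f t" for t
        using exp_taylor_bounds(1)[of "w t"] by (simp add: f_def)
    qed (use intE Ff in auto)
    finally show ?thesis .
  qed
  have mF: "\<bar>?m\<bar> \<le> ?F"
  proof -
    have "\<bar>?m\<bar> \<le> (\<integral>t. \<bar>w t\<bar> \<partial>M)" by simp
    also have "\<dots> \<le> ?F"
    proof (rule integral_mono)
      show "\<bar>w t\<bar> \<le> f t" for t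
        using mult_left_mono[of 1 "exp \<bar>w t\<bar>" "\<bar>w t\<bar>"] by (simp add: f_def)
    qed (use intw Ff in auto)
    finally show ?thesis .
  qed
  have zm: "\<bar>z - ?m\<bar> \<le> (\<integral>t. (f t)\<^sup>2 \<partial>M) / 2"
  proof -
    have "z - ?m = (\<integral>t. exp (w t) - 1 - w t \<partial>M)" using intE intw by (simp add: z_def prob_space)
    also have "\<bar>\<dots>\<bar> \<le> (\<integral>t. \<bar>exp (w t) - 1 - w t\<bar> \<partial>M)" by simp
    also have "\<dots> \<le> (\<integral>t. (f t)\<^sup>2 / 2 \<partial>M)"
    proof (rule integral_mono)
      fix t
      have "(w t)\<^sup>2 * exp \<bar>w t\<bar> \<le> (w t)\<^sup>2 * exp (2 * \<bar>w t\<bar>)" by (intro mult_left_mono) auto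
      then show "\<bar>exp (w t) - 1 - w t\<bar> \<le> (f t)\<^sup>2 / 2"
        using exp_taylor_bounds(2)[of "w t"] fpow[of t 2] by simp
    qed (use intE intw intf in auto)
    finally show ?thesis by simp
  qed
  have zmq: "\<bar>z - ?m - ?q / 2\<bar> \<le> ?J / 6"
  proof -
    have "z - ?m - ?q / 2 = (\<integral>t. exp (w t) - 1 - w t - (w t)\<^sup>2 / 2 \<partial>M)"
      using intE intw intw2 by (simp add: z_def prob_space)
    also have "\<bar>\<dots>\<bar> \<le> (\<integral>t. \<bar>exp (w t) - 1 - w t - (w t)\<^sup>2 / 2\<bar> \<partial>M)" by simp
    also have "\<dots> \<le> (\<integral>t. f t ^ 3 / 6 \<partial>M)"
    proof (rule integral_mono)
      fix t
      have "\<bar>w t\<bar> ^ 3 * exp \<bar>w t\<bar> \<le> \<bar>w t\<bar> ^ 3 * exp (3 * \<bar>w t\<bar>)" by (intro mult_left_mono) auto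
      then show "\<bar>exp (w t) - 1 - w t - (w t)\<^sup>2 / 2\<bar> \<le> f t ^ 3 / 6"
        using exp_taylor_bounds(3)[of "w t"] fpow[of t 3] by simp
    qed (use intE intw intw2 intf in auto)
    finally show ?thesis by (simp add: J)
  qed
  have sq: "\<bar>z\<^sup>2 - ?m\<^sup>2\<bar> \<le> ?J"
  proof -
    have "\<bar>z\<^sup>2 - ?m\<^sup>2\<bar> = \<bar>z - ?m\<bar> * \<bar>z + ?m\<bar>"
      by (simp add: power2_eq_square abs_mult[symmetric] algebra_simps)
    also have "\<dots> \<le> ((\<integral>t. (f t)\<^sup>2 \<partial>M) / 2) * (2 * ?F)"
      by (rule mult_mono[OF zm]) (use zF mF F0 in auto)
    also have "\<dots> \<le> ?J" using cube(2) by (simp add: J)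
    finally show ?thesis .
  qed
  have ln: "\<bar>ln (1 + z) - z + z\<^sup>2 / 2\<bar> \<le> 2 * ?J * ?K / 3"
  proof -
    have "\<bar>ln (1 + z) - z + z\<^sup>2 / 2\<bar> \<le> \<bar>z\<bar> ^ 3 * (1 + 1 / (1 + z)) / 3"
      by (rule ln_taylor_bound) (use I in \<open>simp add: z_def\<close>)
    also have "\<dots> \<le> ?J * (2 * ?K) / 3"
    proof (intro divide_right_mono mult_mono)
      show "\<bar>z\<bar> ^ 3 \<le> ?J" using power_mono[OF zF, of 3] cube(1) by (simp add: J)
      show "1 + 1 / (1 + z) \<le> 2 * ?K" using inv K1 by (simp add: z_def)
      show "0 \<le> 1 + 1 / (1 + z)" using I by (simp add: z_def)
    qed (use J0 in auto)
    finally show ?thesis by (simp add: mult_ac)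
  qed
  have JK: "?J \<le> ?J * ?K" using mult_left_mono[OF K1 J0] by simp
  have "cumulant_remainder M w = (ln (1 + z) - z + z\<^sup>2 / 2) + (z - ?m - ?q / 2) - (z\<^sup>2 - ?m\<^sup>2) / 2"
    by (simp add: cumulant_remainder_def log_partition_def z_def field_simps)
  then have "\<bar>cumulant_remainder M w\<bar> \<le> 2 * ?J * ?K / 3 + ?J / 6 + ?J / 2"
    using ln zmq sq unfolding diff_divide_distrib by linarith
  also have "\<dots> \<le> 2 * ?J * ?K" using JK J0 unfolding mult.assoc by linarith
  finally show ?thesis .
qed

text \<open>
  For \<open>N \<le> 1\<close> this is the general bound. For \<open>N > 1\<close> the three terms of the expansion are each at
  most quadratic in \<open>N\<close> and hence cubic, which is why no exponential of \<open>N\<close> appears.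
\<close>

lemma (in prob_space) cumulant_remainder_le_cube:
  assumes [measurable]: "w \<in> borel_measurable M" and N: "\<And>t. t \<in> space M \<Longrightarrow> \<bar>w t\<bar> \<le> N"
  shows "\<bar>cumulant_remainder M w\<bar> \<le> 2 * exp 4 * N ^ 3"
proof -
  have bd: "bounded_on_space M w" using N by (rule bounded_on_spaceI)
  obtain t0 where "t0 \<in> space M" using not_empty by auto
  then have N0: "0 \<le> N" using N[of t0] by simp
  show ?thesis
  proof (cases "N \<le> 1")
    case True
    have le: "\<bar>w t\<bar> ^ 3 * exp (3 * \<bar>w t\<bar>) \<le> N ^ 3 * exp 3" "exp \<bar>w t\<bar> \<le> exp 1"
      if "t \<in> space M" for t
      using N[OF that] True by (auto intro!: mult_mono power_mono)
    have "(\<integral>t. \<bar>w t\<bar> ^ 3 * exp (3 * \<bar>w t\<bar>) \<partial>M) \<le> N ^ 3 * exp 3"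
      by (rule integral_between(2)[where a=0])
        (use le in \<open>auto intro!: integrable_of_bounded bounded_on_spaceI[where B="N ^ 3 * exp 3"] simp: abs_mult\<close>)
    moreover have "(\<integral>t. exp \<bar>w t\<bar> \<partial>M) \<le> exp 1"
      by (rule integral_between(2)[where a=0])
        (use le in \<open>auto intro!: integrable_of_bounded bounded_on_spaceI[where B="exp 1"]\<close>)
    ultimately have "2 * (\<integral>t. \<bar>w t\<bar> ^ 3 * exp (3 * \<bar>w t\<bar>) \<partial>M) * (\<integral>t. exp \<bar>w t\<bar> \<partial>M)
        \<le> 2 * (N ^ 3 * exp 3) * exp 1"
      using N0 by (intro mult_mono) auto
    also have "\<dots> = 2 * (exp 3 * exp 1) * N ^ 3" by simp
    also have "exp 3 * exp 1 = (exp 4 :: real)" by (simp flip: exp_add)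
    finally show ?thesis using cumulant_remainder_le[OF assms(1) bd] by linarith
  next
    case False
    let ?m = "\<integral>t. w t \<partial>M" and ?q = "\<integral>t. (w t)\<^sup>2 \<partial>M"
    have w2: "(w t)\<^sup>2 \<le> N\<^sup>2" if "t \<in> space M" for t
      using N[OF that] N0 by (simp add: abs_le_square_iff[symmetric])
    have int: "integrable M w" "integrable M (\<lambda>t. (w t)\<^sup>2)"
      using w2 by (auto intro!: integrable_of_bounded bd bounded_on_spaceI[where B="N\<^sup>2"])
    have "-N \<le> w t" "w t \<le> N" if "t \<in> space M" for t using N[OF that] by auto
    from integral_between[OF int(1) this] have "-N \<le> ?m" "?m \<le> N" by auto
    moreover have "\<bar>log_partition M w\<bar> \<le> N" by (rule abs_log_partition_le[OF assms])
    moreover have "?m\<^sup>2 \<le> ?q" by (rule square_integral_le[OF int])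
    moreover have "?q \<le> N\<^sup>2" by (rule integral_between(2)[OF int(2), of 0]) (use w2 in auto)
    moreover have "0 \<le> ?m\<^sup>2" "0 \<le> N\<^sup>2" by simp_all
    moreover have "\<bar>L - m - (q - m\<^sup>2) / 2\<bar> \<le> 2 * N + N\<^sup>2 / 2"
      if "-N \<le> m" "m \<le> N" "\<bar>L\<bar> \<le> N" "m\<^sup>2 \<le> q" "q \<le> N\<^sup>2" "0 \<le> m\<^sup>2" "0 \<le> N\<^sup>2" for L m q :: real
      using that unfolding diff_divide_distrib by linarith
    ultimately have "\<bar>cumulant_remainder M w\<bar> \<le> 2 * N + N\<^sup>2 / 2"
      unfolding cumulant_remainder_def by blast
    also have "\<dots> \<le> 3 * N ^ 3"
    proof -
      have "N \<le> N\<^sup>2" using False by (simp add: power2_eq_square)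
      moreover have "N\<^sup>2 \<le> N ^ 3" using False by (intro power_increasing) auto
      ultimately show ?thesis using N0 by linarith
    qed
    also have "\<dots> \<le> 2 * exp 4 * N ^ 3"
    proof (rule mult_right_mono)
      show "(3::real) \<le> 2 * exp 4" using exp_ge_add_one_self[of 4] by simp
    qed (use N0 in simp)
    finally show ?thesis .
  qed
qed


section \<open>Second-order expansion of the expected log-partition function\<close>

text \<open>
  Bounds for fixed parameter value, uniform in that value, suffice for all exchanges of integrals
  below.
\<close>

lemma (in pair_prob_space) integrable_of_sections:
  fixes f :: "'a \<times> 'b \<Rightarrow> real"
  assumes [measurable]: "f \<in> borel_measurable (M1 \<Otimes>\<^sub>M M2)"
    and c: "\<And>y. y \<in> space M2 \<Longrightarrow> (\<integral>\<^sup>+x. ennreal \<bar>f (x, y)\<bar> \<partial>M1) \<le> ennreal c"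
  shows "integrable (M1 \<Otimes>\<^sub>M M2) f"
proof (rule integrableI_bounded)
  have "(\<integral>\<^sup>+p. ennreal (norm (f p)) \<partial>(M1 \<Otimes>\<^sub>M M2)) = (\<integral>\<^sup>+y. (\<integral>\<^sup>+x. ennreal \<bar>f (x, y)\<bar> \<partial>M1) \<partial>M2)"
    by (subst nn_integral_snd[symmetric]) auto
  also have "\<dots> \<le> (\<integral>\<^sup>+y. ennreal c \<partial>M2)" by (intro nn_integral_mono c)
  also have "\<dots> = ennreal c" by (simp add: M2.emeasure_space_1)
  finally show "(\<integral>\<^sup>+p. ennreal (norm (f p)) \<partial>(M1 \<Otimes>\<^sub>M M2)) < \<infinity>" by (simp add: order_le_less_trans)
qed simp

text \<open>
  Half the expected variance, with respect to \<open>\<nu>\<close>, of the paths of a centred field with covariance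
  function \<open>C\<close>.
\<close>

definition half_variance :: "'t measure \<Rightarrow> ('t \<Rightarrow> 't \<Rightarrow> real) \<Rightarrow> real" where
  "half_variance \<nu> C = ((\<integral>t. C t t \<partial>\<nu>) - (\<integral>p. C (fst p) (snd p) \<partial>(\<nu> \<Otimes>\<^sub>M \<nu>))) / 2"

locale centred_field = prob_space A for A :: "'a measure" +
  fixes \<tau> :: "'t measure" and g :: "'a \<Rightarrow> 't \<Rightarrow> real" and v :: real
  assumes field_measurable: "case_prod g \<in> borel_measurable (A \<Otimes>\<^sub>M \<tau>)"
    and bounded_paths: "\<And>a. a \<in> space A \<Longrightarrow> bounded_on_space \<tau> (g a)"
    and mean_zero: "\<And>t. t \<in> space \<tau> \<Longrightarrow> (\<integral>a. g a t \<partial>A) = 0"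
    and v_nonneg: "0 \<le> v"
    and second_moment: "\<And>t. t \<in> space \<tau> \<Longrightarrow> (\<integral>\<^sup>+a. ennreal ((g a t)\<^sup>2) \<partial>A) \<le> ennreal v"
begin

definition covariance :: "'t \<Rightarrow> 't \<Rightarrow> real" where
  "covariance s t = (\<integral>a. g a s * g a t \<partial>A)"

lemma section_measurable: "t \<in> space \<tau> \<Longrightarrow> (\<lambda>a. g a t) \<in> borel_measurable A"
  using measurable_Pair1[OF field_measurable] by simp

lemma path_measurable: "a \<in> space A \<Longrightarrow> g a \<in> borel_measurable \<tau>"
  using measurable_Pair2[OF field_measurable] by simp

lemma product_moment:
  assumes "s \<in> space \<tau>" "t \<in> space \<tau>"
  shows "(\<integral>\<^sup>+a. ennreal \<bar>g a s * g a t\<bar> \<partial>A) \<le> ennreal v"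
proof -
  note [measurable] = section_measurable[OF assms(1)] section_measurable[OF assms(2)]
  have "(\<integral>\<^sup>+a. ennreal \<bar>g a s * g a t\<bar> \<partial>A)
      \<le> (\<integral>\<^sup>+a. ennreal (1/2) * (ennreal ((g a s)\<^sup>2) + ennreal ((g a t)\<^sup>2)) \<partial>A)"
  proof (rule nn_integral_mono)
    fix a
    have "\<bar>g a s * g a t\<bar> \<le> 1/2 * ((g a s)\<^sup>2 + (g a t)\<^sup>2)"
      using sum_squares_bound[of "\<bar>g a s\<bar>" "\<bar>g a t\<bar>"] by (simp add: abs_mult)
    then have "ennreal \<bar>g a s * g a t\<bar> \<le> ennreal (1/2 * ((g a s)\<^sup>2 + (g a t)\<^sup>2))"
      by (rule ennreal_leI)
    also have "\<dots> = ennreal (1/2) * (ennreal ((g a s)\<^sup>2) + ennreal ((g a t)\<^sup>2))"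
      by (simp only: ennreal_mult ennreal_plus sum_power2_ge_zero zero_le_power2
          zero_le_divide_1_iff zero_le_numeral)
    finally show "ennreal \<bar>g a s * g a t\<bar> \<le> ennreal (1/2) * (ennreal ((g a s)\<^sup>2) + ennreal ((g a t)\<^sup>2))" .
  qed
  also have "\<dots> = ennreal (1/2) * ((\<integral>\<^sup>+a. ennreal ((g a s)\<^sup>2) \<partial>A) + (\<integral>\<^sup>+a. ennreal ((g a t)\<^sup>2) \<partial>A))"
    by (simp add: nn_integral_cmult nn_integral_add)
  also have "\<dots> \<le> ennreal (1/2) * (ennreal v + ennreal v)"
    by (intro mult_left_mono add_mono second_moment assms) simp
  also have "\<dots> = ennreal v"
  proof -
    have "ennreal (1/2) * (ennreal v + ennreal v) = ennreal (1/2 * (v + v))"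
      using v_nonneg by (simp only: ennreal_mult ennreal_plus add_nonneg_nonneg
          zero_le_divide_1_iff zero_le_numeral)
    then show ?thesis by simp
  qed
  finally show ?thesis .
qed

lemma covariance_bound:
  assumes "s \<in> space \<tau>" "t \<in> space \<tau>"
  shows "\<bar>covariance s t\<bar> \<le> v"
proof -
  have "ennreal \<bar>covariance s t\<bar> \<le> (\<integral>\<^sup>+a. ennreal \<bar>g a s * g a t\<bar> \<partial>A)"
  proof (cases "integrable A (\<lambda>a. g a s * g a t)")
    case True
    then show ?thesis unfolding covariance_def using integral_norm_bound_ennreal[OF True] by simp
  next
    case False
    then show ?thesis unfolding covariance_def by (simp add: not_integrable_integral_eq)
  qed
  also note product_moment[OF assms]
  finally show ?thesis using v_nonneg by simp
qed

context
  fixes \<nu> :: "'t measure"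
  assumes \<nu>: "prob_space \<nu>" "sets \<nu> = sets \<tau>"
begin

lemma space_base: "space \<nu> = space \<tau>"
  by (rule sets_eq_imp_space_eq[OF \<nu>(2)])

lemma base_measurable: "case_prod g \<in> borel_measurable (A \<Otimes>\<^sub>M \<nu>)"
  using field_measurable \<nu>(2) by (simp cong: measurable_cong_sets sets_pair_measure_cong)

lemma path_properties:
  assumes "a \<in> space A"
  shows "g a \<in> borel_measurable \<nu>" "bounded_on_space \<nu> (g a)" "integrable \<nu> (g a)"
    "integrable \<nu> (\<lambda>t. (g a t)\<^sup>2)"
proof -
  show m: "g a \<in> borel_measurable \<nu>"
    using path_measurable[OF assms] \<nu>(2) by (simp cong: measurable_cong_sets)
  show b: "bounded_on_space \<nu> (g a)"
    using bounded_paths[OF assms] by (simp add: bounded_on_space_def space_base)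
  then obtain B where B: "\<And>t. t \<in> space \<nu> \<Longrightarrow> \<bar>g a t\<bar> \<le> B" by (auto simp: bounded_on_space_def)
  show "integrable \<nu> (g a)" by (rule prob_space.integrable_of_bounded[OF \<nu>(1) m b])
  have "bounded_on_space \<nu> (\<lambda>t. (g a t)\<^sup>2)"
    by (rule bounded_on_spaceI[where B="B\<^sup>2"])
      (use power_mono[OF B, of _ 2] in auto)
  then show "integrable \<nu> (\<lambda>t. (g a t)\<^sup>2)"
    by (intro prob_space.integrable_of_bounded[OF \<nu>(1)]) (use m in measurable)
qed

lemma square_field_integrable: "integrable (A \<Otimes>\<^sub>M \<nu>) (\<lambda>p. (g (fst p) (snd p))\<^sup>2)"
proof -
  interpret N: prob_space \<nu> by fact
  interpret AN: pair_prob_space A \<nu> ..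
  note [measurable] = base_measurable
  show ?thesis
    by (rule AN.integrable_of_sections[where c=v])
      (use second_moment in \<open>simp_all add: space_base split_beta'\<close>)
qed

lemma field_integrable: "integrable (A \<Otimes>\<^sub>M \<nu>) (\<lambda>p. g (fst p) (snd p))"
proof -
  interpret N: prob_space \<nu> by fact
  interpret AN: pair_prob_space A \<nu> ..
  note [measurable] = base_measurable
  interpret P: prob_space "A \<Otimes>\<^sub>M \<nu>" by (rule prob_space_pair) unfold_locales
  show ?thesis
  proof (rule Bochner_Integration.integrable_bound)
    show "integrable (A \<Otimes>\<^sub>M \<nu>) (\<lambda>p. 1 + (g (fst p) (snd p))\<^sup>2)"
      using square_field_integrable by simp
    have "\<bar>x\<bar> \<le> \<bar>1 + x\<^sup>2\<bar>" for x :: real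
      using sum_squares_bound[of 1 "\<bar>x\<bar>"] zero_le_power2[of x] by simp
    then show "AE p in A \<Otimes>\<^sub>M \<nu>. norm (g (fst p) (snd p)) \<le> norm (1 + (g (fst p) (snd p))\<^sup>2)"
      by simp
  qed (simp add: split_beta')
qed

lemma mean_integral:
  "integrable A (\<lambda>a. \<integral>t. g a t \<partial>\<nu>)" "(\<integral>a. (\<integral>t. g a t \<partial>\<nu>) \<partial>A) = 0"
proof -
  interpret N: prob_space \<nu> by fact
  interpret AN: pair_prob_space A \<nu> ..
  show "integrable A (\<lambda>a. \<integral>t. g a t \<partial>\<nu>)" using AN.integrable_fst'[OF field_integrable] by simp
  have "(\<integral>a. (\<integral>t. g a t \<partial>\<nu>) \<partial>A) = (\<integral>t. (\<integral>a. g a t \<partial>A) \<partial>\<nu>)"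
    by (rule AN.Fubini_integral[symmetric]) (use field_integrable in \<open>simp add: split_beta'\<close>)
  also have "\<dots> = (\<integral>t. 0 \<partial>\<nu>)"
    by (rule Bochner_Integration.integral_cong) (simp_all add: space_base mean_zero)
  finally show "(\<integral>a. (\<integral>t. g a t \<partial>\<nu>) \<partial>A) = 0" by simp
qed

lemma square_integral:
  "integrable A (\<lambda>a. \<integral>t. (g a t)\<^sup>2 \<partial>\<nu>)"
  "(\<integral>a. (\<integral>t. (g a t)\<^sup>2 \<partial>\<nu>) \<partial>A) = (\<integral>t. covariance t t \<partial>\<nu>)"
proof -
  interpret N: prob_space \<nu> by fact
  interpret AN: pair_prob_space A \<nu> ..
  show "integrable A (\<lambda>a. \<integral>t. (g a t)\<^sup>2 \<partial>\<nu>)"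
    using AN.integrable_fst'[OF square_field_integrable] by simp
  show "(\<integral>a. (\<integral>t. (g a t)\<^sup>2 \<partial>\<nu>) \<partial>A) = (\<integral>t. covariance t t \<partial>\<nu>)"
    unfolding covariance_def power2_eq_square[symmetric]
    by (rule AN.Fubini_integral[symmetric]) (use square_field_integrable in \<open>simp add: split_beta'\<close>)
qed

lemma product_field_integrable:
  "integrable (A \<Otimes>\<^sub>M (\<nu> \<Otimes>\<^sub>M \<nu>)) (\<lambda>(a, p). g a (fst p) * g a (snd p))"
proof -
  interpret N: prob_space \<nu> by fact
  interpret NN: pair_prob_space \<nu> \<nu> ..
  interpret N2: prob_space "\<nu> \<Otimes>\<^sub>M \<nu>" by (rule prob_space_pair) unfold_locales
  interpret ANN: pair_prob_space A "\<nu> \<Otimes>\<^sub>M \<nu>" ..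
  note [measurable] = base_measurable
  show ?thesis
    by (rule ANN.integrable_of_sections[where c=v])
      (use product_moment in \<open>auto simp: space_pair_measure space_base split_beta'\<close>)
qed

lemma squared_mean_integral:
  "integrable A (\<lambda>a. (\<integral>t. g a t \<partial>\<nu>)\<^sup>2)"
  "(\<integral>a. (\<integral>t. g a t \<partial>\<nu>)\<^sup>2 \<partial>A) = (\<integral>p. covariance (fst p) (snd p) \<partial>(\<nu> \<Otimes>\<^sub>M \<nu>))"
proof -
  interpret N: prob_space \<nu> by fact
  interpret NN: pair_prob_space \<nu> \<nu> ..
  interpret N2: prob_space "\<nu> \<Otimes>\<^sub>M \<nu>" by (rule prob_space_pair) unfold_locales
  interpret ANN: pair_prob_space A "\<nu> \<Otimes>\<^sub>M \<nu>" ..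
  have sq: "(\<integral>p. g a (fst p) * g a (snd p) \<partial>(\<nu> \<Otimes>\<^sub>M \<nu>)) = (\<integral>t. g a t \<partial>\<nu>)\<^sup>2" if a: "a \<in> space A" for a
  proof -
    note [measurable] = path_properties(1)[OF a]
    obtain B where B: "\<And>t. t \<in> space \<nu> \<Longrightarrow> \<bar>g a t\<bar> \<le> B"
      using path_properties(2)[OF a] by (auto simp: bounded_on_space_def)
    have "integrable (\<nu> \<Otimes>\<^sub>M \<nu>) (\<lambda>p. g a (fst p) * g a (snd p))"
    proof (rule prob_space.integrable_of_bounded)
      have "\<bar>g a (fst p) * g a (snd p)\<bar> \<le> B * B" if "p \<in> space (\<nu> \<Otimes>\<^sub>M \<nu>)" for p
      proof -
        have "\<bar>g a (fst p)\<bar> \<le> B" "\<bar>g a (snd p)\<bar> \<le> B"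
          using that B by (auto simp: space_pair_measure)
        moreover from this have "0 \<le> B" by linarith
        ultimately show ?thesis unfolding abs_mult by (intro mult_mono) auto
      qed
      then show "bounded_on_space (\<nu> \<Otimes>\<^sub>M \<nu>) (\<lambda>p. g a (fst p) * g a (snd p))"
        by (rule bounded_on_spaceI)
      show "prob_space (\<nu> \<Otimes>\<^sub>M \<nu>)" by (rule prob_space_pair) unfold_locales
    qed simp
    from NN.integral_fst'[OF this] show ?thesis by (simp add: power2_eq_square)
  qed
  have "integrable A (\<lambda>a. \<integral>p. g a (fst p) * g a (snd p) \<partial>(\<nu> \<Otimes>\<^sub>M \<nu>))"
    using ANN.integrable_fst'[OF product_field_integrable] by simp
  then show "integrable A (\<lambda>a. (\<integral>t. g a t \<partial>\<nu>)\<^sup>2)"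
    using sq by (simp cong: Bochner_Integration.integrable_cong)
  have "(\<integral>a. (\<integral>t. g a t \<partial>\<nu>)\<^sup>2 \<partial>A) = (\<integral>a. (\<integral>p. g a (fst p) * g a (snd p) \<partial>(\<nu> \<Otimes>\<^sub>M \<nu>)) \<partial>A)"
    by (rule Bochner_Integration.integral_cong) (simp_all add: sq)
  also have "\<dots> = (\<integral>p. covariance (fst p) (snd p) \<partial>(\<nu> \<Otimes>\<^sub>M \<nu>))"
    unfolding covariance_def
    by (rule ANN.Fubini_integral[symmetric]) (use product_field_integrable in simp)
  finally show "(\<integral>a. (\<integral>t. g a t \<partial>\<nu>)\<^sup>2 \<partial>A) = (\<integral>p. covariance (fst p) (snd p) \<partial>(\<nu> \<Otimes>\<^sub>M \<nu>))" .
qed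

lemma covariance_integrable:
  "integrable \<nu> (\<lambda>t. covariance t t)" "integrable (\<nu> \<Otimes>\<^sub>M \<nu>) (\<lambda>p. covariance (fst p) (snd p))"
proof -
  interpret N: prob_space \<nu> by fact
  interpret AN: pair_prob_space A \<nu> ..
  interpret NN: pair_prob_space \<nu> \<nu> ..
  interpret N2: prob_space "\<nu> \<Otimes>\<^sub>M \<nu>" by (rule prob_space_pair) unfold_locales
  interpret ANN: pair_prob_space A "\<nu> \<Otimes>\<^sub>M \<nu>" ..
  have "integrable (A \<Otimes>\<^sub>M \<nu>) (\<lambda>(a, t). g a t * g a t)"
    using square_field_integrable by (simp add: power2_eq_square split_beta')
  from AN.integrable_snd[OF this] show "integrable \<nu> (\<lambda>t. covariance t t)"
    by (simp add: covariance_def)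
  from ANN.integrable_snd[OF product_field_integrable]
  show "integrable (\<nu> \<Otimes>\<^sub>M \<nu>) (\<lambda>p. covariance (fst p) (snd p))"
    by (simp add: covariance_def)
qed

text \<open>
  By Fubini the mean of the first cumulant vanishes and that of the second depends on the covariance
  function alone. Two centred fields with close covariances therefore have close expected
  log-partition functions.
\<close>

lemma log_partition_expansion:
  assumes \<epsilon>: "(\<integral>\<^sup>+a. ennreal \<bar>cumulant_remainder \<nu> (g a)\<bar> \<partial>A) \<le> ennreal \<epsilon>" "0 \<le> \<epsilon>"
  shows "\<bar>(\<integral>a. log_partition \<nu> (g a) \<partial>A) - half_variance \<nu> covariance\<bar> \<le> \<epsilon>"
    and "(\<integral>\<^sup>+a. ennreal \<bar>log_partition \<nu> (g a)\<bar> \<partial>A) \<le> ennreal (\<epsilon> + 1 + 2 * v)"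
proof -
  interpret N: prob_space \<nu> by fact
  have L: "(\<lambda>a. log_partition \<nu> (g a)) \<in> borel_measurable A"
    by (rule measurable_log_partition[OF field_measurable \<nu>])
  note [measurable] = L borel_measurable_integrable[OF mean_integral(1)]
    borel_measurable_integrable[OF square_integral(1)]
  have rem_meas [measurable]: "(\<lambda>a. cumulant_remainder \<nu> (g a)) \<in> borel_measurable A"
    unfolding cumulant_remainder_def by measurable
  have rem: "integrable A (\<lambda>a. cumulant_remainder \<nu> (g a))"
    using \<epsilon>(1) by (intro integrableI_bounded) (auto simp: order_le_less_trans)
  have bound: "\<bar>\<integral>a. cumulant_remainder \<nu> (g a) \<partial>A\<bar> \<le> \<epsilon>"
  proof -
    have "\<bar>\<integral>a. cumulant_remainder \<nu> (g a) \<partial>A\<bar> \<le> (\<integral>a. \<bar>cumulant_remainder \<nu> (g a)\<bar> \<partial>A)" by simp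
    also have "\<dots> \<le> \<epsilon>" by (rule integral_real_bounded[OF \<epsilon>(2,1)])
    finally show ?thesis .
  qed
  note ints = mean_integral(1) square_integral(1) squared_mean_integral(1)
  have "(\<integral>a. log_partition \<nu> (g a) \<partial>A)
      = (\<integral>a. cumulant_remainder \<nu> (g a) + (\<integral>t. g a t \<partial>\<nu>)
          + ((\<integral>t. (g a t)\<^sup>2 \<partial>\<nu>) - (\<integral>t. g a t \<partial>\<nu>)\<^sup>2) / 2 \<partial>A)"
    by (simp add: cumulant_remainder_def)
  also have "\<dots> = (\<integral>a. cumulant_remainder \<nu> (g a) \<partial>A) + half_variance \<nu> covariance"
    using ints rem by (simp add: half_variance_def mean_integral(2) square_integral(2) squared_mean_integral(2))
  finally show "\<bar>(\<integral>a. log_partition \<nu> (g a) \<partial>A) - half_variance \<nu> covariance\<bar> \<le> \<epsilon>"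
    using bound by simp
  have "(\<integral>\<^sup>+a. ennreal \<bar>log_partition \<nu> (g a)\<bar> \<partial>A)
      \<le> (\<integral>\<^sup>+a. ennreal \<bar>cumulant_remainder \<nu> (g a)\<bar> + ennreal (1 + 2 * (\<integral>t. (g a t)\<^sup>2 \<partial>\<nu>)) \<partial>A)"
  proof (rule nn_integral_mono)
    fix a assume a: "a \<in> space A"
    let ?m = "\<integral>t. g a t \<partial>\<nu>" and ?q = "\<integral>t. (g a t)\<^sup>2 \<partial>\<nu>"
    have "?m\<^sup>2 \<le> ?q" by (rule N.square_integral_le) (use path_properties[OF a] in auto)
    moreover have "0 \<le> ?m\<^sup>2" by simp
    moreover have "\<bar>?m\<bar> \<le> 1 + ?m\<^sup>2"
      using sum_squares_bound[of 1 "\<bar>?m\<bar>"] zero_le_power2[of ?m] by simp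
    moreover have "\<bar>L\<bar> \<le> \<bar>L - m - (q - p) / 2\<bar> + (1 + 2 * q)"
      if "p \<le> q" "0 \<le> p" "\<bar>m\<bar> \<le> 1 + p" for L m p q :: real
      using that unfolding diff_divide_distrib by linarith
    ultimately have "\<bar>log_partition \<nu> (g a)\<bar> \<le> \<bar>cumulant_remainder \<nu> (g a)\<bar> + (1 + 2 * ?q)"
      unfolding cumulant_remainder_def by blast
    then show "ennreal \<bar>log_partition \<nu> (g a)\<bar>
        \<le> ennreal \<bar>cumulant_remainder \<nu> (g a)\<bar> + ennreal (1 + 2 * ?q)"
      by (subst ennreal_plus[symmetric]) (auto simp del: ennreal_plus intro!: ennreal_leI)
  qed
  also have "\<dots> = (\<integral>\<^sup>+a. ennreal \<bar>cumulant_remainder \<nu> (g a)\<bar> \<partial>A)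
      + (\<integral>\<^sup>+a. ennreal (1 + 2 * (\<integral>t. (g a t)\<^sup>2 \<partial>\<nu>)) \<partial>A)"
    by (rule nn_integral_add) measurable
  also have "(\<integral>\<^sup>+a. ennreal (1 + 2 * (\<integral>t. (g a t)\<^sup>2 \<partial>\<nu>)) \<partial>A)
      = ennreal (\<integral>a. 1 + 2 * (\<integral>t. (g a t)\<^sup>2 \<partial>\<nu>) \<partial>A)"
    by (rule nn_integral_eq_integral) (use square_integral(1) in auto)
  also have "\<dots> = ennreal (1 + 2 * (\<integral>t. covariance t t \<partial>\<nu>))"
    using square_integral by (simp add: prob_space)
  also have "\<dots> \<le> ennreal (1 + 2 * v)"
  proof -
    have "(\<integral>t. covariance t t \<partial>\<nu>) \<le> (\<integral>t. v \<partial>\<nu>)"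
      by (rule integral_mono[OF covariance_integrable(1)])
        (use covariance_bound in \<open>auto simp: space_base abs_le_iff\<close>)
    then show ?thesis by (intro ennreal_leI) (simp add: N.prob_space)
  qed
  finally have "(\<integral>\<^sup>+a. ennreal \<bar>log_partition \<nu> (g a)\<bar> \<partial>A)
      \<le> ennreal \<epsilon> + ennreal (1 + 2 * v)"
    using \<epsilon>(1) by (meson add_mono order_refl order_trans)
  then show "(\<integral>\<^sup>+a. ennreal \<bar>log_partition \<nu> (g a)\<bar> \<partial>A) \<le> ennreal (\<epsilon> + 1 + 2 * v)"
    using \<epsilon>(2) v_nonneg by (simp add: add.assoc)
qed

lemma half_variance_bound: "\<bar>half_variance \<nu> covariance\<bar> \<le> v"
proof -
  interpret N: prob_space \<nu> by fact
  interpret N2: prob_space "\<nu> \<Otimes>\<^sub>M \<nu>" by (rule prob_space_pair) unfold_locales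
  have "-v \<le> covariance s t" "covariance s t \<le> v" if "s \<in> space \<nu>" "t \<in> space \<nu>" for s t
    using covariance_bound[of s t] that by (auto simp: space_base)
  then have "-v \<le> (\<integral>t. covariance t t \<partial>\<nu>)" "(\<integral>t. covariance t t \<partial>\<nu>) \<le> v"
    "-v \<le> (\<integral>p. covariance (fst p) (snd p) \<partial>(\<nu> \<Otimes>\<^sub>M \<nu>))"
    "(\<integral>p. covariance (fst p) (snd p) \<partial>(\<nu> \<Otimes>\<^sub>M \<nu>)) \<le> v"
    by (rule N.integral_between[OF covariance_integrable(1)]
        N2.integral_between[OF covariance_integrable(2)]; force simp: space_pair_measure)+
  then show ?thesis unfolding half_variance_def diff_divide_distrib by linarith
qed

end

lemma tame_if_remainder:
  assumes "\<And>\<nu>. prob_space \<nu> \<Longrightarrow> sets \<nu> = sets \<tau> \<Longrightarrow>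
      (\<integral>\<^sup>+a. ennreal \<bar>cumulant_remainder \<nu> (g a)\<bar> \<partial>A) \<le> ennreal \<epsilon>" "0 \<le> \<epsilon>"
  shows "tame_field \<tau> A g"
  unfolding tame_field_def
proof (intro conjI ballI exI[of _ "\<epsilon> + 1 + 2 * v"] allI impI)
  show "(\<integral>\<^sup>+a. ennreal \<bar>log_partition \<nu> (g a)\<bar> \<partial>A) \<le> ennreal (\<epsilon> + 1 + 2 * v)"
    if "prob_space \<nu>" "sets \<nu> = sets \<tau>" for \<nu>
    by (rule log_partition_expansion(2)[OF that assms(1)[OF that] assms(2)])
qed (fact field_measurable prob_space_axioms bounded_paths)+

end

lemma half_variance_close:
  assumes "centred_field A \<tau> g v" "centred_field B \<tau> h w" and \<nu>: "prob_space \<nu>" "sets \<nu> = sets \<tau>"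
    and close: "\<And>s t. s \<in> space \<tau> \<Longrightarrow> t \<in> space \<tau> \<Longrightarrow>
      \<bar>centred_field.covariance A g s t - centred_field.covariance B h s t\<bar> \<le> \<kappa>"
  shows "\<bar>half_variance \<nu> (centred_field.covariance A g)
      - half_variance \<nu> (centred_field.covariance B h)\<bar> \<le> \<kappa>"
proof -
  interpret g: centred_field A \<tau> g v by fact
  interpret h: centred_field B \<tau> h w by fact
  interpret N: prob_space \<nu> by fact
  interpret N2: prob_space "\<nu> \<Otimes>\<^sub>M \<nu>" by (rule prob_space_pair) unfold_locales
  have sp: "space \<nu> = space \<tau>" by (rule sets_eq_imp_space_eq[OF \<nu>(2)])
  note ints = g.covariance_integrable[OF \<nu>] h.covariance_integrable[OF \<nu>]
  have cl: "-\<kappa> \<le> g.covariance s t - h.covariance s t" "g.covariance s t - h.covariance s t \<le> \<kappa>"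
    if "s \<in> space \<nu>" "t \<in> space \<nu>" for s t
    using close[of s t] that by (auto simp: sp abs_le_iff)
  have d1: "integrable \<nu> (\<lambda>t. g.covariance t t - h.covariance t t)"
    and d2: "integrable (\<nu> \<Otimes>\<^sub>M \<nu>) (\<lambda>p. g.covariance (fst p) (snd p) - h.covariance (fst p) (snd p))"
    using ints by auto
  have "-\<kappa> \<le> (\<integral>t. g.covariance t t - h.covariance t t \<partial>\<nu>)"
    "(\<integral>t. g.covariance t t - h.covariance t t \<partial>\<nu>) \<le> \<kappa>"
    by (auto intro!: N.integral_between d1 cl)
  moreover have "-\<kappa> \<le> (\<integral>p. g.covariance (fst p) (snd p) - h.covariance (fst p) (snd p) \<partial>(\<nu> \<Otimes>\<^sub>M \<nu>))"
    "(\<integral>p. g.covariance (fst p) (snd p) - h.covariance (fst p) (snd p) \<partial>(\<nu> \<Otimes>\<^sub>M \<nu>)) \<le> \<kappa>"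
    by (auto intro!: N2.integral_between d2 cl simp: space_pair_measure)
  ultimately show ?thesis
    unfolding Bochner_Integration.integral_diff[OF ints(1,3)] Bochner_Integration.integral_diff[OF ints(2,4)]
      half_variance_def abs_le_iff diff_divide_distrib by linarith
qed


section \<open>Sub-Gaussian fields\<close>

text \<open>
  Gaussian fields are used only through their one-dimensional exponential moments and their
  covariance function. This avoids any estimate of the supremum of a Gaussian process.
\<close>

locale subgaussian_field = centred_field A \<tau> g "x\<^sup>2"
  for A :: "'a measure" and \<tau> :: "'t measure" and g and x :: real +
  assumes x_pos: "0 < x"
    and mgf: "\<And>t c. t \<in> space \<tau> \<Longrightarrow> (\<integral>\<^sup>+a. ennreal (exp (c * g a t)) \<partial>A) \<le> ennreal (exp (c\<^sup>2 * x\<^sup>2 / 2))"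
begin

text \<open>
  For \<open>x \<le> 1\<close> the field is rescaled to unit size, \<open>w = x (w / x)\<close>: the remainder gains the factor
  \<open>x ^ 3\<close>, and the product of the two integrals in the general bound is split by the inequality
  between arithmetic and geometric means, so that exponentials of a single value \<open>w t / x\<close> remain.
\<close>

lemma remainder_pointwise:
  assumes \<nu>: "prob_space \<nu>" "sets \<nu> = sets \<tau>" and a: "a \<in> space A" and "x \<le> 1"
  shows "\<bar>cumulant_remainder \<nu> (g a)\<bar>
    \<le> 721 * x ^ 3 * (\<integral>t. exp (7 / x * g a t) + exp (- 7 / x * g a t) \<partial>\<nu>)"
proof -
  interpret N: prob_space \<nu> by fact
  note path = path_properties[OF \<nu> a]
  note [measurable] = path(1)
  obtain B where B: "\<And>t. t \<in> space \<nu> \<Longrightarrow> \<bar>g a t\<bar> \<le> B"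
    using path(2) by (auto simp: bounded_on_space_def)
  obtain t0 where "t0 \<in> space \<nu>" using N.not_empty by auto
  then have B0: "0 \<le> B" using B[of t0] by simp
  let ?w = "g a"
  have int: "integrable \<nu> (\<lambda>t. \<bar>?w t\<bar> ^ i * exp (c * \<bar>?w t\<bar>))" if "0 \<le> c" for i and c :: real
  proof (rule N.integrable_of_bounded)
    show "bounded_on_space \<nu> (\<lambda>t. \<bar>?w t\<bar> ^ i * exp (c * \<bar>?w t\<bar>))"
      by (rule bounded_on_spaceI[where B="B ^ i * exp (c * B)"])
        (use B B0 that in \<open>auto simp: abs_mult intro!: mult_mono power_mono mult_left_mono\<close>)
  qed measurable
  let ?J = "\<integral>t. \<bar>?w t\<bar> ^ 3 * exp (3 * \<bar>?w t\<bar>) \<partial>\<nu>" and ?K = "\<integral>t. exp \<bar>?w t\<bar> \<partial>\<nu>"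
  let ?E = "\<lambda>t. exp (7 / x * ?w t) + exp (- 7 / x * ?w t)"
  have expb: "bounded_on_space \<nu> (\<lambda>t. c * ?w t)" for c
  proof (rule bounded_on_spaceI)
    show "\<bar>c * ?w t\<bar> \<le> \<bar>c\<bar> * B" if "t \<in> space \<nu>" for t
      using B[OF that] by (simp add: abs_mult mult_left_mono)
  qed
  have intE: "integrable \<nu> ?E"
    by (intro Bochner_Integration.integrable_add N.integrable_exp_bounded expb) measurable
  define G where "G = ?J / x ^ 3"
  have sqJ: "G\<^sup>2 \<le> 720 * (\<integral>t. ?E t \<partial>\<nu>)" and sqK: "?K\<^sup>2 \<le> (\<integral>t. ?E t \<partial>\<nu>)"
  proof -
    let ?f = "\<lambda>t. \<bar>?w t\<bar> ^ 3 * exp (3 * \<bar>?w t\<bar>) / x ^ 3"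
    have f2: "(?f t)\<^sup>2 = \<bar>?w t\<bar> ^ 6 * exp (6 * \<bar>?w t\<bar>) / x ^ 6" for t
      by (simp add: power_mult_distrib power_divide exp_double[symmetric] flip: power_mult)
    have maxE: "exp (7 / x * \<bar>?w t\<bar>) \<le> ?E t" for t
      by (cases "0 \<le> ?w t") (auto simp: abs_if)
    have *: "\<bar>?w t\<bar> \<le> \<bar>?w t\<bar> / x" for t
      using mult_left_mono[of x 1 "\<bar>?w t\<bar>"] x_pos \<open>x \<le> 1\<close> by (simp add: field_simps)
    \<comment> \<open>The constant \<open>720 = 6!\<close> comes from \<open>y ^ 6 / 6! \<le> exp y\<close> for the rescaled value \<open>y\<close>.\<close>
    have "G\<^sup>2 = (\<integral>t. ?f t \<partial>\<nu>)\<^sup>2" by (simp add: G_def)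
    also have "\<dots> \<le> (\<integral>t. (?f t)\<^sup>2 \<partial>\<nu>)"
      by (rule N.square_integral_le) (use int[of 3 3] int[of 6 6] in \<open>simp_all add: f2\<close>)
    also have "\<dots> \<le> (\<integral>t. 720 * ?E t \<partial>\<nu>)"
    proof (rule integral_mono)
      fix t
      let ?y = "\<bar>?w t\<bar> / x"
      obtain u where "exp ?y = (\<Sum>n<7. ?y ^ n / fact n) + exp u / fact 7 * ?y ^ 7"
        using Maclaurin_exp_le by blast
      moreover have "0 \<le> exp u / fact 7 * ?y ^ 7" using x_pos by simp
      ultimately have "(\<Sum>n<7. ?y ^ n / fact n) \<le> exp ?y" by linarith
      moreover have "?y ^ 6 / fact 6 \<le> (\<Sum>n<7. ?y ^ n / fact n)"
        by (rule member_le_sum) (use x_pos in auto)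
      ultimately have "?y ^ 6 \<le> 720 * exp ?y" by (simp add: fact_numeral)
      moreover have "exp (6 * \<bar>?w t\<bar>) \<le> exp (6 * ?y)" using *[of t] by simp
      ultimately have "?y ^ 6 * exp (6 * \<bar>?w t\<bar>) \<le> 720 * exp ?y * exp (6 * ?y)"
        by (intro mult_mono) auto
      also have "\<dots> = 720 * exp (7 / x * \<bar>?w t\<bar>)" by (simp flip: exp_add)
      also have "\<dots> \<le> 720 * ?E t" by (rule mult_left_mono[OF maxE]) simp
      finally show "(?f t)\<^sup>2 \<le> 720 * ?E t"
        by (simp only: f2 power_divide[of "\<bar>?w t\<bar>" x 6] times_divide_eq_left)
      show "integrable \<nu> (\<lambda>t. 720 * ?E t)" by (rule integrable_mult_right) (rule intE)
    qed (use int[of 6 6] in \<open>simp add: f2\<close>)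
    finally show "G\<^sup>2 \<le> 720 * (\<integral>t. ?E t \<partial>\<nu>)" by (simp only: integral_mult_right_zero)
    have e2: "(exp \<bar>?w t\<bar>)\<^sup>2 = exp (2 * \<bar>?w t\<bar>)" for t by (simp add: exp_double)
    have "?K\<^sup>2 \<le> (\<integral>t. (exp \<bar>?w t\<bar>)\<^sup>2 \<partial>\<nu>)"
      by (rule N.square_integral_le) (use int[of 1 0] int[of 2 0] in \<open>auto simp: e2\<close>)
    also have "\<dots> \<le> (\<integral>t. ?E t \<partial>\<nu>)"
    proof (rule integral_mono)
      show "(exp \<bar>?w t\<bar>)\<^sup>2 \<le> ?E t" for t
      proof -
        have "2 * \<bar>?w t\<bar> \<le> 7 / x * \<bar>?w t\<bar>" using *[of t] by simp
        then have "exp (2 * \<bar>?w t\<bar>) \<le> exp (7 / x * \<bar>?w t\<bar>)" by (simp only: exp_le_cancel_iff)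
        then show ?thesis using maxE[of t] unfolding e2 by linarith
      qed
      show "integrable \<nu> (\<lambda>t. (exp \<bar>?w t\<bar>)\<^sup>2)" using int[of 2 0] by (simp add: e2)
    qed (rule intE)
    finally show "?K\<^sup>2 \<le> (\<integral>t. ?E t \<partial>\<nu>)" .
  qed
  have J: "?J = x ^ 3 * G" using x_pos by (simp add: G_def)
  have "\<bar>cumulant_remainder \<nu> ?w\<bar> \<le> x ^ 3 * (2 * G * ?K)"
    using N.cumulant_remainder_le[OF path(1,2)] unfolding J by (simp add: mult_ac)
  also have "\<dots> \<le> x ^ 3 * (G\<^sup>2 + ?K\<^sup>2)"
    using sum_squares_bound[of G ?K] x_pos by (intro mult_left_mono) auto
  also have "\<dots> \<le> x ^ 3 * (721 * (\<integral>t. ?E t \<partial>\<nu>))"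
    using sqJ sqK x_pos by (intro mult_left_mono) auto
  finally show ?thesis by (simp add: mult_ac)
qed

lemma remainder_moment:
  assumes \<nu>: "prob_space \<nu>" "sets \<nu> = sets \<tau>" and "x \<le> 1"
  shows "(\<integral>\<^sup>+a. ennreal \<bar>cumulant_remainder \<nu> (g a)\<bar> \<partial>A) \<le> ennreal (1442 * exp 25 * x ^ 3)"
proof -
  interpret N: prob_space \<nu> by fact
  interpret AN: pair_prob_space A \<nu> ..
  note [measurable] = base_measurable[OF \<nu>]
  let ?E = "\<lambda>a t. exp (7 / x * g a t) + exp (- 7 / x * g a t)"
  have "(\<integral>\<^sup>+a. ennreal \<bar>cumulant_remainder \<nu> (g a)\<bar> \<partial>A)
      \<le> (\<integral>\<^sup>+a. ennreal (721 * x ^ 3) * (\<integral>\<^sup>+t. ennreal (?E a t) \<partial>\<nu>) \<partial>A)"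
  proof (rule nn_integral_mono)
    fix a assume a: "a \<in> space A"
    have "ennreal \<bar>cumulant_remainder \<nu> (g a)\<bar> \<le> ennreal (721 * x ^ 3 * (\<integral>t. ?E a t \<partial>\<nu>))"
      by (intro ennreal_leI remainder_pointwise assms a)
    also have "\<dots> = ennreal (721 * x ^ 3) * ennreal (\<integral>t. ?E a t \<partial>\<nu>)"
      using x_pos by (intro ennreal_mult) auto
    also have "ennreal (\<integral>t. ?E a t \<partial>\<nu>) \<le> (\<integral>\<^sup>+t. ennreal (?E a t) \<partial>\<nu>)"
    proof (cases "integrable \<nu> (?E a)")
      case True
      then show ?thesis by (subst nn_integral_eq_integral) auto
    next
      case False
      then show ?thesis by (simp add: not_integrable_integral_eq)
    qed
    finally show "ennreal \<bar>cumulant_remainder \<nu> (g a)\<bar>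
        \<le> ennreal (721 * x ^ 3) * (\<integral>\<^sup>+t. ennreal (?E a t) \<partial>\<nu>)"
      by (simp add: mult_left_mono)
  qed
  also have "\<dots> = ennreal (721 * x ^ 3) * (\<integral>\<^sup>+a. (\<integral>\<^sup>+t. ennreal (?E a t) \<partial>\<nu>) \<partial>A)"
    by (rule nn_integral_cmult) measurable
  also have "(\<integral>\<^sup>+a. (\<integral>\<^sup>+t. ennreal (?E a t) \<partial>\<nu>) \<partial>A) = (\<integral>\<^sup>+t. (\<integral>\<^sup>+a. ennreal (?E a t) \<partial>A) \<partial>\<nu>)"
    by (rule AN.Fubini'[symmetric]) measurable
  also have "\<dots> \<le> (\<integral>\<^sup>+t. ennreal (2 * exp 25) \<partial>\<nu>)"
  proof (rule nn_integral_mono)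
    fix t assume "t \<in> space \<nu>"
    then have t: "t \<in> space \<tau>" by (simp add: space_base[OF \<nu>])
    note [measurable] = section_measurable[OF t]
    have "(\<integral>\<^sup>+a. ennreal (?E a t) \<partial>A)
        = (\<integral>\<^sup>+a. ennreal (exp (7 / x * g a t)) \<partial>A) + (\<integral>\<^sup>+a. ennreal (exp (- 7 / x * g a t)) \<partial>A)"
      by (subst nn_integral_add[symmetric]) auto
    also have "\<dots> \<le> ennreal (exp ((7 / x)\<^sup>2 * x\<^sup>2 / 2)) + ennreal (exp ((- 7 / x)\<^sup>2 * x\<^sup>2 / 2))"
      by (intro add_mono mgf t)
    also have "\<dots> = ennreal (2 * exp (49 / 2))"
      using x_pos by (simp add: power_divide flip: ennreal_plus)
    also have "\<dots> \<le> ennreal (2 * exp 25)" by (intro ennreal_leI) simp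
    finally show "(\<integral>\<^sup>+a. ennreal (?E a t) \<partial>A) \<le> ennreal (2 * exp 25)" .
  qed
  also have "\<dots> = ennreal (2 * exp 25)" by (simp add: N.emeasure_space_1)
  finally have "(\<integral>\<^sup>+a. ennreal \<bar>cumulant_remainder \<nu> (g a)\<bar> \<partial>A)
      \<le> ennreal (721 * x ^ 3) * ennreal (2 * exp 25)"
    by (simp add: mult_left_mono)
  then show ?thesis using x_pos by (simp add: mult_ac flip: ennreal_mult)
qed

text \<open>
  Jensen's inequality in both directions. The upper one is used in the form
  \<open>ln z \<le> ln c + z / c - 1\<close> at the bound \<open>c\<close> for the mean partition function.
\<close>

lemma log_partition_upper:
  assumes \<nu>: "prob_space \<nu>" "sets \<nu> = sets \<tau>"
  shows "(\<integral>\<^sup>+a. ennreal \<bar>log_partition \<nu> (g a)\<bar> \<partial>A) \<le> ennreal (3 + 2 * x\<^sup>2)"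
    and "0 \<le> (\<integral>a. log_partition \<nu> (g a) \<partial>A)" "(\<integral>a. log_partition \<nu> (g a) \<partial>A) \<le> x\<^sup>2"
proof -
  interpret N: prob_space \<nu> by fact
  interpret AN: pair_prob_space A \<nu> ..
  note [measurable] = base_measurable[OF \<nu>]
  define c where "c = exp (x\<^sup>2 / 2)"
  let ?I = "\<lambda>a. \<integral>t. exp (g a t) \<partial>\<nu>" and ?m = "\<lambda>a. \<integral>t. g a t \<partial>\<nu>" and ?q = "\<lambda>a. \<integral>t. (g a t)\<^sup>2 \<partial>\<nu>"
  have c1: "0 < c" by (simp add: c_def)
  have I: "integrable A ?I" "(\<integral>a. ?I a \<partial>A) \<le> c"
  proof -
    have sec: "(\<integral>\<^sup>+a. ennreal \<bar>exp (g (fst (a, t)) (snd (a, t)))\<bar> \<partial>A) \<le> ennreal c" if "t \<in> space \<nu>" for t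
      using mgf[of t 1] that by (simp add: c_def space_base[OF \<nu>])
    have int: "integrable (A \<Otimes>\<^sub>M \<nu>) (\<lambda>p. exp (g (fst p) (snd p)))"
      by (rule AN.integrable_of_sections[OF _ sec]) (simp_all add: split_beta')
    from AN.integrable_fst'[OF int] show "integrable A ?I" by simp
    have "(\<integral>a. ?I a \<partial>A) = (\<integral>t. (\<integral>a. exp (g a t) \<partial>A) \<partial>\<nu>)"
      by (rule AN.Fubini_integral[symmetric]) (use int in \<open>simp add: split_beta'\<close>)
    also have "\<dots> \<le> c"
    proof (rule N.integral_between(2)[where a=0])
      show "integrable \<nu> (\<lambda>t. \<integral>a. exp (g a t) \<partial>A)"
        using AN.integrable_snd[of "\<lambda>a t. exp (g a t)"] int by (simp add: split_beta')
      show "(\<integral>a. exp (g a t) \<partial>A) \<le> c" if "t \<in> space \<nu>" for t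
        by (rule integral_real_bounded) (use c1 sec[OF that] in auto)
    qed auto
    finally show "(\<integral>a. ?I a \<partial>A) \<le> c" .
  qed
  note ints = mean_integral[OF \<nu>] square_integral[OF \<nu>]
  have bounds: "?m a \<le> log_partition \<nu> (g a)" "log_partition \<nu> (g a) \<le> x\<^sup>2 / 2 + ?I a / c - 1"
    if a: "a \<in> space A" for a
  proof -
    note path = path_properties[OF \<nu> a]
    have pos: "0 < ?I a" by (rule N.exp_integral_pos[OF path(1,2)])
    show "?m a \<le> log_partition \<nu> (g a)"
      unfolding log_partition_def using N.exp_mean_le[OF path(1,2)] pos by (simp add: ln_ge_iff)
    have "ln (?I a / c) \<le> ?I a / c - 1" by (rule ln_le_minus_one) (use pos c1 in simp)
    then show "log_partition \<nu> (g a) \<le> x\<^sup>2 / 2 + ?I a / c - 1"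
      using pos c1 by (simp add: log_partition_def ln_div c_def)
  qed
  have L: "(\<lambda>a. log_partition \<nu> (g a)) \<in> borel_measurable A"
    by (rule measurable_log_partition[OF field_measurable \<nu>])
  have dom: "integrable A (\<lambda>a. 1 + ?q a + x\<^sup>2 / 2 + ?I a / c)" using ints I by simp
  have le: "\<bar>log_partition \<nu> (g a)\<bar> \<le> 1 + ?q a + x\<^sup>2 / 2 + ?I a / c" if a: "a \<in> space A" for a
  proof -
    have "(?m a)\<^sup>2 \<le> ?q a" by (rule N.square_integral_le) (use path_properties[OF \<nu> a] in auto)
    moreover have "\<bar>?m a\<bar> \<le> 1 + (?m a)\<^sup>2"
      using sum_squares_bound[of 1 "\<bar>?m a\<bar>"] zero_le_power2[of "?m a"] by simp
    moreover have "0 \<le> ?I a / c" using c1 by simp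
    moreover have "0 \<le> ?q a" by simp
    moreover have "0 \<le> x\<^sup>2" by simp
    ultimately show ?thesis using bounds[OF a] unfolding abs_le_iff by linarith
  qed
  have int_L: "integrable A (\<lambda>a. log_partition \<nu> (g a))"
    by (rule Bochner_Integration.integrable_bound[OF dom L])
      (use le in \<open>auto intro!: AE_I2 order_trans[OF _ abs_ge_self]\<close>)
  have "(\<integral>a. ?m a \<partial>A) \<le> (\<integral>a. log_partition \<nu> (g a) \<partial>A)"
    by (rule integral_mono[OF ints(1) int_L]) (rule bounds)
  then show "0 \<le> (\<integral>a. log_partition \<nu> (g a) \<partial>A)" by (simp add: ints)
  have "(\<integral>a. log_partition \<nu> (g a) \<partial>A) \<le> (\<integral>a. x\<^sup>2 / 2 + ?I a / c - 1 \<partial>A)"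
    by (rule integral_mono[OF int_L]) (use I bounds in auto)
  also have "\<dots> = x\<^sup>2 / 2 + (\<integral>a. ?I a \<partial>A) / c - 1" using I by (simp add: prob_space)
  also have "\<dots> \<le> x\<^sup>2"
  proof -
    have "(\<integral>a. ?I a \<partial>A) / c \<le> 1" using I(2) c1 by simp
    moreover have "0 \<le> x\<^sup>2" by simp
    ultimately show ?thesis by linarith
  qed
  finally show "(\<integral>a. log_partition \<nu> (g a) \<partial>A) \<le> x\<^sup>2" .
  have "(\<integral>\<^sup>+a. ennreal \<bar>log_partition \<nu> (g a)\<bar> \<partial>A) \<le> (\<integral>\<^sup>+a. ennreal (1 + ?q a + x\<^sup>2 / 2 + ?I a / c) \<partial>A)"
    by (intro nn_integral_mono ennreal_leI le)
  also have "\<dots> = ennreal (\<integral>a. 1 + ?q a + x\<^sup>2 / 2 + ?I a / c \<partial>A)"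
    by (rule nn_integral_eq_integral[OF dom]) (use c1 in auto)
  also have "\<dots> \<le> ennreal (3 + 2 * x\<^sup>2)"
  proof (rule ennreal_leI)
    have "(\<integral>t. covariance t t \<partial>\<nu>) \<le> x\<^sup>2"
       using covariance_bound
      by (intro N.integral_between(2)[where a="-(x\<^sup>2)"] covariance_integrable[OF \<nu>])
        (auto simp: space_base[OF \<nu>] abs_le_iff minus_le_iff)
    moreover have "(\<integral>a. ?I a \<partial>A) / c \<le> 1" using I(2) c1 by simp
    moreover have "0 \<le> x\<^sup>2" by simp
    moreover have "(\<integral>a. 1 + ?q a + x\<^sup>2 / 2 + ?I a / c \<partial>A)
        = 1 + (\<integral>t. covariance t t \<partial>\<nu>) + x\<^sup>2 / 2 + (\<integral>a. ?I a \<partial>A) / c"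
      using ints I(1) by (simp add: prob_space)
    ultimately show "(\<integral>a. 1 + ?q a + x\<^sup>2 / 2 + ?I a / c \<partial>A) \<le> 3 + 2 * x\<^sup>2" by linarith
  qed
  finally show "(\<integral>\<^sup>+a. ennreal \<bar>log_partition \<nu> (g a)\<bar> \<partial>A) \<le> ennreal (3 + 2 * x\<^sup>2)" .
qed

lemma tame: "tame_field \<tau> A g"
  unfolding tame_field_def
proof (intro conjI ballI exI[of _ "3 + 2 * x\<^sup>2"] allI impI)
  show "(\<integral>\<^sup>+a. ennreal \<bar>log_partition \<nu> (g a)\<bar> \<partial>A) \<le> ennreal (3 + 2 * x\<^sup>2)"
    if "prob_space \<nu>" "sets \<nu> = sets \<tau>" for \<nu>
    by (rule log_partition_upper(1)[OF that])
qed (fact field_measurable prob_space_axioms bounded_paths)+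

text \<open>
  For \<open>x > 1\<close> the expansion is of no use, as exponential moments of order \<open>x\<^sup>2\<close> would enter; but then
  both sides are of the order \<open>x\<^sup>2 \<le> x ^ 3\<close>.
\<close>

lemma expansion:
  assumes \<nu>: "prob_space \<nu>" "sets \<nu> = sets \<tau>"
  shows "\<bar>(\<integral>a. log_partition \<nu> (g a) \<partial>A) - half_variance \<nu> covariance\<bar> \<le> 1442 * exp 25 * x ^ 3"
proof (cases "x \<le> 1")
  case True
  show ?thesis by (rule log_partition_expansion(1)[OF \<nu> remainder_moment[OF \<nu> True]]) (use x_pos in simp)
next
  case False
  have "\<bar>(\<integral>a. log_partition \<nu> (g a) \<partial>A) - half_variance \<nu> covariance\<bar> \<le> 2 * x\<^sup>2"
    using log_partition_upper(2,3)[OF \<nu>] half_variance_bound[OF \<nu>] by linarith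
  also have "\<dots> \<le> 2 * x ^ 3" using False power_increasing[of 2 3 x] by simp
  also have "\<dots> \<le> 1442 * exp 25 * x ^ 3"
  proof (rule mult_right_mono)
    have "(1::real) \<le> exp 25" by simp
    then show "(2::real) \<le> 1442 * exp 25" by linarith
  qed (use x_pos in simp)
  finally show ?thesis .
qed

end


section \<open>Measurability on a compact metrizable parameter set\<close>

text \<open>
  Compact metric spaces are totally bounded, and the balls of radius \<open>1 / n\<close> around finite nets form
  a base.
\<close>

lemma compact_metrizable_countable_base:
  assumes "compact T" "metrizable_space (top_of_set T)"
  obtains \<B> where "countable \<B>" "\<And>B. B \<in> \<B> \<Longrightarrow> openin (top_of_set T) B"
    "\<And>U t. openin (top_of_set T) U \<Longrightarrow> t \<in> U \<Longrightarrow> \<exists>B\<in>\<B>. t \<in> B \<and> B \<subseteq> U"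
proof -
  obtain X d where Xd: "Metric_space X d" "top_of_set T = Metric_space.mtopology X d"
    using assms(2) unfolding metrizable_space_def by blast
  interpret Metric_space X d by fact
  have T: "X = T" using Xd(2) topspace_mtopology by (metis topspace_euclidean_subtopology)
  have "compact_space mtopology"
    using assms(1) Xd(2) by (metis compact_space_subtopology compactin_euclidean_iff)
  then have tb: "mtotally_bounded X"
    using compactin_imp_mtotally_bounded[of X] by (simp add: compact_space_def)
  have "\<exists>K. finite K \<and> K \<subseteq> X \<and> X \<subseteq> (\<Union>x\<in>K. mball x (1 / Suc n))" for n
    using tb unfolding mtotally_bounded_def by (meson divide_pos_pos of_nat_0_less_iff zero_less_Suc zero_less_one)
  then obtain K where K: "\<And>n. finite (K n)" "\<And>n. K n \<subseteq> X" "\<And>n. X \<subseteq> (\<Union>x\<in>K n. mball x (1 / Suc n))"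
    by metis
  define \<B> where "\<B> = (\<Union>n. (\<lambda>x. mball x (1 / Suc n)) ` K n)"
  show thesis
  proof (rule that[of \<B>])
    show "countable \<B>" unfolding \<B>_def using K(1) by (simp add: countable_finite)
    show "openin (top_of_set T) B" if "B \<in> \<B>" for B
      using that unfolding \<B>_def Xd(2) by auto
    fix U t assume U: "openin (top_of_set T) U" "t \<in> U"
    then obtain r where r: "r > 0" "mball t r \<subseteq> U" "t \<in> X"
      using openin_mtopology[of U] unfolding Xd(2) by (meson subsetD)
    obtain n where n: "1 / Suc n < r / 2"
      using nat_approx_posE[of "r / 2"] r(1) by auto
    obtain x where x: "x \<in> K n" "t \<in> mball x (1 / Suc n)"
      using K(3)[of n] r(3) by auto
    have "mball x (1 / Suc n) \<subseteq> mball t r"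
    proof
      fix y assume y: "y \<in> mball x (1 / Suc n)"
      have "d t y \<le> d t x + d x y" using x y by (intro triangle) auto
      also have "\<dots> < r" using x y n by (auto simp: commute)
      finally show "y \<in> mball t r" using y r(3) by auto
    qed
    then show "\<exists>B\<in>\<B>. t \<in> B \<and> B \<subseteq> U"
      using x r(2) unfolding \<B>_def by blast
  qed
qed

locale compact_metrizable_base =
  fixes T :: "'p::topological_space set" and \<tau> :: "'p measure"
  assumes compact_T: "compact T"
    and metrizable_T: "metrizable_space (top_of_set T)"
    and sets_\<tau>: "sets \<tau> = sets (restrict_space borel T)"
begin

lemma space_\<tau>: "space \<tau> = T"
  using sets_eq_imp_space_eq[OF sets_\<tau>] by (simp add: space_restrict_space)

lemma openin_sets: "openin (top_of_set T) B \<Longrightarrow> B \<in> sets \<tau>"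
  by (auto simp: sets_\<tau> openin_open sets_restrict_space intro!: imageI borel_open)

text \<open>
  The graph of any function on \<open>T\<close>, measurable or not, is separable, so a countable set of points
  approximates every point and its value at the same time. So the supremum over \<open>T\<close> of an arbitrary function
  perturbed by continuous ones is a countable supremum.
\<close>

lemma countable_graph_dense:
  fixes c :: "'p \<Rightarrow> real"
  obtains D where "countable D" "D \<subseteq> T"
    "\<And>U t a b. openin (top_of_set T) U \<Longrightarrow> t \<in> U \<Longrightarrow> a < c t \<Longrightarrow> c t < b \<Longrightarrow>
       \<exists>s\<in>D. s \<in> U \<and> a < c s \<and> c s < b"
proof -
  obtain \<B> where \<B>: "countable \<B>" "\<And>B. B \<in> \<B> \<Longrightarrow> openin (top_of_set T) B"
    "\<And>U t. openin (top_of_set T) U \<Longrightarrow> t \<in> U \<Longrightarrow> \<exists>B\<in>\<B>. t \<in> B \<and> B \<subseteq> U"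
    using compact_metrizable_countable_base[OF compact_T metrizable_T] by metis
  define S where "S = (\<lambda>(B, p, q). {t\<in>B. real_of_rat p < c t \<and> c t < real_of_rat q})"
  define pick where "pick = (\<lambda>k. SOME t. t \<in> S k)"
  define I where "I = {k \<in> \<B> \<times> (UNIV :: rat set) \<times> (UNIV :: rat set). S k \<noteq> {}}"
  have pick: "pick k \<in> S k" if "k \<in> I" for k
    using that unfolding pick_def I_def by (auto intro: someI)
  show thesis
  proof (rule that[of "pick ` I"])
    have "countable (\<B> \<times> (UNIV :: rat set) \<times> (UNIV :: rat set))" using \<B>(1) by simp
    then have "countable I" unfolding I_def by (rule countable_subset[rotated]) auto
    then show "countable (pick ` I)" by simp
    show "pick ` I \<subseteq> T"
    proof
      fix t assume "t \<in> pick ` I"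
      then obtain B p q where k: "(B, p, q) \<in> I" "t = pick (B, p, q)" by (metis imageE prod_cases3)
      then have "t \<in> B" "B \<in> \<B>" using pick[OF k(1)] by (auto simp: S_def I_def)
      then show "t \<in> T" using \<B>(2) openin_imp_subset by blast
    qed
    fix U t a b assume U: "openin (top_of_set T) U" "t \<in> U" and ab: "a < c t" "c t < b"
    obtain B where B: "B \<in> \<B>" "t \<in> B" "B \<subseteq> U" using \<B>(3) U by blast
    obtain p where p: "a < real_of_rat p" "real_of_rat p < c t" using of_rat_dense[OF ab(1)] by blast
    obtain q where q: "c t < real_of_rat q" "real_of_rat q < b" using of_rat_dense[OF ab(2)] by blast
    have k: "(B, p, q) \<in> I" using B p q by (auto simp: I_def S_def)
    from pick[OF this] have "pick (B, p, q) \<in> B" "real_of_rat p < c (pick (B, p, q))"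
      "c (pick (B, p, q)) < real_of_rat q" by (auto simp: S_def)
    then show "\<exists>s\<in>pick ` I. s \<in> U \<and> a < c s \<and> c s < b"
      using k B(3) p q by (intro bexI[of _ "pick (B, p, q)"]) auto
  qed
qed

lemma continuous_preimage_openin:
  fixes f :: "'p \<Rightarrow> real"
  assumes "continuous_on T f" "open O'"
  shows "openin (top_of_set T) {t\<in>T. f t \<in> O'}"
proof -
  have "{t\<in>T. f t \<in> O'} = T \<inter> f -` O'" by auto
  then show ?thesis using continuous_openin_preimage_gen[OF assms] by simp
qed

text \<open>
  The hypothesis is all that continuity of the full likelihood process gives for one component: the
  difference of two paths is continuous, but the paths themselves may share an irregular drift.
\<close>

lemma SUP_perturbed_measurable:
  fixes R :: "'p \<Rightarrow> 'w \<Rightarrow> real"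
  assumes meas: "\<And>t. t \<in> T \<Longrightarrow> R t \<in> borel_measurable N"
    and cont: "\<And>\<omega> \<omega>'. \<omega> \<in> space N \<Longrightarrow> \<omega>' \<in> space N \<Longrightarrow> continuous_on T (\<lambda>t. R t \<omega> - R t \<omega>')"
  shows "(\<lambda>\<omega>. SUP t\<in>T. ennreal (\<bar>R t \<omega>\<bar> ^ 3)) \<in> borel_measurable N"
proof (cases "space N = {}")
  case True
  then show ?thesis by (auto simp: measurable_def)
next
  case False
  then obtain \<omega>0 where \<omega>0: "\<omega>0 \<in> space N" by auto
  obtain D where D: "countable D" "D \<subseteq> T"
    "\<And>U t a b. openin (top_of_set T) U \<Longrightarrow> t \<in> U \<Longrightarrow> a < R t \<omega>0 \<Longrightarrow> R t \<omega>0 < b \<Longrightarrow>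
       \<exists>s\<in>D. s \<in> U \<and> a < R s \<omega>0 \<and> R s \<omega>0 < b"
    using countable_graph_dense[of "\<lambda>t. R t \<omega>0"] by metis
  have "(SUP t\<in>T. ennreal (\<bar>R t \<omega>\<bar> ^ 3)) = (SUP t\<in>D. ennreal (\<bar>R t \<omega>\<bar> ^ 3))" if \<omega>: "\<omega> \<in> space N" for \<omega>
  proof (rule antisym)
    show "(SUP t\<in>D. ennreal (\<bar>R t \<omega>\<bar> ^ 3)) \<le> (SUP t\<in>T. ennreal (\<bar>R t \<omega>\<bar> ^ 3))"
      by (rule SUP_subset_mono[OF D(2)]) simp
    show "(SUP t\<in>T. ennreal (\<bar>R t \<omega>\<bar> ^ 3)) \<le> (SUP t\<in>D. ennreal (\<bar>R t \<omega>\<bar> ^ 3))"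
    proof (rule SUP_least, rule ccontr)
      fix t assume t: "t \<in> T" and "\<not> ennreal (\<bar>R t \<omega>\<bar> ^ 3) \<le> (SUP t\<in>D. ennreal (\<bar>R t \<omega>\<bar> ^ 3))"
      then have lt: "(SUP t\<in>D. ennreal (\<bar>R t \<omega>\<bar> ^ 3)) < ennreal (\<bar>R t \<omega>\<bar> ^ 3)" by simp
      let ?k = "\<lambda>s. R s \<omega> - R s \<omega>0"
      \<comment> \<open>Points of \<open>D\<close> approach \<open>t\<close> together with the values at \<open>\<omega>0\<close>, so the values at \<open>\<omega>\<close> come close as well.\<close>
      have "\<exists>s\<in>D. \<bar>R t \<omega>\<bar> - e < \<bar>R s \<omega>\<bar>" if e: "e > 0" for e
      proof -
        let ?U = "{s\<in>T. ?k s \<in> ball (?k t) (e / 2)}"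
        have U: "openin (top_of_set T) ?U"
          by (rule continuous_preimage_openin[OF cont[OF \<omega> \<omega>0]]) simp
        have "t \<in> ?U" using t e by simp
        from D(3)[OF U this, of "R t \<omega>0 - e / 2" "R t \<omega>0 + e / 2"] e obtain s where
          s: "s \<in> D" "s \<in> ?U" "R t \<omega>0 - e / 2 < R s \<omega>0" "R s \<omega>0 < R t \<omega>0 + e / 2" by auto
        then have "\<bar>?k t - ?k s\<bar> < e / 2" by (simp add: dist_real_def)
        then have "\<bar>R t \<omega>\<bar> - e < \<bar>R s \<omega>\<bar>" using s(3,4) by linarith
        then show ?thesis using s(1) by blast
      qed
      note near = this
      have "ennreal (x ^ 3) \<le> (SUP t\<in>D. ennreal (\<bar>R t \<omega>\<bar> ^ 3))" if x: "0 \<le> x" "x < \<bar>R t \<omega>\<bar>" for x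
      proof -
        obtain s where s: "s \<in> D" "x < \<bar>R s \<omega>\<bar>" using near[of "\<bar>R t \<omega>\<bar> - x"] x by auto
        have "x ^ 3 \<le> \<bar>R s \<omega>\<bar> ^ 3" using s x by (intro power_mono) auto
        then have "ennreal (x ^ 3) \<le> ennreal (\<bar>R s \<omega>\<bar> ^ 3)" by (rule ennreal_leI)
        also have "\<dots> \<le> (SUP t\<in>D. ennreal (\<bar>R t \<omega>\<bar> ^ 3))" by (rule SUP_upper[OF s(1)])
        finally show ?thesis .
      qed
      note below = this
      have pos: "0 < \<bar>R t \<omega>\<bar>"
        using lt by (cases "R t \<omega> = 0") auto
      have "((\<lambda>x. ennreal (x ^ 3)) \<longlongrightarrow> ennreal (\<bar>R t \<omega>\<bar> ^ 3)) (at_left \<bar>R t \<omega>\<bar>)"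
        by (intro tendsto_intros)
      moreover have "eventually (\<lambda>x. ennreal (x ^ 3) \<le> (SUP t\<in>D. ennreal (\<bar>R t \<omega>\<bar> ^ 3))) (at_left \<bar>R t \<omega>\<bar>)"
        using eventually_at_left_real[OF pos] by eventually_elim (rule below, auto)
      ultimately have "ennreal (\<bar>R t \<omega>\<bar> ^ 3) \<le> (SUP t\<in>D. ennreal (\<bar>R t \<omega>\<bar> ^ 3))"
        by (rule tendsto_upperbound) simp
      then show False using lt by simp
    qed
  qed
  moreover have "(\<lambda>\<omega>. SUP t\<in>D. ennreal (\<bar>R t \<omega>\<bar> ^ 3)) \<in> borel_measurable N"
  proof (rule borel_measurable_SUP[OF D(1)])
    fix t assume "t \<in> D"
    then have [measurable]: "R t \<in> borel_measurable N" using D(2) meas by auto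
    show "(\<lambda>\<omega>. ennreal (\<bar>R t \<omega>\<bar> ^ 3)) \<in> borel_measurable N" by measurable
  qed
  ultimately show ?thesis by (simp cong: measurable_cong)
qed

text \<open>
  A path exceeds \<open>a\<close> at \<open>t\<close> iff on some basic neighbourhood of \<open>t\<close> it is at least some rational
  \<open>q > a\<close>, and by continuity this can be tested on a countable dense set.
\<close>

lemma caratheodory_measurable:
  fixes f :: "'w \<Rightarrow> 'p \<Rightarrow> real"
  assumes meas: "\<And>t. t \<in> T \<Longrightarrow> (\<lambda>\<omega>. f \<omega> t) \<in> borel_measurable N"
    and cont: "\<And>\<omega>. \<omega> \<in> space N \<Longrightarrow> continuous_on T (f \<omega>)"
  shows "case_prod f \<in> borel_measurable (N \<Otimes>\<^sub>M \<tau>)"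
proof -
  obtain \<B> where \<B>: "countable \<B>" "\<And>B. B \<in> \<B> \<Longrightarrow> openin (top_of_set T) B"
    "\<And>U t. openin (top_of_set T) U \<Longrightarrow> t \<in> U \<Longrightarrow> \<exists>B\<in>\<B>. t \<in> B \<and> B \<subseteq> U"
    using compact_metrizable_countable_base[OF compact_T metrizable_T] by metis
  obtain D where D: "countable D" "D \<subseteq> T"
    "\<And>U t. openin (top_of_set T) U \<Longrightarrow> t \<in> U \<Longrightarrow> \<exists>s\<in>D. s \<in> U"
    using countable_graph_dense[of "\<lambda>_. 0"] by (metis less_numeral_extra(1) neg_less_0_iff_less)
  show ?thesis
  proof (rule borel_measurableI_greater)
    fix a :: real
    let ?E = "\<lambda>B q. {\<omega>\<in>space N. \<forall>s\<in>D \<inter> B. real_of_rat q \<le> f \<omega> s} \<times> B"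
    let ?I = "\<B> \<times> {q. a < real_of_rat q}"
    have "{p \<in> space (N \<Otimes>\<^sub>M \<tau>). a < case_prod f p} = (\<Union>(B, q)\<in>?I. ?E B q)"
    proof (intro equalityI subsetI)
      fix p assume "p \<in> {p \<in> space (N \<Otimes>\<^sub>M \<tau>). a < case_prod f p}"
      then obtain \<omega> t where p: "p = (\<omega>, t)" "\<omega> \<in> space N" "t \<in> T" "a < f \<omega> t"
        by (auto simp: space_pair_measure space_\<tau>)
      obtain q where q: "a < real_of_rat q" "real_of_rat q < f \<omega> t" using of_rat_dense[OF p(4)] by blast
      have "openin (top_of_set T) {s\<in>T. f \<omega> s \<in> {real_of_rat q<..}}"
        by (rule continuous_preimage_openin[OF cont[OF p(2)]]) simp
      from \<B>(3)[OF this, of t] q p obtain B where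
        "B \<in> \<B>" "t \<in> B" "B \<subseteq> {s\<in>T. f \<omega> s \<in> {real_of_rat q<..}}" by auto
      then show "p \<in> (\<Union>(B, q)\<in>?I. ?E B q)"
        using p q by (auto intro!: bexI[of _ "(B, q)"] less_imp_le)
    next
      fix p assume "p \<in> (\<Union>(B, q)\<in>?I. ?E B q)"
      then obtain B q \<omega> t where p: "p = (\<omega>, t)" "B \<in> \<B>" "a < real_of_rat q" "t \<in> B" "\<omega> \<in> space N"
        and le: "\<forall>s\<in>D \<inter> B. real_of_rat q \<le> f \<omega> s" by auto
      have B: "openin (top_of_set T) B" using \<B>(2) p(2) by blast
      then have t: "t \<in> T" using p(4) openin_imp_subset by blast
      have "real_of_rat q \<le> f \<omega> t"
      proof (rule ccontr)
        assume "\<not> real_of_rat q \<le> f \<omega> t"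
        then have "t \<in> B \<inter> {s\<in>T. f \<omega> s \<in> {..<real_of_rat q}}" using p(4) t by auto
        moreover have "openin (top_of_set T) (B \<inter> {s\<in>T. f \<omega> s \<in> {..<real_of_rat q}})"
          by (intro openin_Int B continuous_preimage_openin[OF cont[OF p(5)]]) simp
        ultimately obtain s where "s \<in> D" "s \<in> B" "f \<omega> s < real_of_rat q" using D(3) by blast
        then show False using le by force
      qed
      then show "p \<in> {p \<in> space (N \<Otimes>\<^sub>M \<tau>). a < case_prod f p}"
        using p t by (auto simp: space_pair_measure space_\<tau>)
    qed
    moreover have "(\<Union>(B, q)\<in>?I. ?E B q) \<in> sets (N \<Otimes>\<^sub>M \<tau>)"
    proof (rule sets.countable_UN'')
      show "countable ?I" using \<B>(1) by simp
      fix k assume "k \<in> ?I"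
      then obtain B q where k: "k = (B, q)" "B \<in> \<B>" by auto
      have "{\<omega>\<in>space N. \<forall>s\<in>D \<inter> B. real_of_rat q \<le> f \<omega> s} \<in> sets N"
      proof -
        have "{\<omega>\<in>space N. f \<omega> s < real_of_rat q} \<in> sets N" if "s \<in> D \<inter> B" for s
        proof -
          have [measurable]: "(\<lambda>\<omega>. f \<omega> s) \<in> borel_measurable N" using that D(2) meas by auto
          show ?thesis by measurable
        qed
        then have "space N - (\<Union>s\<in>D \<inter> B. {\<omega>\<in>space N. f \<omega> s < real_of_rat q}) \<in> sets N"
          using D(1) by (intro sets.Diff sets.top sets.countable_UN'') (auto simp: countable_Int1)
        also have "space N - (\<Union>s\<in>D \<inter> B. {\<omega>\<in>space N. f \<omega> s < real_of_rat q})
            = {\<omega>\<in>space N. \<forall>s\<in>D \<inter> B. real_of_rat q \<le> f \<omega> s}" by (force simp: not_less)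
        finally show ?thesis .
      qed
      then show "(case k of (B, q) \<Rightarrow> ?E B q) \<in> sets (N \<Otimes>\<^sub>M \<tau>)"
        using k \<B>(2) openin_sets by (auto intro: pair_measureI)
    qed
    ultimately show "{p \<in> space (N \<Otimes>\<^sub>M \<tau>). a < case_prod f p} \<in> sets (N \<Otimes>\<^sub>M \<tau>)" by simp
  qed
qed

lemma continuous_bounded_on_T:
  fixes f :: "'p \<Rightarrow> real"
  assumes "continuous_on T f"
  shows "\<exists>B. \<forall>t\<in>T. \<bar>f t\<bar> \<le> B"
  using compact_imp_bounded[OF compact_continuous_image[OF assms compact_T]]
  by (auto simp: bounded_iff)

end


section \<open>Random operators\<close>

lemma op_norm_on_measurable:
  fixes V :: "'w \<Rightarrow> 'h \<Rightarrow> 'h::{real_inner, second_countable_topology}"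
  assumes bdd: "\<And>\<omega>. \<omega> \<in> space N \<Longrightarrow> bounded_operator_on H (V \<omega>)"
    and meas: "\<And>h. h \<in> H \<Longrightarrow> (\<lambda>\<omega>. V \<omega> h) \<in> borel_measurable N"
    and H: "subspace H"
  shows "(\<lambda>\<omega>. op_norm_on H (V \<omega>)) \<in> borel_measurable N"
proof -
  obtain D where D: "countable D" "D \<subseteq> H \<inter> cball 0 1" "H \<inter> cball 0 1 \<subseteq> closure D"
    using separable[of "H \<inter> cball 0 1"] by metis
  have "op_norm_on H (V \<omega>) = (SUP x\<in>D. ennreal (norm (V \<omega> x)))" if \<omega>: "\<omega> \<in> space N" for \<omega>
    unfolding op_norm_on_def
  proof (rule antisym)
    show "(SUP x\<in>D. ennreal (norm (V \<omega> x))) \<le> (SUP x\<in>H \<inter> cball 0 1. ennreal (norm (V \<omega> x)))"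
      by (rule SUP_subset_mono[OF D(2)]) simp
    obtain B where V: "\<And>x y. x \<in> H \<Longrightarrow> y \<in> H \<Longrightarrow> V \<omega> (x + y) = V \<omega> x + V \<omega> y"
      "\<And>x. x \<in> H \<Longrightarrow> norm (V \<omega> x) \<le> B * norm x"
      using bdd[OF \<omega>] unfolding bounded_operator_on_def by blast
    show "(SUP x\<in>H \<inter> cball 0 1. ennreal (norm (V \<omega> x))) \<le> (SUP x\<in>D. ennreal (norm (V \<omega> x)))"
    proof (rule SUP_least)
      fix x assume x: "x \<in> H \<inter> cball 0 1"
      then have "x \<in> closure D" using D(3) by blast
      then obtain y where y: "\<And>n. y n \<in> D" "y \<longlonglongrightarrow> x"
        by (auto simp: closure_sequential)
      have yH: "y n \<in> H" for n using y(1) D(2) by auto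
      have le: "norm (V \<omega> x) \<le> norm (V \<omega> (y n)) + \<bar>B\<bar> * norm (x - y n)" for n
      proof -
        have xy: "x - y n \<in> H" using x yH H by (auto intro: subspace_diff)
        have "V \<omega> x = V \<omega> (y n) + V \<omega> (x - y n)" using V(1)[OF yH[of n] xy] by simp
        then have "norm (V \<omega> x) \<le> norm (V \<omega> (y n)) + norm (V \<omega> (x - y n))"
          by (simp add: norm_triangle_ineq)
        also have "norm (V \<omega> (x - y n)) \<le> \<bar>B\<bar> * norm (x - y n)"
          using V(2)[OF xy] by (rule order_trans) (simp add: mult_right_mono)
        finally show ?thesis by simp
      qed
      have "ennreal (norm (V \<omega> x)) \<le> (SUP x\<in>D. ennreal (norm (V \<omega> x))) + ennreal (\<bar>B\<bar> * norm (x - y n))" for n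
      proof -
        have "ennreal (norm (V \<omega> x)) \<le> ennreal (norm (V \<omega> (y n))) + ennreal (\<bar>B\<bar> * norm (x - y n))"
          using le[of n] by (subst ennreal_plus[symmetric]) (auto intro: ennreal_leI simp del: ennreal_plus)
        then show ?thesis using SUP_upper[OF y(1), of "\<lambda>x. ennreal (norm (V \<omega> x))" n]
          by (meson add_mono order_refl order_trans)
      qed
      moreover have "(\<lambda>n. (SUP x\<in>D. ennreal (norm (V \<omega> x))) + ennreal (\<bar>B\<bar> * norm (x - y n)))
          \<longlonglongrightarrow> (SUP x\<in>D. ennreal (norm (V \<omega> x))) + ennreal (\<bar>B\<bar> * norm (x - x))"
        by (intro tendsto_intros y(2))
      ultimately show "ennreal (norm (V \<omega> x)) \<le> (SUP x\<in>D. ennreal (norm (V \<omega> x)))"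
        by (intro LIMSEQ_le_const[of _ "(SUP x\<in>D. ennreal (norm (V \<omega> x)))"]) auto
    qed
  qed
  moreover have "(\<lambda>\<omega>. SUP x\<in>D. ennreal (norm (V \<omega> x))) \<in> borel_measurable N"
  proof (rule borel_measurable_SUP[OF D(1)])
    fix x assume "x \<in> D"
    then have [measurable]: "(\<lambda>\<omega>. V \<omega> x) \<in> borel_measurable N" using D(2) meas by auto
    show "(\<lambda>\<omega>. ennreal (norm (V \<omega> x))) \<in> borel_measurable N" by measurable
  qed
  ultimately show ?thesis by (simp cong: measurable_cong)
qed

lemma norm_le_op_norm:
  fixes A :: "'h \<Rightarrow> 'h::real_inner"
  assumes "bounded_operator_on H A" "subspace H" "x \<in> H"
  shows "norm (A x) \<le> enn2real (op_norm_on H A) * norm x" "op_norm_on H A < \<top>"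
proof -
  obtain B where B: "\<And>x. x \<in> H \<Longrightarrow> norm (A x) \<le> B * norm x"
    and sc: "\<And>c x. x \<in> H \<Longrightarrow> A (c *\<^sub>R x) = c *\<^sub>R A x"
    using assms(1) unfolding bounded_operator_on_def by blast
  have "op_norm_on H A \<le> ennreal \<bar>B\<bar>"
    unfolding op_norm_on_def
  proof (rule SUP_least)
    fix x assume x: "x \<in> H \<inter> cball 0 1"
    have "norm (A x) \<le> \<bar>B\<bar> * norm x"
    proof (rule order_trans)
      show "norm (A x) \<le> B * norm x" using x B by simp
    qed (simp add: mult_right_mono)
    also have "\<dots> \<le> \<bar>B\<bar> * 1" using x by (intro mult_left_mono) auto
    finally show "ennreal (norm (A x)) \<le> ennreal \<bar>B\<bar>" by (simp add: ennreal_leI)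
  qed
  then show fin: "op_norm_on H A < \<top>" by (simp add: order_le_less_trans)
  show "norm (A x) \<le> enn2real (op_norm_on H A) * norm x"
  proof (cases "x = 0")
    case True
    then show ?thesis using B[OF assms(3)] by simp
  next
    case False
    let ?u = "(1 / norm x) *\<^sub>R x"
    have u: "?u \<in> H \<inter> cball 0 1" using assms(2,3) False by (auto intro: subspace_scale)
    have "ennreal (norm (A ?u)) \<le> op_norm_on H A"
      unfolding op_norm_on_def by (rule SUP_upper[OF u])
    then have "norm (A ?u) \<le> enn2real (op_norm_on H A)"
      using fin by (metis enn2real_ennreal enn2real_mono norm_ge_zero)
    then show ?thesis using False by (simp add: sc[OF assms(3)] field_simps)
  qed
qed


section \<open>Moment bounds\<close>

text \<open>
  Stated with the nonnegative integral, so that integrability is part of the bound.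
\<close>

definition moment_le :: "nat \<Rightarrow> 'w measure \<Rightarrow> ('w \<Rightarrow> real) \<Rightarrow> real \<Rightarrow> bool" where
  "moment_le k N f c \<longleftrightarrow>
     f \<in> borel_measurable N \<and> 0 \<le> c \<and> (\<integral>\<^sup>+\<omega>. ennreal (\<bar>f \<omega>\<bar> ^ k) \<partial>N) \<le> ennreal c"

lemma moment_leD:
  assumes "moment_le k N f c"
  shows "f \<in> borel_measurable N" "0 \<le> c" "integrable N (\<lambda>\<omega>. \<bar>f \<omega>\<bar> ^ k)" "(\<integral>\<omega>. \<bar>f \<omega>\<bar> ^ k \<partial>N) \<le> c"
proof -
  show [measurable]: "f \<in> borel_measurable N" and c: "0 \<le> c" using assms by (auto simp: moment_le_def)
  have le: "(\<integral>\<^sup>+\<omega>. ennreal (\<bar>f \<omega>\<bar> ^ k) \<partial>N) \<le> ennreal c" using assms by (simp add: moment_le_def)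
  then show "integrable N (\<lambda>\<omega>. \<bar>f \<omega>\<bar> ^ k)"
    by (intro integrableI_bounded) (auto simp: order_le_less_trans)
  show "(\<integral>\<omega>. \<bar>f \<omega>\<bar> ^ k \<partial>N) \<le> c" by (rule integral_real_bounded[OF c le])
qed

lemma moment_leI:
  assumes "f \<in> borel_measurable N" "integrable N (\<lambda>\<omega>. \<bar>f \<omega>\<bar> ^ k)" "(\<integral>\<omega>. \<bar>f \<omega>\<bar> ^ k \<partial>N) \<le> c"
  shows "moment_le k N f c"
proof -
  have "0 \<le> (\<integral>\<omega>. \<bar>f \<omega>\<bar> ^ k \<partial>N)" by simp
  then have "0 \<le> c" using assms(3) by linarith
  then show ?thesis
    using assms by (auto simp: moment_le_def nn_integral_eq_integral intro!: ennreal_leI)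
qed

lemma moment_le_mono:
  assumes "moment_le k N f c" "c \<le> d"
  shows "moment_le k N f d"
  using assms unfolding moment_le_def by (meson ennreal_leI order_trans)

lemma moment_le_bound:
  assumes "moment_le k N f c" "g \<in> borel_measurable N" "\<And>\<omega>. \<omega> \<in> space N \<Longrightarrow> \<bar>g \<omega>\<bar> \<le> \<bar>f \<omega>\<bar>"
  shows "moment_le k N g c"
proof -
  have "(\<integral>\<^sup>+\<omega>. ennreal (\<bar>g \<omega>\<bar> ^ k) \<partial>N) \<le> (\<integral>\<^sup>+\<omega>. ennreal (\<bar>f \<omega>\<bar> ^ k) \<partial>N)"
    by (intro nn_integral_mono ennreal_leI power_mono assms) auto
  then show ?thesis using assms unfolding moment_le_def by (meson order_trans)
qed

lemma power_add_le:
  fixes x y :: real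
  shows "\<bar>x + y\<bar> ^ 2 \<le> 2 * (\<bar>x\<bar> ^ 2 + \<bar>y\<bar> ^ 2)" "\<bar>x + y\<bar> ^ 3 \<le> 4 * (\<bar>x\<bar> ^ 3 + \<bar>y\<bar> ^ 3)"
proof -
  show "\<bar>x + y\<bar> ^ 2 \<le> 2 * (\<bar>x\<bar> ^ 2 + \<bar>y\<bar> ^ 2)"
    using sum_squares_bound[of x y] by (simp add: power2_sum)
  define a b where "a = \<bar>x\<bar>" and "b = \<bar>y\<bar>"
  have "0 \<le> 3 * (a + b) * (a - b)\<^sup>2" by (simp add: a_def b_def)
  also have "\<dots> = 4 * (a ^ 3 + b ^ 3) - (a + b) ^ 3"
    by (simp add: power2_eq_square power3_eq_cube algebra_simps)
  finally have "(a + b) ^ 3 \<le> 4 * (a ^ 3 + b ^ 3)" by simp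
  moreover have "\<bar>x + y\<bar> ^ 3 \<le> (a + b) ^ 3"
    by (intro power_mono) (simp_all add: a_def b_def abs_triangle_ineq)
  ultimately show "\<bar>x + y\<bar> ^ 3 \<le> 4 * (\<bar>x\<bar> ^ 3 + \<bar>y\<bar> ^ 3)"
    unfolding a_def b_def by linarith
qed

lemma moment_le_add:
  assumes "moment_le k N f c" "moment_le k N g d"
    and K: "\<And>x y :: real. \<bar>x + y\<bar> ^ k \<le> K * (\<bar>x\<bar> ^ k + \<bar>y\<bar> ^ k)"
  shows "moment_le k N (\<lambda>\<omega>. f \<omega> + g \<omega>) (K * (c + d))"
proof (rule moment_leI)
  note f = moment_leD[OF assms(1)] and g = moment_leD[OF assms(2)]
  note [measurable] = f(1) g(1)
  have K0: "0 \<le> K"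
  proof -
    have "0 \<le> \<bar>1 + 1 :: real\<bar> ^ k" by simp
    also have "\<dots> \<le> K * (\<bar>1\<bar> ^ k + \<bar>1\<bar> ^ k)" by (rule K)
    finally show ?thesis by simp
  qed
  show "(\<lambda>\<omega>. f \<omega> + g \<omega>) \<in> borel_measurable N" by measurable
  have dom: "integrable N (\<lambda>\<omega>. K * (\<bar>f \<omega>\<bar> ^ k + \<bar>g \<omega>\<bar> ^ k))" using f g by simp
  show int: "integrable N (\<lambda>\<omega>. \<bar>f \<omega> + g \<omega>\<bar> ^ k)"
    by (rule Bochner_Integration.integrable_bound[OF dom])
      (use K in \<open>auto intro!: AE_I2 order_trans[OF _ abs_ge_self]\<close>)
  have "(\<integral>\<omega>. \<bar>f \<omega> + g \<omega>\<bar> ^ k \<partial>N) \<le> (\<integral>\<omega>. K * (\<bar>f \<omega>\<bar> ^ k + \<bar>g \<omega>\<bar> ^ k) \<partial>N)"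
    by (rule integral_mono[OF int dom K])
  also have "\<dots> \<le> K * (c + d)"
    using f g K0 by (simp add: mult_left_mono add_mono)
  finally show "(\<integral>\<omega>. \<bar>f \<omega> + g \<omega>\<bar> ^ k \<partial>N) \<le> K * (c + d)" .
qed

lemmas moment2_add = moment_le_add[OF _ _ power_add_le(1)]
lemmas moment3_add = moment_le_add[OF _ _ power_add_le(2)]

lemma moment2_product:
  assumes "moment_le 2 N f (a\<^sup>2)" "moment_le 2 N g (b\<^sup>2)" "0 \<le> a" "0 \<le> b"
  shows "integrable N (\<lambda>\<omega>. f \<omega> * g \<omega>)" "\<bar>\<integral>\<omega>. f \<omega> * g \<omega> \<partial>N\<bar> \<le> a * b"
proof -
  note [measurable] = moment_leD(1)[OF assms(1)] moment_leD(1)[OF assms(2)]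
  let ?x = "\<integral>\<^sup>+\<omega>. ennreal \<bar>f \<omega> * g \<omega>\<bar> \<partial>N"
  have "?x\<^sup>2 = (\<integral>\<^sup>+\<omega>. ennreal \<bar>f \<omega>\<bar> * ennreal \<bar>g \<omega>\<bar> \<partial>N)\<^sup>2"
    by (simp add: abs_mult ennreal_mult)
  also have "\<dots> \<le> (\<integral>\<^sup>+\<omega>. (ennreal \<bar>f \<omega>\<bar>)\<^sup>2 \<partial>N) * (\<integral>\<^sup>+\<omega>. (ennreal \<bar>g \<omega>\<bar>)\<^sup>2 \<partial>N)"
    by (rule Cauchy_Schwarz_nn_integral) measurable
  also have "\<dots> \<le> ennreal (a\<^sup>2) * ennreal (b\<^sup>2)"
    using assms(1,2) by (intro mult_mono) (simp_all add: moment_le_def ennreal_power)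
  also have "\<dots> = ennreal ((a * b)\<^sup>2)" by (simp add: power_mult_distrib ennreal_mult)
  finally have sq: "?x\<^sup>2 \<le> ennreal ((a * b)\<^sup>2)" .
  have x: "?x \<le> ennreal (a * b)"
  proof (cases ?x)
    case (real c)
    then have "c\<^sup>2 \<le> (a * b)\<^sup>2" using sq by (simp add: ennreal_power)
    then have "c \<le> a * b" by (rule power2_le_imp_le) (use assms(3,4) in simp)
    then show ?thesis using real by (simp add: ennreal_leI)
  next
    case top
    then show ?thesis using sq by (simp add: power2_eq_square ennreal_mult_top top_unique)
  qed
  then show int: "integrable N (\<lambda>\<omega>. f \<omega> * g \<omega>)"
    by (intro integrableI_bounded) (auto simp: order_le_less_trans)
  have "ennreal \<bar>\<integral>\<omega>. f \<omega> * g \<omega> \<partial>N\<bar> \<le> ?x" using integral_norm_bound_ennreal[OF int] by simp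
  also note x
  finally show "\<bar>\<integral>\<omega>. f \<omega> * g \<omega> \<partial>N\<bar> \<le> a * b" using assms(3,4) by simp
qed

lemma abs_product_le_cubes:
  fixes x y z :: real
  shows "\<bar>x * y * z\<bar> \<le> \<bar>x\<bar> ^ 3 + \<bar>y\<bar> ^ 3 + \<bar>z\<bar> ^ 3"
proof -
  define m where "m = max \<bar>x\<bar> (max \<bar>y\<bar> \<bar>z\<bar>)"
  have "\<bar>x * y * z\<bar> \<le> m * m * m"
    unfolding abs_mult by (intro mult_mono) (auto simp: m_def)
  also have "\<dots> = m ^ 3" by (simp add: power3_eq_cube)
  also have "\<dots> \<le> \<bar>x\<bar> ^ 3 + \<bar>y\<bar> ^ 3 + \<bar>z\<bar> ^ 3"
    by (auto simp: m_def max_def)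
  finally show ?thesis .
qed

text \<open>
  Products of three factors with small third moments are small. All error terms that involve the
  measure \<open>P\<close> are brought to this form, since only third moments are controlled under it.
\<close>

lemma moment3_product:
  assumes "moment_le 3 N f a" "moment_le 3 N g b" "moment_le 3 N h c"
  shows "integrable N (\<lambda>\<omega>. f \<omega> * g \<omega> * h \<omega>)" "(\<integral>\<omega>. \<bar>f \<omega> * g \<omega> * h \<omega>\<bar> \<partial>N) \<le> a + b + c"
proof -
  note D = moment_leD[OF assms(1)] moment_leD[OF assms(2)] moment_leD[OF assms(3)]
  note [measurable] = D(1,5,9)
  let ?d = "\<lambda>\<omega>. \<bar>f \<omega>\<bar> ^ 3 + \<bar>g \<omega>\<bar> ^ 3 + \<bar>h \<omega>\<bar> ^ 3"
  have dom: "integrable N ?d" using D by simp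
  show int: "integrable N (\<lambda>\<omega>. f \<omega> * g \<omega> * h \<omega>)"
    by (rule Bochner_Integration.integrable_bound[OF dom])
      (auto intro!: AE_I2 order_trans[OF abs_product_le_cubes])
  have "(\<integral>\<omega>. \<bar>f \<omega> * g \<omega> * h \<omega>\<bar> \<partial>N) \<le> (\<integral>\<omega>. ?d \<omega> \<partial>N)"
    by (rule integral_mono[OF _ dom abs_product_le_cubes]) (use int in simp)
  also have "\<dots> \<le> a + b + c" using D by simp
  finally show "(\<integral>\<omega>. \<bar>f \<omega> * g \<omega> * h \<omega>\<bar> \<partial>N) \<le> a + b + c" .
qed

lemma (in prob_space) moment3_lower_integrable:
  assumes "moment_le 3 M f c"
  shows "integrable M f" "integrable M (\<lambda>\<omega>. (f \<omega>)\<^sup>2)"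
proof -
  note D = moment_leD[OF assms]
  note [measurable] = D(1)
  have dom: "integrable M (\<lambda>\<omega>. 1 + \<bar>f \<omega>\<bar> ^ 3)" using D by simp
  have le: "\<bar>x\<bar> ^ k \<le> 1 + \<bar>x\<bar> ^ 3" if "k \<le> 3" for x :: real and k
  proof (cases "\<bar>x\<bar> \<le> 1")
    case True
    then have "\<bar>x\<bar> ^ k \<le> 1" by (intro power_le_one) auto
    then show ?thesis using zero_le_power[of "\<bar>x\<bar>" 3] by linarith
  next
    case False
    then have "\<bar>x\<bar> ^ k \<le> \<bar>x\<bar> ^ 3" using that by (intro power_increasing) auto
    then show ?thesis by linarith
  qed
  show "integrable M f"
  proof (rule Bochner_Integration.integrable_bound[OF dom])
    show "AE \<omega> in M. norm (f \<omega>) \<le> norm (1 + \<bar>f \<omega>\<bar> ^ 3)" using le[of 1] by simp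
  qed simp
  show "integrable M (\<lambda>\<omega>. (f \<omega>)\<^sup>2)"
  proof (rule Bochner_Integration.integrable_bound[OF dom])
    show "AE \<omega> in M. norm ((f \<omega>)\<^sup>2) \<le> norm (1 + \<bar>f \<omega>\<bar> ^ 3)" using le[of 2] by simp
  qed simp
qed


section \<open>Change of measure by a small log-likelihood ratio\<close>

text \<open>
  The factor \<open>1 + exp x\<close>, in place of \<open>exp \<bar>x\<bar>\<close>, turns into a sum of expectations under the two
  measures when \<open>x\<close> is a log-likelihood ratio.
\<close>

lemma exp_remainder_two_sided:
  fixes x :: real
  shows "\<bar>exp x - 1\<bar> \<le> \<bar>x\<bar> * (1 + exp x)" and "\<bar>exp x - 1 - x\<bar> \<le> x\<^sup>2 / 2 * (1 + exp x)"
proof -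
  have *: "\<exists>t. \<bar>t\<bar> \<le> \<bar>x\<bar> \<and> exp x = (\<Sum>m<n. x ^ m / fact m) + exp t / fact n * x ^ n" for n
    using Maclaurin_exp_le by blast
  obtain s where s: "\<bar>s\<bar> \<le> \<bar>x\<bar>" "exp x = 1 + exp s * x" using *[of 1] by auto
  obtain t where t: "\<bar>t\<bar> \<le> \<bar>x\<bar>" "exp x = 1 + x + exp t / 2 * x\<^sup>2"
    using *[of 2] by (auto simp: eval_nat_numeral)
  obtain u where u: "exp x = 1 + x + x\<^sup>2 / 2 + exp u / 6 * x ^ 3"
    using *[of 3] by (auto simp: eval_nat_numeral)
  show "\<bar>exp x - 1\<bar> \<le> \<bar>x\<bar> * (1 + exp x)"
  proof (cases "0 \<le> x")
    case True
    then have "exp s * x \<le> exp x * x" using s(1) by (intro mult_right_mono) auto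
    then show ?thesis using s(2) True by (simp add: algebra_simps)
  next
    case False
    have "1 - exp x \<le> - x" using exp_ge_add_one_self[of x] by linarith
    moreover have "x * exp x \<le> 0" using False by (intro mult_nonpos_nonneg) auto
    then have "- x \<le> - x * (1 + exp x)" by (simp add: algebra_simps)
    ultimately have "1 - exp x \<le> - x * (1 + exp x)" by linarith
    moreover have "\<bar>x\<bar> = - x" "\<bar>exp x - 1\<bar> = 1 - exp x" using False by simp_all
    ultimately show ?thesis by (simp only:)
  qed
  have low: "0 \<le> exp x - 1 - x" using exp_ge_add_one_self[of x] by linarith
  show "\<bar>exp x - 1 - x\<bar> \<le> x\<^sup>2 / 2 * (1 + exp x)"
  proof (cases "0 \<le> x")
    case True
    then have "exp t / 2 * x\<^sup>2 \<le> exp x / 2 * x\<^sup>2" using t(1) by (intro mult_right_mono) auto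
    moreover have "exp x - 1 - x = exp t / 2 * x\<^sup>2" using t(2) by linarith
    moreover have "x\<^sup>2 / 2 * (1 + exp x) = x\<^sup>2 / 2 + exp x / 2 * x\<^sup>2" by (simp add: algebra_simps)
    moreover have "0 \<le> x\<^sup>2 / 2" by simp
    ultimately show ?thesis using low by linarith
  next
    case False
    then have "exp u / 6 * x ^ 3 \<le> 0" by (intro mult_nonneg_nonpos) (auto simp: power_le_zero_eq)
    moreover have "exp x - 1 - x = x\<^sup>2 / 2 + exp u / 6 * x ^ 3" using u by linarith
    moreover have "x\<^sup>2 / 2 * (1 + exp x) = x\<^sup>2 / 2 + x\<^sup>2 / 2 * exp x" by (simp add: algebra_simps)
    moreover have "0 \<le> x\<^sup>2 / 2 * exp x" by simp
    ultimately show ?thesis using low by linarith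
  qed
qed

locale log_likelihood_tilt = prob_space P0 for P0 :: "'w measure" +
  fixes P :: "'w measure" and l :: "'w \<Rightarrow> real"
  assumes l_measurable [measurable]: "l \<in> borel_measurable P0"
    and P_eq: "P = density P0 (\<lambda>\<omega>. ennreal (exp (l \<omega>)))"
    and prob_P: "prob_space P"
begin

lemma integral_P:
  fixes f :: "'w \<Rightarrow> real"
  assumes [measurable]: "f \<in> borel_measurable P0"
  shows "(\<integral>\<omega>. f \<omega> \<partial>P) = (\<integral>\<omega>. exp (l \<omega>) * f \<omega> \<partial>P0)"
    "integrable P f \<longleftrightarrow> integrable P0 (\<lambda>\<omega>. exp (l \<omega>) * f \<omega>)"
  unfolding P_eq by (subst integral_density, simp_all) (subst integrable_density, simp_all)

text \<open>
  The errors come out in expectations under both measures because \<open>exp l\<close> need not have moments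
  of its own; it only ever appears as the density.
\<close>

lemma first_order_tilt:
  assumes [measurable]: "f \<in> borel_measurable P0"
    and f: "integrable P0 f" "integrable P f"
    and fl: "integrable P0 (\<lambda>\<omega>. f \<omega> * l \<omega>)" "integrable P (\<lambda>\<omega>. f \<omega> * l \<omega>)"
  shows "\<bar>(\<integral>\<omega>. f \<omega> \<partial>P) - (\<integral>\<omega>. f \<omega> \<partial>P0)\<bar> \<le> (\<integral>\<omega>. \<bar>f \<omega> * l \<omega>\<bar> \<partial>P0) + (\<integral>\<omega>. \<bar>f \<omega> * l \<omega>\<bar> \<partial>P)"
proof -
  have int: "integrable P0 (\<lambda>\<omega>. exp (l \<omega>) * f \<omega>)" "integrable P0 (\<lambda>\<omega>. exp (l \<omega>) * \<bar>f \<omega> * l \<omega>\<bar>)"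
    using f fl integral_P(2)[of f] integral_P(2)[of "\<lambda>\<omega>. \<bar>f \<omega> * l \<omega>\<bar>"] by auto
  have "(\<integral>\<omega>. f \<omega> \<partial>P) - (\<integral>\<omega>. f \<omega> \<partial>P0) = (\<integral>\<omega>. f \<omega> * (exp (l \<omega>) - 1) \<partial>P0)"
    using int f by (simp add: integral_P(1) algebra_simps)
  also have "\<bar>\<dots>\<bar> \<le> (\<integral>\<omega>. \<bar>f \<omega> * (exp (l \<omega>) - 1)\<bar> \<partial>P0)" by simp
  also have "\<dots> \<le> (\<integral>\<omega>. \<bar>f \<omega> * l \<omega>\<bar> + exp (l \<omega>) * \<bar>f \<omega> * l \<omega>\<bar> \<partial>P0)"
  proof (rule integral_mono)
    have "integrable P0 (\<lambda>\<omega>. exp (l \<omega>) * f \<omega> - f \<omega>)" using int f by simp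
    then show "integrable P0 (\<lambda>\<omega>. \<bar>f \<omega> * (exp (l \<omega>) - 1)\<bar>)" by (simp add: algebra_simps)
    show "\<bar>f \<omega> * (exp (l \<omega>) - 1)\<bar> \<le> \<bar>f \<omega> * l \<omega>\<bar> + exp (l \<omega>) * \<bar>f \<omega> * l \<omega>\<bar>" for \<omega>
    proof -
      have "\<bar>f \<omega>\<bar> * \<bar>exp (l \<omega>) - 1\<bar> \<le> \<bar>f \<omega>\<bar> * (\<bar>l \<omega>\<bar> * (1 + exp (l \<omega>)))"
        by (intro mult_left_mono exp_remainder_two_sided) simp
      also have "\<dots> = \<bar>f \<omega> * l \<omega>\<bar> + exp (l \<omega>) * \<bar>f \<omega> * l \<omega>\<bar>"
        by (simp add: abs_mult algebra_simps)
      finally show ?thesis unfolding abs_mult[of "f \<omega>" "exp (l \<omega>) - 1"] .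
    qed
  qed (use int fl in auto)
  also have "\<dots> = (\<integral>\<omega>. \<bar>f \<omega> * l \<omega>\<bar> \<partial>P0) + (\<integral>\<omega>. \<bar>f \<omega> * l \<omega>\<bar> \<partial>P)"
    using int fl by (simp add: integral_P(1))
  finally show ?thesis .
qed

lemma second_order_tilt:
  assumes [measurable]: "f \<in> borel_measurable P0"
    and f: "integrable P0 f" "integrable P f" and fl: "integrable P0 (\<lambda>\<omega>. f \<omega> * l \<omega>)"
    and fll: "integrable P0 (\<lambda>\<omega>. f \<omega> * l \<omega> * l \<omega>)" "integrable P (\<lambda>\<omega>. f \<omega> * l \<omega> * l \<omega>)"
  shows "\<bar>(\<integral>\<omega>. f \<omega> \<partial>P) - (\<integral>\<omega>. f \<omega> \<partial>P0) - (\<integral>\<omega>. f \<omega> * l \<omega> \<partial>P0)\<bar>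
    \<le> ((\<integral>\<omega>. \<bar>f \<omega> * l \<omega> * l \<omega>\<bar> \<partial>P0) + (\<integral>\<omega>. \<bar>f \<omega> * l \<omega> * l \<omega>\<bar> \<partial>P)) / 2"
proof -
  have int: "integrable P0 (\<lambda>\<omega>. exp (l \<omega>) * f \<omega>)" "integrable P0 (\<lambda>\<omega>. exp (l \<omega>) * \<bar>f \<omega> * l \<omega> * l \<omega>\<bar>)"
    using f fll integral_P(2)[of f] integral_P(2)[of "\<lambda>\<omega>. \<bar>f \<omega> * l \<omega> * l \<omega>\<bar>"] by auto
  have "(\<integral>\<omega>. f \<omega> \<partial>P) - (\<integral>\<omega>. f \<omega> \<partial>P0) - (\<integral>\<omega>. f \<omega> * l \<omega> \<partial>P0) = (\<integral>\<omega>. f \<omega> * (exp (l \<omega>) - 1 - l \<omega>) \<partial>P0)"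
    using int f fl by (simp add: integral_P(1) algebra_simps)
  also have "\<bar>\<dots>\<bar> \<le> (\<integral>\<omega>. \<bar>f \<omega> * (exp (l \<omega>) - 1 - l \<omega>)\<bar> \<partial>P0)" by simp
  also have "\<dots> \<le> (\<integral>\<omega>. (\<bar>f \<omega> * l \<omega> * l \<omega>\<bar> + exp (l \<omega>) * \<bar>f \<omega> * l \<omega> * l \<omega>\<bar>) / 2 \<partial>P0)"
  proof (rule integral_mono)
    have "integrable P0 (\<lambda>\<omega>. exp (l \<omega>) * f \<omega> - f \<omega> - f \<omega> * l \<omega>)" using int f fl by simp
    then show "integrable P0 (\<lambda>\<omega>. \<bar>f \<omega> * (exp (l \<omega>) - 1 - l \<omega>)\<bar>)" by (simp add: algebra_simps)
    show "\<bar>f \<omega> * (exp (l \<omega>) - 1 - l \<omega>)\<bar>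
        \<le> (\<bar>f \<omega> * l \<omega> * l \<omega>\<bar> + exp (l \<omega>) * \<bar>f \<omega> * l \<omega> * l \<omega>\<bar>) / 2" for \<omega>
    proof -
      have "\<bar>f \<omega>\<bar> * \<bar>exp (l \<omega>) - 1 - l \<omega>\<bar> \<le> \<bar>f \<omega>\<bar> * ((l \<omega>)\<^sup>2 / 2 * (1 + exp (l \<omega>)))"
        by (intro mult_left_mono exp_remainder_two_sided) simp
      also have "\<dots> = (\<bar>f \<omega> * l \<omega> * l \<omega>\<bar> + exp (l \<omega>) * \<bar>f \<omega> * l \<omega> * l \<omega>\<bar>) / 2"
        by (simp add: abs_mult power2_eq_square algebra_simps)
      finally show ?thesis unfolding abs_mult[of "f \<omega>" "exp (l \<omega>) - 1 - l \<omega>"] .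
    qed
  qed (use int fll in auto)
  also have "\<dots> = ((\<integral>\<omega>. \<bar>f \<omega> * l \<omega> * l \<omega>\<bar> \<partial>P0) + (\<integral>\<omega>. \<bar>f \<omega> * l \<omega> * l \<omega>\<bar> \<partial>P)) / 2"
    using int fll by (simp add: integral_P(1))
  finally show ?thesis .
qed

end

text \<open>
  The scalar form of a local component at one parameter value. Component and log-likelihood ratio
  split likewise into score parts \<open>a\<close>, \<open>p\<close> and remainders \<open>w\<close>, \<open>d\<close>: the former have second moments
  \<open>b\<^sup>2\<close> of order one (times the squared feature radius), the latter small second moments \<open>\<kappa>\<^sup>2\<close>.
\<close>

locale local_moments = log_likelihood_tilt P0 P "\<lambda>\<omega>. p \<omega> + d \<omega>" for P0 P :: "'w measure" and p d +
  fixes q \<kappa> b :: real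
  assumes cube_p: "moment_le 3 P0 p q" "moment_le 3 P p q"
    and cube_d: "moment_le 3 P0 d q" "moment_le 3 P d q"
    and square_p: "moment_le 2 P0 p (b\<^sup>2)" and square_d: "moment_le 2 P0 d (\<kappa>\<^sup>2)"
    and nonneg: "0 \<le> \<kappa>" "0 \<le> b" "0 \<le> q"
begin

definition admissible :: "('w \<Rightarrow> real) \<Rightarrow> ('w \<Rightarrow> real) \<Rightarrow> bool" where
  "admissible a w \<longleftrightarrow>
     moment_le 3 P0 a q \<and> moment_le 3 P a q \<and> moment_le 3 P0 w q \<and> moment_le 3 P w q \<and>
     moment_le 2 P0 a (b\<^sup>2) \<and> moment_le 2 P0 w (\<kappa>\<^sup>2) \<and> (\<integral>\<omega>. a \<omega> \<partial>P0) = 0"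

lemma cube_l: "moment_le 3 P0 (\<lambda>\<omega>. p \<omega> + d \<omega>) (8 * q)" "moment_le 3 P (\<lambda>\<omega>. p \<omega> + d \<omega>) (8 * q)"
  using moment3_add[OF cube_p(1) cube_d(1)] moment3_add[OF cube_p(2) cube_d(2)] by simp_all

lemma cube_sum:
  assumes "admissible a w"
  shows "moment_le 3 P0 (\<lambda>\<omega>. a \<omega> + w \<omega>) (8 * q)" "moment_le 3 P (\<lambda>\<omega>. a \<omega> + w \<omega>) (8 * q)"
  using assms moment3_add[of P0 a q w q] moment3_add[of P a q w q] by (simp_all add: admissible_def)

lemma const_moment: "moment_le 3 P0 (\<lambda>_. c) (\<bar>c\<bar> ^ 3)" "moment_le 3 P (\<lambda>_. c) (\<bar>c\<bar> ^ 3)"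
  using prob_P by (auto simp: moment_le_def emeasure_space_1 prob_space.emeasure_space_1)

text \<open>
  The term of first order in \<open>p + d\<close> contributes the product of the score parts; every other product
  of two factors contains \<open>w\<close> or \<open>d\<close>, which are small in mean square under \<open>P0\<close>.
\<close>

lemma mean_expansion:
  assumes aw: "admissible a w"
  shows "\<bar>(\<integral>\<omega>. a \<omega> + w \<omega> \<partial>P) - (\<integral>\<omega>. p \<omega> * a \<omega> \<partial>P0) - (\<integral>\<omega>. w \<omega> \<partial>P0)\<bar>
    \<le> 24 * q + 2 * b * \<kappa> + \<kappa>\<^sup>2"
proof -
  interpret P: prob_space P by (rule prob_P)
  let ?X = "\<lambda>\<omega>. a \<omega> + w \<omega>" and ?l = "\<lambda>\<omega>. p \<omega> + d \<omega>"
  have sq: "moment_le 2 P0 a (b\<^sup>2)" "moment_le 2 P0 w (\<kappa>\<^sup>2)" and a0: "(\<integral>\<omega>. a \<omega> \<partial>P0) = 0"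
    and cu: "moment_le 3 P0 a q" "moment_le 3 P0 w q"
    using aw by (auto simp: admissible_def)
  note X = cube_sum[OF aw]
  note ap = moment2_product[OF sq(1) square_p nonneg(2,2)]
  note ad = moment2_product[OF sq(1) square_d nonneg(2,1)]
  note wp = moment2_product[OF sq(2) square_p nonneg(1,2)]
  note wd = moment2_product[OF sq(2) square_d nonneg(1,1)]
  have Xl: "(\<lambda>\<omega>. ?X \<omega> * ?l \<omega>) = (\<lambda>\<omega>. p \<omega> * a \<omega> + a \<omega> * d \<omega> + w \<omega> * p \<omega> + w \<omega> * d \<omega>)"
    by (auto simp: algebra_simps)
  have pa: "integrable P0 (\<lambda>\<omega>. p \<omega> * a \<omega>)" using ap(1) by (simp add: mult.commute)
  have int_Xl: "integrable P0 (\<lambda>\<omega>. ?X \<omega> * ?l \<omega>)"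
    unfolding Xl using pa ad wp wd by simp
  have eq_Xl: "(\<integral>\<omega>. ?X \<omega> * ?l \<omega> \<partial>P0)
      = (\<integral>\<omega>. p \<omega> * a \<omega> \<partial>P0) + (\<integral>\<omega>. a \<omega> * d \<omega> \<partial>P0) + (\<integral>\<omega>. w \<omega> * p \<omega> \<partial>P0) + (\<integral>\<omega>. w \<omega> * d \<omega> \<partial>P0)"
    unfolding Xl using pa ad wp wd by simp
  note ints = moment3_lower_integrable(1)[OF cu(1)] moment3_lower_integrable(1)[OF cu(2)]
  note XllP0 = moment3_product[OF X(1) cube_l(1) cube_l(1)]
  note XllP = moment3_product[OF X(2) cube_l(2) cube_l(2)]
  have "\<bar>(\<integral>\<omega>. ?X \<omega> \<partial>P) - (\<integral>\<omega>. ?X \<omega> \<partial>P0) - (\<integral>\<omega>. ?X \<omega> * ?l \<omega> \<partial>P0)\<bar>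
    \<le> ((\<integral>\<omega>. \<bar>?X \<omega> * ?l \<omega> * ?l \<omega>\<bar> \<partial>P0) + (\<integral>\<omega>. \<bar>?X \<omega> * ?l \<omega> * ?l \<omega>\<bar> \<partial>P)) / 2"
    by (rule second_order_tilt[OF moment_leD(1)[OF X(1)] moment3_lower_integrable(1)[OF X(1)]
          P.moment3_lower_integrable(1)[OF X(2)] int_Xl XllP0(1) XllP(1)])
  also have "\<dots> \<le> 24 * q" using XllP0(2) XllP(2) by simp
  finally have "\<bar>(\<integral>\<omega>. ?X \<omega> \<partial>P) - (\<integral>\<omega>. ?X \<omega> \<partial>P0) - (\<integral>\<omega>. ?X \<omega> * ?l \<omega> \<partial>P0)\<bar> \<le> 24 * q" .
  moreover have "(\<integral>\<omega>. ?X \<omega> \<partial>P0) = (\<integral>\<omega>. w \<omega> \<partial>P0)" using ints a0 by simp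
  moreover have "\<bar>\<integral>\<omega>. w \<omega> * p \<omega> \<partial>P0\<bar> \<le> b * \<kappa>" using wp(2) by (simp add: mult.commute)
  ultimately show ?thesis
    unfolding eq_Xl using ad(2) wd(2) by (simp only: power2_eq_square mult.assoc)
qed

text \<open>
  The mean is essentially a product of two score moments, whose square is not bounded by the
  error terms when the scores are large. But multiplying the expansion of the mean by the mean itself yields
  a product of three factors, and a mean larger than one has a square below its cube.
\<close>

lemma mean_square_le:
  assumes aw: "admissible a w"
  shows "(\<integral>\<omega>. a \<omega> + w \<omega> \<partial>P)\<^sup>2 \<le> 68 * q + 4 * b * \<kappa> + 3 * \<kappa>\<^sup>2"
proof -
  interpret P: prob_space P by (rule prob_P)
  define m where "m = (\<integral>\<omega>. a \<omega> + w \<omega> \<partial>P)"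
  define \<tau> where "\<tau> = 24 * q + 2 * b * \<kappa> + \<kappa>\<^sup>2"
  let ?e = "\<integral>\<omega>. p \<omega> * a \<omega> \<partial>P0" and ?w = "\<integral>\<omega>. w \<omega> \<partial>P0"
  have sq: "moment_le 2 P0 w (\<kappa>\<^sup>2)" and cu: "moment_le 3 P0 a q" "moment_le 3 P0 w q"
    using aw by (auto simp: admissible_def)
  have \<tau>: "\<bar>m - ?e - ?w\<bar> \<le> \<tau>" unfolding m_def \<tau>_def by (rule mean_expansion[OF aw])
  have m3: "\<bar>m\<bar> ^ 3 \<le> 8 * q"
  proof -
    note X = cube_sum(2)[OF aw]
    note X3 = moment_leD[OF X]
    have "\<bar>m\<bar> \<le> (\<integral>\<omega>. \<bar>a \<omega> + w \<omega>\<bar> \<partial>P)" unfolding m_def by simp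
    then have "\<bar>m\<bar> ^ 3 \<le> (\<integral>\<omega>. \<bar>a \<omega> + w \<omega>\<bar> \<partial>P) ^ 3" by (intro power_mono) auto
    also have "\<dots> \<le> (\<integral>\<omega>. \<bar>a \<omega> + w \<omega>\<bar> ^ 3 \<partial>P)"
      by (rule P.cube_moment_inequalities(1)) (use P.moment3_lower_integrable[OF X] X3 in auto)
    also have "\<dots> \<le> 8 * q" by (rule X3(4))
    finally show ?thesis .
  qed
  have mc: "moment_le 3 P0 (\<lambda>_. m) (8 * q)"
    by (rule moment_le_mono[OF const_moment(1) m3])
  have "\<bar>m * ?e\<bar> = \<bar>\<integral>\<omega>. m * p \<omega> * a \<omega> \<partial>P0\<bar>" by (simp add: mult.assoc)
  also have "\<dots> \<le> (\<integral>\<omega>. \<bar>m * p \<omega> * a \<omega>\<bar> \<partial>P0)" by (rule integral_abs_bound)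
  also have "\<dots> \<le> 8 * q + q + q" by (rule moment3_product(2)[OF mc cube_p(1) cu(1)])
  finally have me: "\<bar>m * ?e\<bar> \<le> 10 * q" by simp
  have w: "\<bar>?w\<bar> \<le> \<kappa>"
    using moment2_product(2)[of P0 w \<kappa> "\<lambda>_. 1" 1] sq nonneg
    by (simp add: moment_le_def emeasure_space_1)
  have 0: "0 \<le> b * \<kappa>" "0 \<le> \<kappa>\<^sup>2" using nonneg by auto
  show ?thesis
  proof (cases "\<bar>m\<bar> \<le> 1")
    case True
    have "m\<^sup>2 = m * ?e + m * ?w + m * (m - ?e - ?w)" by (simp add: power2_eq_square algebra_simps)
    also have "\<dots> \<le> 10 * q + (m\<^sup>2 / 2 + \<kappa>\<^sup>2 / 2) + \<tau>"
    proof (intro add_mono)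
      show "m * ?e \<le> 10 * q" using me by simp
      have "m * ?w \<le> \<bar>m\<bar> * \<bar>?w\<bar>" by (metis abs_ge_self abs_mult)
      also have "\<dots> \<le> \<bar>m\<bar> * \<kappa>" by (intro mult_left_mono w) simp
      also have "\<dots> \<le> m\<^sup>2 / 2 + \<kappa>\<^sup>2 / 2" using sum_squares_bound[of "\<bar>m\<bar>" \<kappa>] by simp
      finally show "m * ?w \<le> m\<^sup>2 / 2 + \<kappa>\<^sup>2 / 2" .
      have "m * (m - ?e - ?w) \<le> \<bar>m\<bar> * \<bar>m - ?e - ?w\<bar>" by (metis abs_ge_self abs_mult)
      also have "\<dots> \<le> 1 * \<tau>" by (intro mult_mono True \<tau>) auto
      finally show "m * (m - ?e - ?w) \<le> \<tau>" by simp
    qed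
    finally show ?thesis unfolding m_def[symmetric] \<tau>_def by (simp add: algebra_simps)
  next
    case False
    then have "\<bar>m\<bar>\<^sup>2 \<le> \<bar>m\<bar> ^ 3" by (intro power_increasing) auto
    then have "m\<^sup>2 \<le> 8 * q" using m3 by simp
    then show ?thesis unfolding m_def[symmetric] mult.assoc using 0 nonneg by linarith
  qed
qed

lemma covariance_expansion:
  assumes aw: "admissible a w" and aw': "admissible a' w'"
  shows "\<bar>(\<integral>\<omega>. (a \<omega> + w \<omega>) * (a' \<omega> + w' \<omega>) \<partial>P) - (\<integral>\<omega>. a \<omega> + w \<omega> \<partial>P) * (\<integral>\<omega>. a' \<omega> + w' \<omega> \<partial>P)
      - (\<integral>\<omega>. a \<omega> * a' \<omega> \<partial>P0)\<bar> \<le> 116 * q + 6 * b * \<kappa> + 4 * \<kappa>\<^sup>2"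
proof -
  interpret P: prob_space P by (rule prob_P)
  let ?X = "\<lambda>\<omega>. a \<omega> + w \<omega>" and ?X' = "\<lambda>\<omega>. a' \<omega> + w' \<omega>" and ?l = "\<lambda>\<omega>. p \<omega> + d \<omega>"
  let ?Y = "\<lambda>\<omega>. ?X \<omega> * ?X' \<omega>"
  have sq: "moment_le 2 P0 a (b\<^sup>2)" "moment_le 2 P0 w (\<kappa>\<^sup>2)"
    "moment_le 2 P0 a' (b\<^sup>2)" "moment_le 2 P0 w' (\<kappa>\<^sup>2)"
    using aw aw' by (auto simp: admissible_def)
  note X = cube_sum[OF aw] and X' = cube_sum[OF aw']
  note aa = moment2_product(1)[OF sq(1,3) nonneg(2,2)]
  note aw1 = moment2_product[OF sq(1,4) nonneg(2,1)]
  note wa1 = moment2_product[OF sq(2,3) nonneg(1,2)]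
  note ww1 = moment2_product[OF sq(2,4) nonneg(1,1)]
  have Y: "?Y = (\<lambda>\<omega>. a \<omega> * a' \<omega> + a \<omega> * w' \<omega> + w \<omega> * a' \<omega> + w \<omega> * w' \<omega>)"
    by (auto simp: algebra_simps)
  have intY: "integrable P0 ?Y" unfolding Y using aa aw1 wa1 ww1 by simp
  have eqY: "(\<integral>\<omega>. ?Y \<omega> \<partial>P0) = (\<integral>\<omega>. a \<omega> * a' \<omega> \<partial>P0) + (\<integral>\<omega>. a \<omega> * w' \<omega> \<partial>P0)
      + (\<integral>\<omega>. w \<omega> * a' \<omega> \<partial>P0) + (\<integral>\<omega>. w \<omega> * w' \<omega> \<partial>P0)"
    unfolding Y using aa aw1 wa1 ww1 by simp
  have YP: "integrable P ?Y"
  proof -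
    have "integrable P (\<lambda>\<omega>. ?X \<omega> * ?X' \<omega> * 1)"
      by (rule moment3_product(1)[OF X(2) X'(2) const_moment(2)])
    then show ?thesis by simp
  qed
  note YlP0 = moment3_product[OF X(1) X'(1) cube_l(1)]
  note YlP = moment3_product[OF X(2) X'(2) cube_l(2)]
  have measY: "?Y \<in> borel_measurable P0" using intY by simp
  have "\<bar>(\<integral>\<omega>. ?Y \<omega> \<partial>P) - (\<integral>\<omega>. ?Y \<omega> \<partial>P0)\<bar> \<le> (\<integral>\<omega>. \<bar>?Y \<omega> * ?l \<omega>\<bar> \<partial>P0) + (\<integral>\<omega>. \<bar>?Y \<omega> * ?l \<omega>\<bar> \<partial>P)"
    by (rule first_order_tilt[OF measY intY YP YlP0(1) YlP(1)])
  also have "\<dots> \<le> 48 * q" using YlP0(2) YlP(2) by simp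
  finally have 1: "\<bar>(\<integral>\<omega>. ?Y \<omega> \<partial>P) - (\<integral>\<omega>. ?Y \<omega> \<partial>P0)\<bar> \<le> 48 * q" .
  have 2: "\<bar>(\<integral>\<omega>. ?X \<omega> \<partial>P) * (\<integral>\<omega>. ?X' \<omega> \<partial>P)\<bar> \<le> 68 * q + 4 * b * \<kappa> + 3 * \<kappa>\<^sup>2"
    using sum_squares_bound[of "\<bar>\<integral>\<omega>. ?X \<omega> \<partial>P\<bar>" "\<bar>\<integral>\<omega>. ?X' \<omega> \<partial>P\<bar>"]
      mean_square_le[OF aw] mean_square_le[OF aw'] by (simp add: abs_mult)
  have 3: "\<bar>\<integral>\<omega>. w \<omega> * a' \<omega> \<partial>P0\<bar> \<le> b * \<kappa>" using wa1(2) by (simp add: mult.commute)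
  show ?thesis
    using 1 2 3 aw1(2) ww1(2) unfolding eqY
    by (simp only: power2_eq_square mult.assoc)
qed

end


section \<open>Exchanging one component\<close>

lemma tame_field_shift:
  assumes g: "tame_field \<tau> A g" and [measurable]: "b \<in> borel_measurable \<tau>" and b: "bounded_on_space \<tau> b"
  shows "tame_field \<tau> A (\<lambda>a t. b t + g a t)"
    and "prob_space \<nu> \<Longrightarrow> sets \<nu> = sets \<tau> \<Longrightarrow>
      (\<integral>a. log_partition \<nu> (\<lambda>t. b t + g a t) \<partial>A)
        = log_partition \<nu> b + (\<integral>a. log_partition (gibbs \<nu> b) (g a) \<partial>A)"
proof -
  interpret A: prob_space A using g by (simp add: tame_field_def)
  obtain B where B: "\<And>t. t \<in> space \<tau> \<Longrightarrow> \<bar>b t\<bar> \<le> B" using b by (auto simp: bounded_on_space_def)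
  obtain c where c: "\<And>\<nu>. prob_space \<nu> \<Longrightarrow> sets \<nu> = sets \<tau> \<Longrightarrow>
      (\<integral>\<^sup>+a. ennreal \<bar>log_partition \<nu> (g a)\<bar> \<partial>A) \<le> ennreal c"
    using g unfolding tame_field_def by blast
  have [measurable]: "case_prod g \<in> borel_measurable (A \<Otimes>\<^sub>M \<tau>)" using g by (simp add: tame_field_def)
  have meas: "case_prod (\<lambda>a t. b t + g a t) \<in> borel_measurable (A \<Otimes>\<^sub>M \<tau>)"
    unfolding split_beta' by measurable
  have base: "b \<in> borel_measurable \<nu>" "bounded_on_space \<nu> b" "\<And>t. t \<in> space \<nu> \<Longrightarrow> \<bar>b t\<bar> \<le> B"
    "sets (gibbs \<nu> b) = sets \<tau>" if "sets \<nu> = sets \<tau>" for \<nu>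
    using that b B sets_eq_imp_space_eq[OF that]
    by (auto simp: bounded_on_space_def cong: measurable_cong_sets)
  have split: "log_partition \<nu> (\<lambda>t. b t + g a t) = log_partition \<nu> b + log_partition (gibbs \<nu> b) (g a)"
    if "a \<in> space A" "prob_space \<nu>" "sets \<nu> = sets \<tau>" for a \<nu>
    by (intro prob_space.log_partition_add that base tame_field_section[OF g])
  have gb: "prob_space (gibbs \<nu> b)" if "prob_space \<nu>" "sets \<nu> = sets \<tau>" for \<nu>
    by (intro prob_space.prob_space_gibbs that base)
  show "(\<integral>a. log_partition \<nu> (\<lambda>t. b t + g a t) \<partial>A)
      = log_partition \<nu> b + (\<integral>a. log_partition (gibbs \<nu> b) (g a) \<partial>A)"
    if \<nu>: "prob_space \<nu>" "sets \<nu> = sets \<tau>" for \<nu>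
  proof -
    have int: "integrable A (\<lambda>a. log_partition (gibbs \<nu> b) (g a))"
      by (rule tame_field_integrable[OF g gb[OF \<nu>] base(4)[OF \<nu>(2)]])
    have "(\<integral>a. log_partition \<nu> (\<lambda>t. b t + g a t) \<partial>A)
        = (\<integral>a. log_partition \<nu> b + log_partition (gibbs \<nu> b) (g a) \<partial>A)"
      by (intro Bochner_Integration.integral_cong refl split \<nu>)
    also have "\<dots> = log_partition \<nu> b + (\<integral>a. log_partition (gibbs \<nu> b) (g a) \<partial>A)"
      using int by (simp add: A.prob_space)
    finally show ?thesis .
  qed
  have "(\<integral>\<^sup>+a. ennreal \<bar>log_partition \<nu> (\<lambda>t. b t + g a t)\<bar> \<partial>A) \<le> ennreal (\<bar>B\<bar> + \<bar>c\<bar>)"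
    if \<nu>: "prob_space \<nu>" "sets \<nu> = sets \<tau>" for \<nu>
  proof -
    note [measurable] = measurable_log_partition[OF \<open>case_prod g \<in> borel_measurable (A \<Otimes>\<^sub>M \<tau>)\<close> gb[OF \<nu>] base(4)[OF \<nu>(2)]]
    have "\<bar>log_partition \<nu> b\<bar> \<le> \<bar>B\<bar>"
      using prob_space.abs_log_partition_le[OF \<nu>(1) base(1)[OF \<nu>(2)], of B] base(3)[OF \<nu>(2)] by fastforce
    then have "(\<integral>\<^sup>+a. ennreal \<bar>log_partition \<nu> (\<lambda>t. b t + g a t)\<bar> \<partial>A)
        \<le> (\<integral>\<^sup>+a. ennreal \<bar>B\<bar> + ennreal \<bar>log_partition (gibbs \<nu> b) (g a)\<bar> \<partial>A)"
      by (intro nn_integral_mono)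
        (auto simp: split \<nu> simp flip: ennreal_plus intro!: ennreal_leI)
    also have "\<dots> = ennreal \<bar>B\<bar> + (\<integral>\<^sup>+a. ennreal \<bar>log_partition (gibbs \<nu> b) (g a)\<bar> \<partial>A)"
      by (subst nn_integral_add) (auto simp: A.emeasure_space_1)
    also have "\<dots> \<le> ennreal \<bar>B\<bar> + ennreal \<bar>c\<bar>"
      using c[OF gb[OF \<nu>] base(4)[OF \<nu>(2)]]
      by (intro add_left_mono) (meson abs_ge_self ennreal_leI order_trans)
    finally show ?thesis by simp
  qed
  moreover have "bounded_on_space \<tau> (\<lambda>t. b t + g a t)" if "a \<in> space A" for a
    using that g by (intro bounded_on_space_add b) (auto simp: tame_field_def)
  ultimately show "tame_field \<tau> A (\<lambda>a t. b t + g a t)"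
    using meas A.prob_space_axioms unfolding tame_field_def by blast
qed

text \<open>
  A common mean is absorbed into the base measure, so only centred fields have to be compared. The
  mean itself may be large (of the order of the squared feature radius); expanding in it would leave
  quadratic terms that the moment bounds do not control.
\<close>

lemma component_exchange_cost:
  assumes g: "centred_field A \<tau> g v" "tame_field \<tau> A g" and h: "centred_field B \<tau> h w" "tame_field \<tau> B h"
    and eg: "\<And>\<nu>. prob_space \<nu> \<Longrightarrow> sets \<nu> = sets \<tau> \<Longrightarrow>
      \<bar>(\<integral>a. log_partition \<nu> (g a) \<partial>A) - half_variance \<nu> (centred_field.covariance A g)\<bar> \<le> \<epsilon>"
    and eh: "\<And>\<nu>. prob_space \<nu> \<Longrightarrow> sets \<nu> = sets \<tau> \<Longrightarrow>
      \<bar>(\<integral>a. log_partition \<nu> (h a) \<partial>B) - half_variance \<nu> (centred_field.covariance B h)\<bar> \<le> \<epsilon>'"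
    and close: "\<And>s t. s \<in> space \<tau> \<Longrightarrow> t \<in> space \<tau> \<Longrightarrow>
      \<bar>centred_field.covariance A g s t - centred_field.covariance B h s t\<bar> \<le> \<kappa>"
    and b: "b \<in> borel_measurable \<tau>" "bounded_on_space \<tau> b"
    and \<nu>: "prob_space \<nu>" "sets \<nu> = sets \<tau>"
  shows "\<bar>(\<integral>a. log_partition \<nu> (\<lambda>t. b t + g a t) \<partial>A) - (\<integral>a. log_partition \<nu> (\<lambda>t. b t + h a t) \<partial>B)\<bar>
    \<le> \<epsilon> + \<epsilon>' + \<kappa>"
proof -
  have \<mu>: "prob_space (gibbs \<nu> b)" "sets (gibbs \<nu> b) = sets \<tau>"
  proof -
    have "b \<in> borel_measurable \<nu>" using b(1) \<nu>(2) by (simp cong: measurable_cong_sets)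
    moreover have "bounded_on_space \<nu> b"
      using b(2) by (simp add: bounded_on_space_def sets_eq_imp_space_eq[OF \<nu>(2)])
    ultimately show "prob_space (gibbs \<nu> b)" by (rule prob_space.prob_space_gibbs[OF \<nu>(1)])
    show "sets (gibbs \<nu> b) = sets \<tau>" using \<nu>(2) by simp
  qed
  show ?thesis
    unfolding tame_field_shift(2)[OF g(2) b \<nu>] tame_field_shift(2)[OF h(2) b \<nu>]
    using eg[OF \<mu>] eh[OF \<mu>] half_variance_close[OF g(1) h(1) \<mu> close] by linarith
qed


section \<open>Gaussian processes\<close>

lemma nn_integral_normal_exp:
  assumes "0 < \<sigma>"
  shows "(\<integral>\<^sup>+x. ennreal (normal_density \<mu> \<sigma> x) * ennreal (exp (c * (x - \<mu>))) \<partial>lborel)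
    = ennreal (exp (c\<^sup>2 * \<sigma>\<^sup>2 / 2))"
proof -
  \<comment> \<open>Completing the square turns the exponential into a shift of the mean.\<close>
  have "normal_density \<mu> \<sigma> x * exp (c * (x - \<mu>)) = exp (c\<^sup>2 * \<sigma>\<^sup>2 / 2) * normal_density (\<mu> + c * \<sigma>\<^sup>2) \<sigma> x" for x
  proof -
    have "- (x - \<mu>)\<^sup>2 / (2 * \<sigma>\<^sup>2) + c * (x - \<mu>)
        = c\<^sup>2 * \<sigma>\<^sup>2 / 2 + - (x - (\<mu> + c * \<sigma>\<^sup>2))\<^sup>2 / (2 * \<sigma>\<^sup>2)"
      using assms by (simp add: field_simps power2_eq_square)
    then show ?thesis
      by (simp add: normal_density_def exp_add[symmetric] algebra_simps)
  qed
  then have "ennreal (normal_density \<mu> \<sigma> x) * ennreal (exp (c * (x - \<mu>)))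
      = ennreal (exp (c\<^sup>2 * \<sigma>\<^sup>2 / 2)) * ennreal (normal_density (\<mu> + c * \<sigma>\<^sup>2) \<sigma> x)" for x
    by (simp flip: ennreal_mult)
  then have "(\<integral>\<^sup>+x. ennreal (normal_density \<mu> \<sigma> x) * ennreal (exp (c * (x - \<mu>))) \<partial>lborel)
      = ennreal (exp (c\<^sup>2 * \<sigma>\<^sup>2 / 2)) * (\<integral>\<^sup>+x. ennreal (normal_density (\<mu> + c * \<sigma>\<^sup>2) \<sigma> x) \<partial>lborel)"
    by (simp add: nn_integral_cmult)
  also have "(\<integral>\<^sup>+x. ennreal (normal_density (\<mu> + c * \<sigma>\<^sup>2) \<sigma> x) \<partial>lborel) = 1"
    using assms by (subst nn_integral_eq_integral) auto
  finally show ?thesis by simp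
qed

lemma (in prob_space) gaussian_rv_moments:
  assumes Z: "gaussian_rv M Z" and var: "variance Z \<le> x\<^sup>2"
  shows "integrable M Z" "(\<integral>\<^sup>+\<omega>. ennreal ((Z \<omega> - expectation Z)\<^sup>2) \<partial>M) \<le> ennreal (x\<^sup>2)"
    "(\<integral>\<^sup>+\<omega>. ennreal (exp (c * (Z \<omega> - expectation Z))) \<partial>M) \<le> ennreal (exp (c\<^sup>2 * x\<^sup>2 / 2))"
proof -
  have [measurable]: "Z \<in> borel_measurable M" using Z by (simp add: gaussian_rv_def)
  have "integrable M Z \<and> (\<integral>\<^sup>+\<omega>. ennreal ((Z \<omega> - expectation Z)\<^sup>2) \<partial>M) \<le> ennreal (x\<^sup>2) \<and>
    (\<integral>\<^sup>+\<omega>. ennreal (exp (c * (Z \<omega> - expectation Z))) \<partial>M) \<le> ennreal (exp (c\<^sup>2 * x\<^sup>2 / 2))"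
  proof -
    obtain \<mu> where "(AE \<omega> in M. Z \<omega> = \<mu>) \<or>
        (\<exists>\<sigma>>0. distributed M lborel Z (\<lambda>x. ennreal (normal_density \<mu> \<sigma> x)))"
      using Z by (auto simp: gaussian_rv_def)
    then show ?thesis
    proof
      assume ae: "AE \<omega> in M. Z \<omega> = \<mu>"
      have E: "expectation Z = \<mu>"
        using integral_cong_AE[OF _ _ ae] by (simp add: prob_space)
      have "integrable M Z"
        using integrable_cong_AE[of Z M "\<lambda>_. \<mu>"] ae by simp
      moreover have "(\<integral>\<^sup>+\<omega>. ennreal ((Z \<omega> - expectation Z)\<^sup>2) \<partial>M) = (\<integral>\<^sup>+\<omega>. 0 \<partial>M)"
        by (rule nn_integral_cong_AE) (use ae in \<open>auto simp: E\<close>)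
      moreover have "(\<integral>\<^sup>+\<omega>. ennreal (exp (c * (Z \<omega> - expectation Z))) \<partial>M) = (\<integral>\<^sup>+\<omega>. 1 \<partial>M)"
        by (rule nn_integral_cong_AE) (use ae in \<open>auto simp: E\<close>)
      moreover have "(1::ennreal) \<le> ennreal (exp (c\<^sup>2 * x\<^sup>2 / 2))"
        by (subst ennreal_1[symmetric], rule ennreal_leI) simp
      ultimately show ?thesis by (simp add: emeasure_space_1)
    next
      assume "\<exists>\<sigma>>0. distributed M lborel Z (\<lambda>x. ennreal (normal_density \<mu> \<sigma> x))"
      then obtain \<sigma> where \<sigma>: "0 < \<sigma>" and D: "distributed M lborel Z (\<lambda>x. ennreal (normal_density \<mu> \<sigma> x))"
        by blast
      have E: "expectation Z = \<mu>" by (rule normal_distributed_expectation[OF \<sigma> D])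
      have V: "\<sigma>\<^sup>2 \<le> x\<^sup>2" using var normal_distributed_variance[OF \<sigma> D] by simp
      have "integrable M Z"
        using distributed_integrable[OF D, of "\<lambda>x. x"] integrable_normal_moment_nz_1[OF \<sigma>, of \<mu>] by simp
      moreover have "(\<integral>\<^sup>+\<omega>. ennreal ((Z \<omega> - expectation Z)\<^sup>2) \<partial>M) \<le> ennreal (x\<^sup>2)"
      proof -
        have int: "integrable M (\<lambda>\<omega>. (Z \<omega> - \<mu>)\<^sup>2)"
          using distributed_integrable[OF D, of "\<lambda>x. (x - \<mu>)\<^sup>2"] integrable_normal_moment[OF \<sigma>, of \<mu> 2] by simp
        show ?thesis unfolding E using int var
          by (subst nn_integral_eq_integral) (auto simp: E intro!: ennreal_leI)
      qed
      moreover have "(\<integral>\<^sup>+\<omega>. ennreal (exp (c * (Z \<omega> - \<mu>))) \<partial>M) \<le> ennreal (exp (c\<^sup>2 * x\<^sup>2 / 2))"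
      proof -
        have "(\<integral>\<^sup>+\<omega>. ennreal (exp (c * (Z \<omega> - \<mu>))) \<partial>M) = ennreal (exp (c\<^sup>2 * \<sigma>\<^sup>2 / 2))"
          using distributed_nn_integral[OF D, of "\<lambda>x. ennreal (exp (c * (x - \<mu>)))"]
            nn_integral_normal_exp[OF \<sigma>, of \<mu> c] by simp
        also have "\<dots> \<le> ennreal (exp (c\<^sup>2 * x\<^sup>2 / 2))"
          using V by (intro ennreal_leI) (simp add: mult_left_mono)
        finally show ?thesis .
      qed
      ultimately show ?thesis by (simp add: E)
    qed
  qed
  then show "integrable M Z" "(\<integral>\<^sup>+\<omega>. ennreal ((Z \<omega> - expectation Z)\<^sup>2) \<partial>M) \<le> ennreal (x\<^sup>2)"
    "(\<integral>\<^sup>+\<omega>. ennreal (exp (c * (Z \<omega> - expectation Z))) \<partial>M) \<le> ennreal (exp (c\<^sup>2 * x\<^sup>2 / 2))" by auto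
qed

lemma gaussian_process_at:
  assumes "gaussian_process Q T Y" "t \<in> T"
  shows "gaussian_rv Q (Y t)"
  using assms(1)[unfolded gaussian_process_def, rule_format, of "{t}" "\<lambda>_. 1"] assms(2) by simp

text \<open>
  Independent processes live on one probability space; equipping it with the sigma-algebra of a
  single process gives the factors of a product space. Their points are still points of the original
  space, so that path continuity is not lost, as it would be on the space of all real functions.
\<close>

context compact_metrizable_base
begin

definition path_algebra :: "'y measure \<Rightarrow> ('p \<Rightarrow> 'y \<Rightarrow> real) \<Rightarrow> 'y measure" where
  "path_algebra Q Y = vimage_algebra (space Q) (\<lambda>\<omega>. \<lambda>t\<in>T. Y t \<omega>) (PiM T (\<lambda>_. borel))"

definition path_space :: "'y measure \<Rightarrow> ('p \<Rightarrow> 'y \<Rightarrow> real) \<Rightarrow> 'y measure" where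
  "path_space Q Y = distr Q (path_algebra Q Y) (\<lambda>\<omega>. \<omega>)"

lemma space_path_space: "space (path_space Q Y) = space Q"
  by (simp add: path_space_def path_algebra_def)

lemma path_map_measurable:
  assumes "\<And>t. t \<in> T \<Longrightarrow> Y t \<in> borel_measurable Q"
  shows "(\<lambda>\<omega>. \<lambda>t\<in>T. Y t \<omega>) \<in> measurable Q (PiM T (\<lambda>_. borel))"
  using assms by (rule measurable_restrict)

lemma id_path_algebra:
  assumes "\<And>t. t \<in> T \<Longrightarrow> Y t \<in> borel_measurable Q"
  shows "(\<lambda>\<omega>. \<omega>) \<in> measurable Q (path_algebra Q Y)"
  unfolding path_algebra_def
  by (rule measurable_vimage_algebra2) (use path_map_measurable[OF assms] in auto)

lemma process_measurable_path_space:
  assumes "t \<in> T"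
  shows "Y t \<in> borel_measurable (path_space Q Y)"
proof -
  have "(\<lambda>\<omega>. \<lambda>t\<in>T. Y t \<omega>) \<in> measurable (path_algebra Q Y) (PiM T (\<lambda>_. borel))"
    unfolding path_algebra_def by (rule measurable_vimage_algebra1) (auto simp: space_PiM)
  from measurable_compose[OF this measurable_component_singleton[OF assms]]
  show ?thesis using assms by (simp add: path_space_def)
qed

lemma path_space_integral:
  fixes f :: "'y \<Rightarrow> real"
  assumes "\<And>t. t \<in> T \<Longrightarrow> Y t \<in> borel_measurable Q" "f \<in> borel_measurable (path_space Q Y)"
  shows "(\<integral>\<omega>. f \<omega> \<partial>path_space Q Y) = (\<integral>\<omega>. f \<omega> \<partial>Q)"
  using assms unfolding path_space_def by (subst integral_distr[OF id_path_algebra]) auto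

lemma path_space_nn_integral:
  fixes f :: "'y \<Rightarrow> ennreal"
  assumes "\<And>t. t \<in> T \<Longrightarrow> Y t \<in> borel_measurable Q" "f \<in> borel_measurable (path_space Q Y)"
  shows "(\<integral>\<^sup>+\<omega>. f \<omega> \<partial>path_space Q Y) = (\<integral>\<^sup>+\<omega>. f \<omega> \<partial>Q)"
  using assms unfolding path_space_def by (subst nn_integral_distr[OF id_path_algebra]) auto

lemma independent_paths:
  assumes Q: "prob_space Q" and I: "I \<noteq> {}"
    and meas: "\<And>m t. m \<in> I \<Longrightarrow> t \<in> T \<Longrightarrow> Y m t \<in> borel_measurable Q"
    and indep: "prob_space.indep_vars Q (\<lambda>_. PiM T (\<lambda>_. borel)) (\<lambda>m \<omega>. \<lambda>t\<in>T. Y m t \<omega>) I"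
  shows "PiM I (\<lambda>m. path_space Q (Y m)) = distr Q (PiM I (\<lambda>m. path_algebra Q (Y m))) (\<lambda>\<omega>. \<lambda>m\<in>I. \<omega>)"
    and "(\<lambda>\<omega>. \<lambda>m\<in>I. \<omega>) \<in> measurable Q (PiM I (\<lambda>m. path_algebra Q (Y m)))"
proof -
  interpret prob_space Q by fact
  have id: "(\<lambda>\<omega>. \<omega>) \<in> measurable Q (path_algebra Q (Y m))" if "m \<in> I" for m
    by (rule id_path_algebra) (use meas that in auto)
  have "indep_vars (\<lambda>m. path_algebra Q (Y m)) (\<lambda>m \<omega>. \<omega>) I"
    unfolding indep_vars_def2
  proof (intro conjI ballI id)
    have "{(\<lambda>\<omega>. \<omega>) -` A \<inter> space Q |A. A \<in> sets (path_algebra Q (Y m))}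
        = {(\<lambda>\<omega>. \<lambda>t\<in>T. Y m t \<omega>) -` A \<inter> space Q |A. A \<in> sets (PiM T (\<lambda>_. borel))}" for m
      unfolding path_algebra_def by (subst sets_vimage_algebra2) (auto simp: space_PiM)
    then show "indep_sets (\<lambda>m. {(\<lambda>\<omega>. \<omega>) -` A \<inter> space Q |A. A \<in> sets (path_algebra Q (Y m))}) I"
      using indep unfolding indep_vars_def2 by simp
  qed
  then show "PiM I (\<lambda>m. path_space Q (Y m)) = distr Q (PiM I (\<lambda>m. path_algebra Q (Y m))) (\<lambda>\<omega>. \<lambda>m\<in>I. \<omega>)"
    using indep_vars_iff_distr_eq_PiM'[OF I, where M'="\<lambda>m. path_algebra Q (Y m)" and X="\<lambda>m \<omega>. \<omega>"] id
    by (simp add: path_space_def)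
  show "(\<lambda>\<omega>. \<lambda>m\<in>I. \<omega>) \<in> measurable Q (PiM I (\<lambda>m. path_algebra Q (Y m)))"
    using id by (rule measurable_restrict)
qed

lemma independent_sum_integral:
  assumes "prob_space Q" "I \<noteq> {}"
    and "\<And>m t. m \<in> I \<Longrightarrow> t \<in> T \<Longrightarrow> Y m t \<in> borel_measurable Q"
    and "prob_space.indep_vars Q (\<lambda>_. PiM T (\<lambda>_. borel)) (\<lambda>m \<omega>. \<lambda>t\<in>T. Y m t \<omega>) I"
    and "finite I" and tame: "\<And>m. m \<in> I \<Longrightarrow> tame_field \<tau> (path_space Q (Y m)) (\<lambda>\<omega> t. Y m t \<omega>)"
    and \<nu>: "prob_space \<nu>" "sets \<nu> = sets \<tau>"
  shows "(\<integral>x. log_partition \<nu> (sum_field I (\<lambda>m \<omega> t. Y m t \<omega>) x) \<partial>PiM I (\<lambda>m. path_space Q (Y m)))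
    = (\<integral>\<omega>. log_partition \<nu> (\<lambda>t. \<Sum>m\<in>I. Y m t \<omega>) \<partial>Q)"
proof -
  have "tame_field \<tau> (PiM I (\<lambda>m. path_space Q (Y m))) (sum_field I (\<lambda>m \<omega> t. Y m t \<omega>))"
    by (rule tame_field_sum[OF assms(5) tame])
  then have "(\<lambda>x. log_partition \<nu> (sum_field I (\<lambda>m \<omega> t. Y m t \<omega>) x))
      \<in> borel_measurable (PiM I (\<lambda>m. path_space Q (Y m)))"
    using \<nu> by (intro measurable_log_partition) (auto simp: tame_field_def)
  then have meas: "(\<lambda>x. log_partition \<nu> (sum_field I (\<lambda>m \<omega> t. Y m t \<omega>) x))
      \<in> borel_measurable (PiM I (\<lambda>m. path_algebra Q (Y m)))"
    by (simp add: independent_paths(1)[where Y=Y, OF assms(1-4)])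
  have "(\<integral>x. log_partition \<nu> (sum_field I (\<lambda>m \<omega> t. Y m t \<omega>) x) \<partial>PiM I (\<lambda>m. path_space Q (Y m)))
      = (\<integral>\<omega>. log_partition \<nu> (sum_field I (\<lambda>m \<omega> t. Y m t \<omega>) (\<lambda>m\<in>I. \<omega>)) \<partial>Q)"
    using integral_distr[OF independent_paths(2)[where Y=Y, OF assms(1-4)] meas]
    by (simp only: independent_paths(1)[where Y=Y, OF assms(1-4)])
  then show ?thesis by (simp add: sum_field_def[abs_def])
qed

lemma mean_measurable:
  assumes N: "prob_space N" and f: "case_prod f \<in> borel_measurable (N \<Otimes>\<^sub>M \<tau>)"
  shows "(\<lambda>t. \<integral>\<omega>. f \<omega> t \<partial>N :: real) \<in> borel_measurable \<tau>"
proof -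
  interpret prob_space N by fact
  have "(\<lambda>(t, \<omega>). f \<omega> t) \<in> borel_measurable (\<tau> \<Otimes>\<^sub>M N)"
    using measurable_pair_swap[OF f] by (simp add: split_beta')
  then show ?thesis by measurable
qed

lemma gaussian_centred_field:
  assumes Q: "prob_space Q" and gauss: "gaussian_process Q T Y"
    and cont: "\<And>\<omega>. \<omega> \<in> space Q \<Longrightarrow> continuous_on T (\<lambda>t. Y t \<omega>)"
    and var: "\<And>t. t \<in> T \<Longrightarrow> (\<integral>\<omega>. (Y t \<omega> - (\<integral>\<omega>. Y t \<omega> \<partial>Q))\<^sup>2 \<partial>Q) \<le> x\<^sup>2"
    and x: "0 < x"
    and mean: "bounded_on_space \<tau> (\<lambda>t. \<integral>\<omega>. Y t \<omega> \<partial>Q)"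
  shows "subgaussian_field (path_space Q Y) \<tau> (\<lambda>\<omega> t. Y t \<omega> - (\<integral>\<omega>. Y t \<omega> \<partial>Q)) x"
    and "(\<lambda>t. \<integral>\<omega>. Y t \<omega> \<partial>Q) \<in> borel_measurable \<tau>"
    and "\<And>s t. s \<in> T \<Longrightarrow> t \<in> T \<Longrightarrow>
      centred_field.covariance (path_space Q Y) (\<lambda>\<omega> t. Y t \<omega> - (\<integral>\<omega>. Y t \<omega> \<partial>Q)) s t
        = (\<integral>\<omega>. (Y s \<omega> - (\<integral>\<omega>. Y s \<omega> \<partial>Q)) * (Y t \<omega> - (\<integral>\<omega>. Y t \<omega> \<partial>Q)) \<partial>Q)"
proof -
  interpret Q: prob_space Q by fact
  let ?b = "\<lambda>t. \<integral>\<omega>. Y t \<omega> \<partial>Q"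
  have rv: "gaussian_rv Q (Y t)" if "t \<in> T" for t by (rule gaussian_process_at[OF gauss that])
  then have measQ: "\<And>t. t \<in> T \<Longrightarrow> Y t \<in> borel_measurable Q" by (simp add: gaussian_rv_def)
  note measP = process_measurable_path_space[where Y=Y and Q=Q]
  have PS: "prob_space (path_space Q Y)"
    unfolding path_space_def by (rule Q.prob_space_distr[OF id_path_algebra[where Y=Y, OF measQ]])
  have joint: "case_prod (\<lambda>\<omega> t. Y t \<omega>) \<in> borel_measurable (path_space Q Y \<Otimes>\<^sub>M \<tau>)"
    by (rule caratheodory_measurable[OF measP]) (use cont in \<open>auto simp: space_path_space\<close>)
  have "(\<lambda>t. \<integral>\<omega>. Y t \<omega> \<partial>path_space Q Y) \<in> borel_measurable \<tau>"
    by (rule mean_measurable[OF PS joint])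
  then show b [measurable]: "?b \<in> borel_measurable \<tau>"
  proof (rule measurable_cong[THEN iffD1, rotated])
    show "(\<integral>\<omega>. Y t \<omega> \<partial>path_space Q Y) = ?b t" if "t \<in> space \<tau>" for t
      by (rule path_space_integral[where Y=Y, OF measQ measP]) (use that in \<open>simp_all add: space_\<tau>\<close>)
  qed
  note mom = Q.gaussian_rv_moments[OF rv var]
  have centred: "centred_field (path_space Q Y) \<tau> (\<lambda>\<omega> t. Y t \<omega> - ?b t) (x\<^sup>2)"
  proof (intro centred_field.intro centred_field_axioms.intro PS)
    show "case_prod (\<lambda>\<omega> t. Y t \<omega> - ?b t) \<in> borel_measurable (path_space Q Y \<Otimes>\<^sub>M \<tau>)"
      using joint unfolding split_beta' by measurable
    show "bounded_on_space \<tau> (\<lambda>t. Y t \<omega> - ?b t)" if "\<omega> \<in> space (path_space Q Y)" for \<omega>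
    proof -
      have "bounded_on_space \<tau> (\<lambda>t. Y t \<omega>)"
        using continuous_bounded_on_T[OF cont] that
        by (simp add: bounded_on_space_def space_\<tau> space_path_space)
      moreover have "bounded_on_space \<tau> (\<lambda>t. - ?b t)" using mean by (simp add: bounded_on_space_def)
      ultimately show ?thesis using bounded_on_space_add[of \<tau> "\<lambda>t. Y t \<omega>" "\<lambda>t. - ?b t"] by simp
    qed
    fix t assume "t \<in> space \<tau>"
    then have t: "t \<in> T" by (simp add: space_\<tau>)
    note [measurable] = measP[OF t]
    have "(\<integral>\<omega>. Y t \<omega> - ?b t \<partial>path_space Q Y) = (\<integral>\<omega>. Y t \<omega> - ?b t \<partial>Q)"
      by (rule path_space_integral[where Y=Y, OF measQ]) simp_all
    then show "(\<integral>\<omega>. Y t \<omega> - ?b t \<partial>path_space Q Y) = 0"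
      using mom(1)[OF t t] by (simp add: Q.prob_space)
    have "(\<integral>\<^sup>+\<omega>. ennreal ((Y t \<omega> - ?b t)\<^sup>2) \<partial>path_space Q Y) = (\<integral>\<^sup>+\<omega>. ennreal ((Y t \<omega> - ?b t)\<^sup>2) \<partial>Q)"
      by (rule path_space_nn_integral[where Y=Y, OF measQ]) simp_all
    then show "(\<integral>\<^sup>+\<omega>. ennreal ((Y t \<omega> - ?b t)\<^sup>2) \<partial>path_space Q Y) \<le> ennreal (x\<^sup>2)"
      using mom(2)[OF t t] by simp
  qed simp
  show "subgaussian_field (path_space Q Y) \<tau> (\<lambda>\<omega> t. Y t \<omega> - ?b t) x"
  proof (intro subgaussian_field.intro subgaussian_field_axioms.intro centred x)
    fix t c assume "t \<in> space \<tau>"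
    then have t: "t \<in> T" by (simp add: space_\<tau>)
    note [measurable] = measP[OF t]
    have "(\<integral>\<^sup>+\<omega>. ennreal (exp (c * (Y t \<omega> - ?b t))) \<partial>path_space Q Y)
        = (\<integral>\<^sup>+\<omega>. ennreal (exp (c * (Y t \<omega> - ?b t))) \<partial>Q)"
      by (rule path_space_nn_integral[where Y=Y, OF measQ]) simp_all
    then show "(\<integral>\<^sup>+\<omega>. ennreal (exp (c * (Y t \<omega> - ?b t))) \<partial>path_space Q Y) \<le> ennreal (exp (c\<^sup>2 * x\<^sup>2 / 2))"
      using mom(3)[OF t t] by simp
  qed
  show "centred_field.covariance (path_space Q Y) (\<lambda>\<omega> t. Y t \<omega> - ?b t) s t
      = (\<integral>\<omega>. (Y s \<omega> - ?b s) * (Y t \<omega> - ?b t) \<partial>Q)" if "s \<in> T" "t \<in> T" for s t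
  proof -
    note [measurable] = measP[OF that(1)] measP[OF that(2)]
    show ?thesis
      unfolding centred_field.covariance_def[OF centred]
      by (rule path_space_integral[where Y=Y, OF measQ]) simp_all
  qed
qed

end


section \<open>Moments from the local error terms\<close>

lemma ennreal_mult_le_imp_le_divide:
  assumes "0 < r" "0 \<le> D" "ennreal r * X \<le> ennreal D"
  shows "X \<le> ennreal (D / r)"
proof (cases X)
  case (real x)
  then have "ennreal (r * x) \<le> ennreal D" using assms by (simp add: ennreal_mult)
  then have "r * x \<le> D" using assms(2) by (simp add: ennreal_le_iff)
  then show ?thesis using real assms(1) by (auto intro!: ennreal_leI simp: field_simps)
next
  case top
  then show ?thesis using assms by (simp add: ennreal_mult_top top_unique)
qed

lemma ennreal_sqrt_le_imp:
  assumes "ennreal_sqrt X \<le> ennreal c" "0 \<le> c"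
  shows "X \<le> ennreal (c\<^sup>2)"
proof (cases X)
  case (real x)
  then have "sqrt x \<le> c" using assms by (simp add: ennreal_sqrt_def)
  then have "x \<le> c\<^sup>2" using real by (simp add: sqrt_le_D)
  then show ?thesis using real by (simp add: ennreal_leI)
next
  case top
  then show ?thesis using assms by (simp add: ennreal_sqrt_def top_unique)
qed

lemma moment_le_scale:
  assumes [measurable]: "f \<in> borel_measurable N" and "0 \<le> a" "0 \<le> c"
    and le: "(\<integral>\<^sup>+\<omega>. ennreal (\<bar>f \<omega>\<bar> ^ k) \<partial>N) \<le> ennreal c"
  shows "moment_le k N (\<lambda>\<omega>. a * f \<omega>) (a ^ k * c)"
proof -
  have "(\<integral>\<^sup>+\<omega>. ennreal (\<bar>a * f \<omega>\<bar> ^ k) \<partial>N) = (\<integral>\<^sup>+\<omega>. ennreal (a ^ k) * ennreal (\<bar>f \<omega>\<bar> ^ k) \<partial>N)"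
    using assms(2) by (simp add: abs_mult power_mult_distrib ennreal_mult)
  also have "\<dots> = ennreal (a ^ k) * (\<integral>\<^sup>+\<omega>. ennreal (\<bar>f \<omega>\<bar> ^ k) \<partial>N)" by (rule nn_integral_cmult) simp
  also have "\<dots> \<le> ennreal (a ^ k) * ennreal c" by (intro mult_left_mono le) simp
  finally show ?thesis using assms(2,3) by (simp add: moment_le_def ennreal_mult)
qed

lemma ennreal_sum_le_parts:
  fixes a b c x :: ennreal
  shows "a + b \<le> x \<Longrightarrow> a \<le> x" "a + b \<le> x \<Longrightarrow> b \<le> x"
  by (erule order_trans[rotated], simp add: add_increasing2 add_increasing)+

lemma score_error_moments:
  fixes U :: "'w \<Rightarrow> 'h::{real_normed_vector, second_countable_topology}"
  assumes e: "score_error r P0 P U \<le> ennreal D" and r: "0 < r" "0 \<le> D"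
    and U: "U \<in> borel_measurable P0" "U \<in> borel_measurable P"
  shows "moment_le 3 P0 (\<lambda>\<omega>. r * norm (U \<omega>)) (r\<^sup>2 * D)" "moment_le 3 P (\<lambda>\<omega>. r * norm (U \<omega>)) (r\<^sup>2 * D)"
proof -
  note [measurable] = U
  have "(\<integral>\<^sup>+\<omega>. ennreal (norm (U \<omega>) ^ 3) \<partial>P0) + (\<integral>\<^sup>+\<omega>. ennreal (norm (U \<omega>) ^ 3) \<partial>P) \<le> ennreal (D / r)"
    by (rule ennreal_mult_le_imp_le_divide[OF r]) (use e in \<open>simp add: score_error_def\<close>)
  then have le: "(\<integral>\<^sup>+\<omega>. ennreal (\<bar>norm (U \<omega>)\<bar> ^ 3) \<partial>P0) \<le> ennreal (D / r)"
    "(\<integral>\<^sup>+\<omega>. ennreal (\<bar>norm (U \<omega>)\<bar> ^ 3) \<partial>P) \<le> ennreal (D / r)"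
    by (auto dest: ennreal_sum_le_parts)
  have eq: "r ^ 3 * (D / r) = r\<^sup>2 * D" using r by (simp add: power2_eq_square power3_eq_cube)
  show "moment_le 3 P0 (\<lambda>\<omega>. r * norm (U \<omega>)) (r\<^sup>2 * D)" "moment_le 3 P (\<lambda>\<omega>. r * norm (U \<omega>)) (r\<^sup>2 * D)"
    unfolding eq[symmetric] by (intro moment_le_scale le; use r in simp)+
qed

lemma curvature_error_moments:
  assumes e: "curvature_error r P0 P H V \<le> ennreal D" and r: "0 < r" "0 \<le> D"
    and v: "v \<in> borel_measurable P0" "v \<in> borel_measurable P" "\<And>\<omega>. 0 \<le> v \<omega>"
    and op: "\<And>\<omega>. \<omega> \<in> space P0 \<Longrightarrow> op_norm_on H (V \<omega>) = ennreal (v \<omega>)" and sp: "space P = space P0"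
  shows "moment_le 2 P0 (\<lambda>\<omega>. r\<^sup>2 * v \<omega>) (r\<^sup>2 * D\<^sup>2)"
    "moment_le 3 P0 (\<lambda>\<omega>. r\<^sup>2 * v \<omega>) (r\<^sup>2 * D)" "moment_le 3 P (\<lambda>\<omega>. r\<^sup>2 * v \<omega>) (r\<^sup>2 * D)"
proof -
  have pow: "(\<integral>\<^sup>+\<omega>. op_norm_on H (V \<omega>) ^ k \<partial>N) = (\<integral>\<^sup>+\<omega>. ennreal (\<bar>v \<omega>\<bar> ^ k) \<partial>N)"
    if "space N = space P0" for k N
    by (rule nn_integral_cong) (use that v(3) in \<open>simp add: op ennreal_power\<close>)
  note e' = e[unfolded curvature_error_def pow[OF refl] pow[OF sp]]
  have "ennreal r * ennreal_sqrt (\<integral>\<^sup>+\<omega>. ennreal (\<bar>v \<omega>\<bar> ^ 2) \<partial>P0) \<le> ennreal D"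
    by (rule ennreal_sum_le_parts(1)[OF e'])
  then have "ennreal_sqrt (\<integral>\<^sup>+\<omega>. ennreal (\<bar>v \<omega>\<bar> ^ 2) \<partial>P0) \<le> ennreal (D / r)"
    by (rule ennreal_mult_le_imp_le_divide[OF r])
  then have sq: "(\<integral>\<^sup>+\<omega>. ennreal (\<bar>v \<omega>\<bar> ^ 2) \<partial>P0) \<le> ennreal ((D / r)\<^sup>2)"
    by (rule ennreal_sqrt_le_imp) (use r in simp)
  have "(\<integral>\<^sup>+\<omega>. ennreal (\<bar>v \<omega>\<bar> ^ 3) \<partial>P0) + (\<integral>\<^sup>+\<omega>. ennreal (\<bar>v \<omega>\<bar> ^ 3) \<partial>P) \<le> ennreal (D / r ^ 4)"
    by (rule ennreal_mult_le_imp_le_divide) (use r ennreal_sum_le_parts(2)[OF e'] in simp_all)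
  then have cu: "(\<integral>\<^sup>+\<omega>. ennreal (\<bar>v \<omega>\<bar> ^ 3) \<partial>P0) \<le> ennreal (D / r ^ 4)"
    "(\<integral>\<^sup>+\<omega>. ennreal (\<bar>v \<omega>\<bar> ^ 3) \<partial>P) \<le> ennreal (D / r ^ 4)"
    by (auto dest: ennreal_sum_le_parts)
  have eq2: "(r\<^sup>2) ^ 2 * (D / r)\<^sup>2 = r\<^sup>2 * D\<^sup>2" and eq3: "(r\<^sup>2) ^ 3 * (D / r ^ 4) = r\<^sup>2 * D"
    using r by (simp_all add: field_simps eval_nat_numeral)
  show "moment_le 2 P0 (\<lambda>\<omega>. r\<^sup>2 * v \<omega>) (r\<^sup>2 * D\<^sup>2)"
    unfolding eq2[symmetric] by (rule moment_le_scale[OF v(1) _ _ sq]) (use r in auto)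
  show "moment_le 3 P0 (\<lambda>\<omega>. r\<^sup>2 * v \<omega>) (r\<^sup>2 * D)" "moment_le 3 P (\<lambda>\<omega>. r\<^sup>2 * v \<omega>) (r\<^sup>2 * D)"
    unfolding eq3[symmetric]
    by (rule moment_le_scale[OF v(1) _ _ cu(1)] moment_le_scale[OF v(2) _ _ cu(2)]; use r in simp)+
qed

lemma inverse_square_mult_le:
  assumes "ennreal (1 / r\<^sup>2) * X \<le> ennreal D" "0 < r" "0 \<le> D"
  shows "X \<le> ennreal (r\<^sup>2 * D)"
  using ennreal_mult_le_imp_le_divide[of "1 / r\<^sup>2" D X] assms by (simp add: mult.commute)

lemma inverse_sqrt_mult_le:
  assumes "ennreal (1 / r) * ennreal_sqrt X \<le> ennreal D" "0 < r" "0 \<le> D"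
  shows "X \<le> ennreal (r\<^sup>2 * D\<^sup>2)"
proof -
  have "ennreal_sqrt X \<le> ennreal (r * D)"
    using ennreal_mult_le_imp_le_divide[of "1 / r" D] assms by (simp add: mult.commute)
  from ennreal_sqrt_le_imp[OF this] show ?thesis using assms by (simp add: power_mult_distrib)
qed

lemma density_error_moments:
  assumes e: "density_error r P0 P d \<le> ennreal D" and r: "0 < r" "0 \<le> D"
    and d: "d \<in> borel_measurable P0" "d \<in> borel_measurable P"
  shows "moment_le 2 P0 d (r\<^sup>2 * D\<^sup>2)" "moment_le 3 P0 d (r\<^sup>2 * D)" "moment_le 3 P d (r\<^sup>2 * D)"
proof -
  note e' = e[unfolded density_error_def]
  have "(\<integral>\<^sup>+\<omega>. ennreal (\<bar>d \<omega>\<bar> ^ 3) \<partial>P0) + (\<integral>\<^sup>+\<omega>. ennreal (\<bar>d \<omega>\<bar> ^ 3) \<partial>P) \<le> ennreal (r\<^sup>2 * D)"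
    by (rule inverse_square_mult_le[OF ennreal_sum_le_parts(2)[OF e'] r])
  moreover have "(\<integral>\<^sup>+\<omega>. ennreal (\<bar>d \<omega>\<bar> ^ 2) \<partial>P0) \<le> ennreal (r\<^sup>2 * D\<^sup>2)"
    by (rule inverse_sqrt_mult_le[OF ennreal_sum_le_parts(1)[OF e'] r])
  ultimately show "moment_le 2 P0 d (r\<^sup>2 * D\<^sup>2)" "moment_le 3 P0 d (r\<^sup>2 * D)" "moment_le 3 P d (r\<^sup>2 * D)"
    using d r by (auto simp: moment_le_def dest: ennreal_sum_le_parts)
qed

lemma remainder_error_moments:
  assumes e: "remainder_error r P0 P T R \<le> ennreal D" and r: "0 < r" "0 \<le> D"
    and R: "\<And>t. t \<in> T \<Longrightarrow> R t \<in> borel_measurable P0"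
  shows "t \<in> T \<Longrightarrow> \<bar>\<integral>\<omega>. R t \<omega> \<partial>P0\<bar> \<le> r\<^sup>2 * D"
    "t \<in> T \<Longrightarrow> moment_le 2 P0 (R t) (r\<^sup>2 * D\<^sup>2)" "t \<in> T \<Longrightarrow> moment_le 3 P0 (R t) (r\<^sup>2 * D)"
    "(\<integral>\<^sup>+\<omega>. (SUP t\<in>T. ennreal (\<bar>R t \<omega>\<bar> ^ 3)) \<partial>P) \<le> ennreal (r\<^sup>2 * D)"
proof -
  note e' = e[unfolded remainder_error_def]
  show "(\<integral>\<^sup>+\<omega>. (SUP t\<in>T. ennreal (\<bar>R t \<omega>\<bar> ^ 3)) \<partial>P) \<le> ennreal (r\<^sup>2 * D)"
    by (rule inverse_square_mult_le[OF ennreal_sum_le_parts(2)[OF e'] r])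
  assume t: "t \<in> T"
  have "ennreal (1 / r ^ 2) * ennreal \<bar>\<integral>\<omega>. R t \<omega> \<partial>P0\<bar> +
      ennreal (1 / r) * ennreal_sqrt (\<integral>\<^sup>+\<omega>. ennreal (\<bar>R t \<omega>\<bar> ^ 2) \<partial>P0) +
      ennreal (1 / r ^ 2) * (\<integral>\<^sup>+\<omega>. ennreal (\<bar>R t \<omega>\<bar> ^ 3) \<partial>P0) \<le> ennreal D"
    by (rule order_trans[OF _ ennreal_sum_le_parts(1)[OF e']]) (rule SUP_upper[OF t])
  note * = ennreal_sum_le_parts(1)[OF this] ennreal_sum_le_parts(2)[OF this]
  have "ennreal \<bar>\<integral>\<omega>. R t \<omega> \<partial>P0\<bar> \<le> ennreal (r\<^sup>2 * D)"
    by (rule inverse_square_mult_le[OF ennreal_sum_le_parts(1)[OF *(1)] r])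
  then show "\<bar>\<integral>\<omega>. R t \<omega> \<partial>P0\<bar> \<le> r\<^sup>2 * D" using r by simp
  show "moment_le 2 P0 (R t) (r\<^sup>2 * D\<^sup>2)"
    using inverse_sqrt_mult_le[OF ennreal_sum_le_parts(2)[OF *(1)] r] R[OF t] by (simp add: moment_le_def)
  show "moment_le 3 P0 (R t) (r\<^sup>2 * D)"
    using inverse_square_mult_le[OF *(2) r] R[OF t] r by (simp add: moment_le_def)
qed


section \<open>A local component\<close>

text \<open>
  One component at one true parameter value, with \<open>D\<close> for the total of the local errors and \<open>L\<close> for
  the second moments. The target for every error below is \<open>r\<^sup>2 * (D * (1 + D))\<close>: the powers of the
  feature radius \<open>r\<close> in the error terms are such that all of them carry the common factor \<open>r\<^sup>2\<close>,
  and the sum over the components then brings in \<open>M * r\<^sup>2\<close>, which is at most of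
  the order of \<open>n\<close>.
\<close>

locale bounded_local_component = local_likelihood_model +
  fixes \<theta> and m :: nat and D L :: real
  assumes theta: "\<theta> \<in> \<Theta>" and m: "m \<in> {1..M}" and D_pos: "0 < D" and L_nonneg: "0 \<le> L"
    and U_mean: "(\<integral>\<omega>. U m \<omega> \<partial>P0 m) = 0"
    and second_bound: "second_moments (P0 m) (U m) (S m) \<le> ennreal L"
    and error_bound: "score_error (feature_radius \<Theta> M \<eta>) (P0 m) (P \<theta> m) (U m)
      + score_error (feature_radius \<Theta> M \<eta>) (P0 m) (P \<theta> m) (S m)
      + curvature_error (feature_radius \<Theta> M \<eta>) (P0 m) (P \<theta> m) (H m) (V m)
      + remainder_error (feature_radius \<Theta> M \<eta>) (P0 m) (P \<theta> m) T (R m)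
      + density_error (feature_radius \<Theta> M \<eta>) (P0 m) (P \<theta> m) (\<Delta> m \<theta>) \<le> ennreal D"
begin

sublocale base: compact_metrizable_base T \<pi>
  by unfold_locales (fact compact_T metrizable_T sets_prior)+

abbreviation r :: real where "r \<equiv> feature_radius \<Theta> M \<eta>"

abbreviation X where "X t \<omega> \<equiv> local_component U V R \<eta> m t \<omega>"

lemma D_nonneg: "0 \<le> D" using D_pos by simp

lemma feature_norm:
  assumes "u \<in> \<Theta>"
  shows "norm (\<eta> m u) \<le> r"
proof -
  have "compact ((\<lambda>u. norm (\<eta> m u)) ` \<Theta>)"
    by (intro compact_continuous_image continuous_on_norm feature_cont m compact_Theta)
  then have "bdd_above ((\<lambda>u. norm (\<eta> m u)) ` \<Theta>)"
    by (intro bounded_imp_bdd_above compact_imp_bounded)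
  then have "norm (\<eta> m u) \<le> (SUP u\<in>\<Theta>. norm (\<eta> m u))" by (rule cSUP_upper[OF assms])
  also have "\<dots> \<le> r" unfolding feature_radius_def by (rule Max_ge) (use m in auto)
  finally show ?thesis .
qed

lemma feature_H: "u \<in> \<Theta> \<Longrightarrow> \<eta> m u \<in> H m"
  using feature_in[OF m] by auto

lemma T_Theta: "t \<in> T \<Longrightarrow> t \<in> \<Theta>"
  using T_subset by auto

lemma sets_P: "sets (P \<theta> m) = sets (P0 m)"
  using P_density[OF theta m] by simp

lemma space_P: "space (P \<theta> m) = space (P0 m)"
  by (rule sets_eq_imp_space_eq[OF sets_P])

lemma measurable_P: "f \<in> borel_measurable (P0 m) \<Longrightarrow> f \<in> borel_measurable (P \<theta> m)"
  by (simp add: measurable_cong_sets[OF sets_P refl])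

lemma prob_at_P0: "prob_space (P0 m)" and prob_at_P: "prob_space (P \<theta> m)"
  by (rule prob_P0[OF m], rule prob_P[OF theta m])

definition v where
  "v \<omega> = (if \<omega> \<in> space (P0 m) then enn2real (op_norm_on (H m) (V m \<omega>)) else 0)"

lemma v_nonneg: "0 \<le> v \<omega>" by (simp add: v_def)

lemma v_measurable: "v \<in> borel_measurable (P0 m)"
proof -
  have "(\<lambda>\<omega>. op_norm_on (H m) (V m \<omega>)) \<in> borel_measurable (P0 m)"
    by (rule op_norm_on_measurable) (use V_bounded V_measurable subspace_H m in auto)
  then have "(\<lambda>\<omega>. enn2real (op_norm_on (H m) (V m \<omega>))) \<in> borel_measurable (P0 m)" by measurable
  then show ?thesis by (rule measurable_cong[THEN iffD1, rotated]) (simp add: v_def)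
qed

lemma op_norm_eq_v: "\<omega> \<in> space (P0 m) \<Longrightarrow> op_norm_on (H m) (V m \<omega>) = ennreal (v \<omega>)"
  using norm_le_op_norm(2)[OF V_bounded[OF m] subspace_H[OF m] subspace_0[OF subspace_H[OF m]]]
  by (simp add: v_def ennreal_enn2real)

lemma quadratic_bound:
  assumes "\<omega> \<in> space (P0 m)" "t \<in> T"
  shows "\<bar>V m \<omega> (\<eta> m t) \<bullet> \<eta> m t\<bar> \<le> r\<^sup>2 * v \<omega>"
proof -
  have n: "norm (\<eta> m t) \<le> r" by (intro feature_norm T_Theta assms)
  have "\<bar>V m \<omega> (\<eta> m t) \<bullet> \<eta> m t\<bar> \<le> norm (V m \<omega> (\<eta> m t)) * norm (\<eta> m t)" by (rule Cauchy_Schwarz_ineq2)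
  also have "\<dots> \<le> (v \<omega> * norm (\<eta> m t)) * norm (\<eta> m t)"
    using norm_le_op_norm(1)[OF V_bounded[OF m assms(1)] subspace_H[OF m] feature_H[OF T_Theta[OF assms(2)]]]
    by (intro mult_right_mono) (simp_all add: v_def assms(1))
  also have "\<dots> \<le> (v \<omega> * r) * r"
    using n radius_pos v_nonneg by (intro mult_mono mult_left_mono) auto
  finally show ?thesis by (simp add: power2_eq_square mult_ac)
qed

lemma errors:
  "score_error r (P0 m) (P \<theta> m) (U m) \<le> ennreal D" "score_error r (P0 m) (P \<theta> m) (S m) \<le> ennreal D"
  "curvature_error r (P0 m) (P \<theta> m) (H m) (V m) \<le> ennreal D"
  "remainder_error r (P0 m) (P \<theta> m) T (R m) \<le> ennreal D"
  "density_error r (P0 m) (P \<theta> m) (\<Delta> m \<theta>) \<le> ennreal D"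
proof -
  note 1 = error_bound
  note 2 = ennreal_sum_le_parts(1)[OF 1] ennreal_sum_le_parts(2)[OF 1]
  note 3 = ennreal_sum_le_parts(1)[OF 2(1)] ennreal_sum_le_parts(2)[OF 2(1)]
  note 4 = ennreal_sum_le_parts(1)[OF 3(1)] ennreal_sum_le_parts(2)[OF 3(1)]
  note 5 = ennreal_sum_le_parts(1)[OF 4(1)] ennreal_sum_le_parts(2)[OF 4(1)]
  show "score_error r (P0 m) (P \<theta> m) (U m) \<le> ennreal D" "score_error r (P0 m) (P \<theta> m) (S m) \<le> ennreal D"
    "curvature_error r (P0 m) (P \<theta> m) (H m) (V m) \<le> ennreal D"
    "remainder_error r (P0 m) (P \<theta> m) T (R m) \<le> ennreal D"
    "density_error r (P0 m) (P \<theta> m) (\<Delta> m \<theta>) \<le> ennreal D"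
    by (fact 5 4(2) 3(2) 2(2))+
qed

lemmas U_cubes = score_error_moments[OF errors(1) radius_pos D_nonneg U_measurable[OF m]
    measurable_P[OF U_measurable[OF m]]]
lemmas S_cubes = score_error_moments[OF errors(2) radius_pos D_nonneg S_measurable[OF m]
    measurable_P[OF S_measurable[OF m]]]
lemma V_moments:
  "moment_le 2 (P0 m) (\<lambda>\<omega>. r\<^sup>2 * v \<omega>) (r\<^sup>2 * D\<^sup>2)"
  "moment_le 3 (P0 m) (\<lambda>\<omega>. r\<^sup>2 * v \<omega>) (r\<^sup>2 * D)" "moment_le 3 (P \<theta> m) (\<lambda>\<omega>. r\<^sup>2 * v \<omega>) (r\<^sup>2 * D)"
  using curvature_error_moments[OF errors(3) radius_pos D_nonneg v_measurable
    measurable_P[OF v_measurable] v_nonneg op_norm_eq_v space_P] by simp_all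

lemma R_moments:
  "t \<in> T \<Longrightarrow> \<bar>\<integral>\<omega>. R m t \<omega> \<partial>P0 m\<bar> \<le> r\<^sup>2 * D"
  "t \<in> T \<Longrightarrow> moment_le 2 (P0 m) (R m t) (r\<^sup>2 * D\<^sup>2)" "t \<in> T \<Longrightarrow> moment_le 3 (P0 m) (R m t) (r\<^sup>2 * D)"
  "(\<integral>\<^sup>+\<omega>. (SUP t\<in>T. ennreal (\<bar>R m t \<omega>\<bar> ^ 3)) \<partial>P \<theta> m) \<le> ennreal (r\<^sup>2 * D)"
  using remainder_error_moments[OF errors(4) radius_pos D_nonneg R_measurable[OF m]] by simp_all

lemmas Delta_moments = density_error_moments[OF errors(5) radius_pos D_nonneg
    Delta_measurable[OF m theta] measurable_P[OF Delta_measurable[OF m theta]]]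

lemma score_squares:
  "moment_le 2 (P0 m) (\<lambda>\<omega>. r * norm (U m \<omega>)) ((r * sqrt L)\<^sup>2)"
  "moment_le 2 (P0 m) (\<lambda>\<omega>. r * norm (S m \<omega>)) ((r * sqrt L)\<^sup>2)"
proof -
  note [measurable] = U_measurable[OF m] S_measurable[OF m]
  have "(\<integral>\<^sup>+\<omega>. ennreal (\<bar>norm (U m \<omega>)\<bar> ^ 2) \<partial>P0 m) \<le> ennreal L"
    "(\<integral>\<^sup>+\<omega>. ennreal (\<bar>norm (S m \<omega>)\<bar> ^ 2) \<partial>P0 m) \<le> ennreal L"
    using second_bound by (auto simp: second_moments_def dest: ennreal_sum_le_parts)
  moreover have "(r * sqrt L)\<^sup>2 = r\<^sup>2 * L" using L_nonneg by (simp add: power_mult_distrib)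
  ultimately show "moment_le 2 (P0 m) (\<lambda>\<omega>. r * norm (U m \<omega>)) ((r * sqrt L)\<^sup>2)"
    "moment_le 2 (P0 m) (\<lambda>\<omega>. r * norm (S m \<omega>)) ((r * sqrt L)\<^sup>2)"
    using radius_pos L_nonneg by (auto intro!: moment_le_scale)
qed

text \<open>
  Changing one coordinate of the sample leaves all other components as they are, so continuity of
  the sum gives continuity of differences within one component.
\<close>

lemma X_difference_continuous:
  assumes "\<omega> \<in> space (P0 m)" "\<omega>' \<in> space (P0 m)"
  shows "continuous_on T (\<lambda>t. X t \<omega> - X t \<omega>')"
proof -
  have "prob_space (PiM {1..M} P0)" by (rule prob_space_PiM) (use prob_P0 in auto)
  then obtain z where z: "z \<in> space (PiM {1..M} P0)" using prob_space.not_empty by blast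
  have upd: "z(m := w) \<in> space (PiM {1..M} P0)" if "w \<in> space (P0 m)" for w
    using z that m by (auto simp: space_PiM PiE_iff extensional_def)
  have split: "likelihood_process M U V R \<eta> t (z(m := w))
      = X t w + (\<Sum>k\<in>{1..M} - {m}. local_component U V R \<eta> k t (z k))" for t w
  proof -
    have "(\<Sum>k\<in>{1..M} - {m}. local_component U V R \<eta> k t ((z(m := w)) k))
        = (\<Sum>k\<in>{1..M} - {m}. local_component U V R \<eta> k t (z k))"
      by (rule sum.cong) auto
    then show ?thesis
      unfolding likelihood_process_def using m by (subst sum.remove[of _ m]) auto
  qed
  have "continuous_on T (\<lambda>t. likelihood_process M U V R \<eta> t (z(m := \<omega>))
      - likelihood_process M U V R \<eta> t (z(m := \<omega>')))"
    by (intro continuous_on_diff X_continuous upd assms)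
  then show ?thesis by (simp add: split)
qed

lemma feature_continuous_T: "continuous_on T (\<eta> m)"
  using continuous_on_subset[OF feature_cont[OF m] T_subset] .

lemma quadratic_continuous:
  assumes \<omega>: "\<omega> \<in> space (P0 m)"
  shows "continuous_on T (\<lambda>t. V m \<omega> (\<eta> m t) \<bullet> \<eta> m t)"
proof -
  obtain B where V: "\<And>x y. x \<in> H m \<Longrightarrow> y \<in> H m \<Longrightarrow> V m \<omega> (x + y) = V m \<omega> x + V m \<omega> y"
    and B: "\<And>x. x \<in> H m \<Longrightarrow> norm (V m \<omega> x) \<le> B * norm x"
    using V_bounded[OF m \<omega>] unfolding bounded_operator_on_def by blast
  have "\<bar>B\<bar>-lipschitz_on (H m) (V m \<omega>)"
  proof (rule lipschitz_onI)
    fix x y assume xy: "x \<in> H m" "y \<in> H m"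
    then have d: "x - y \<in> H m" using subspace_H[OF m] by (rule subspace_diff[rotated])
    have "V m \<omega> x = V m \<omega> y + V m \<omega> (x - y)" using V[OF xy(2) d] by simp
    then have "dist (V m \<omega> x) (V m \<omega> y) = norm (V m \<omega> (x - y))" by (simp add: dist_norm)
    also have "\<dots> \<le> B * norm (x - y)" by (rule B[OF d])
    also have "\<dots> \<le> \<bar>B\<bar> * dist x y" by (simp add: dist_norm mult_right_mono)
    finally show "dist (V m \<omega> x) (V m \<omega> y) \<le> \<bar>B\<bar> * dist x y" .
  qed simp
  then have "continuous_on (H m) (V m \<omega>)" by (rule lipschitz_on_continuous_on)
  then have "continuous_on T (\<lambda>t. V m \<omega> (\<eta> m t))"
    by (rule continuous_on_compose2[OF _ feature_continuous_T]) (use feature_H T_Theta in auto)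
  then show ?thesis by (intro continuous_on_inner feature_continuous_T)
qed

lemma R_difference_continuous:
  assumes "\<omega> \<in> space (P0 m)" "\<omega>' \<in> space (P0 m)"
  shows "continuous_on T (\<lambda>t. R m t \<omega> - R m t \<omega>')"
proof -
  have "continuous_on T (\<lambda>t. (X t \<omega> - X t \<omega>')
      - (U m \<omega> \<bullet> \<eta> m t - 1 / 2 * (V m \<omega> (\<eta> m t) \<bullet> \<eta> m t))
      + (U m \<omega>' \<bullet> \<eta> m t - 1 / 2 * (V m \<omega>' (\<eta> m t) \<bullet> \<eta> m t)))"
    by (intro continuous_intros X_difference_continuous quadratic_continuous feature_continuous_T assms)
  then show ?thesis by (simp add: local_component_def)
qed

definition \<rho> where
  "\<rho> \<omega> = root 3 (enn2real (SUP t\<in>T. ennreal (\<bar>R m t \<omega>\<bar> ^ 3)))"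

lemma R_sup_measurable: "(\<lambda>\<omega>. SUP t\<in>T. ennreal (\<bar>R m t \<omega>\<bar> ^ 3)) \<in> borel_measurable (P0 m)"
  by (rule base.SUP_perturbed_measurable[OF R_measurable[OF m] R_difference_continuous])

text \<open>
  The moment bound gives one sample point with finite supremum; any other path differs from that one
  by a continuous and hence bounded function.
\<close>

lemma R_sup_finite:
  assumes \<omega>: "\<omega> \<in> space (P0 m)"
  shows "(SUP t\<in>T. ennreal (\<bar>R m t \<omega>\<bar> ^ 3)) < \<top>"
proof -
  let ?s = "\<lambda>\<omega>. SUP t\<in>T. ennreal (\<bar>R m t \<omega>\<bar> ^ 3)"
  interpret N: prob_space "P \<theta> m" by (rule prob_at_P)
  have "(\<integral>\<^sup>+\<omega>. ?s \<omega> \<partial>P \<theta> m) \<noteq> \<infinity>" using R_moments(4) by (auto simp: top_unique)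
  then have "AE \<omega> in P \<theta> m. ?s \<omega> \<noteq> \<infinity>"
    by (rule nn_integral_PInf_AE[OF measurable_P[OF R_sup_measurable]])
  then have "AE \<omega> in P \<theta> m. \<exists>\<omega>0\<in>space (P \<theta> m). ?s \<omega>0 \<noteq> \<infinity>"
    using AE_space by eventually_elim blast
  then have "\<exists>\<omega>0\<in>space (P \<theta> m). ?s \<omega>0 \<noteq> \<infinity>" by simp
  then obtain \<omega>0 where \<omega>0: "\<omega>0 \<in> space (P0 m)" "?s \<omega>0 \<noteq> \<top>" by (auto simp: space_P)
  then obtain c where c: "0 \<le> c" "?s \<omega>0 = ennreal c" by (cases "?s \<omega>0") auto
  obtain B where B: "\<And>t. t \<in> T \<Longrightarrow> \<bar>R m t \<omega> - R m t \<omega>0\<bar> \<le> B"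
    using base.continuous_bounded_on_T[OF R_difference_continuous[OF \<omega> \<omega>0(1)]] by blast
  have "ennreal (\<bar>R m t \<omega>\<bar> ^ 3) \<le> ennreal (4 * (\<bar>B\<bar> ^ 3 + c))" if t: "t \<in> T" for t
  proof (rule ennreal_leI)
    have "ennreal (\<bar>R m t \<omega>0\<bar> ^ 3) \<le> ennreal c" unfolding c(2)[symmetric] by (rule SUP_upper[OF t])
    then have "\<bar>R m t \<omega>0\<bar> ^ 3 \<le> c" using c(1) by simp
    moreover have "\<bar>R m t \<omega> - R m t \<omega>0\<bar> ^ 3 \<le> \<bar>B\<bar> ^ 3"
      using B[OF t] by (intro power_mono) auto
    ultimately show "\<bar>R m t \<omega>\<bar> ^ 3 \<le> 4 * (\<bar>B\<bar> ^ 3 + c)"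
      using power_add_le(2)[of "R m t \<omega> - R m t \<omega>0" "R m t \<omega>0"] unfolding diff_add_cancel distrib_left by linarith
  qed
  then have "?s \<omega> \<le> ennreal (4 * (\<bar>B\<bar> ^ 3 + c))" by (rule SUP_least)
  then show ?thesis by (simp add: order_le_less_trans)
qed

lemma R_le_rho:
  assumes "\<omega> \<in> space (P0 m)" "t \<in> T"
  shows "\<bar>R m t \<omega>\<bar> \<le> \<rho> \<omega>"
proof -
  have "ennreal (\<bar>R m t \<omega>\<bar> ^ 3) \<le> (SUP t\<in>T. ennreal (\<bar>R m t \<omega>\<bar> ^ 3))" by (rule SUP_upper[OF assms(2)])
  then have "\<bar>R m t \<omega>\<bar> ^ 3 \<le> enn2real (SUP t\<in>T. ennreal (\<bar>R m t \<omega>\<bar> ^ 3))"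
    using R_sup_finite[OF assms(1)] by (metis enn2real_ennreal enn2real_mono zero_le_power abs_ge_zero)
  then have "root 3 (\<bar>R m t \<omega>\<bar> ^ 3) \<le> \<rho> \<omega>" unfolding \<rho>_def by (simp add: real_root_le_mono)
  then show ?thesis by (simp add: real_root_power_cancel)
qed

lemma rho_nonneg: "0 \<le> \<rho> \<omega>" by (simp add: \<rho>_def)

lemma rho_cube: "moment_le 3 (P \<theta> m) \<rho> (r\<^sup>2 * D)"
proof -
  have "\<rho> \<in> borel_measurable (P \<theta> m)"
    unfolding \<rho>_def[abs_def] using measurable_P[OF R_sup_measurable] by measurable
  moreover have "(\<integral>\<^sup>+\<omega>. ennreal (\<bar>\<rho> \<omega>\<bar> ^ 3) \<partial>P \<theta> m) \<le> (\<integral>\<^sup>+\<omega>. (SUP t\<in>T. ennreal (\<bar>R m t \<omega>\<bar> ^ 3)) \<partial>P \<theta> m)"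
  proof (rule nn_integral_mono)
    have "ennreal (enn2real s) \<le> s" for s by (cases s) auto
    then show "ennreal (\<bar>\<rho> \<omega>\<bar> ^ 3) \<le> (SUP t\<in>T. ennreal (\<bar>R m t \<omega>\<bar> ^ 3))" for \<omega>
      by (simp add: \<rho>_def)
  qed
  ultimately show ?thesis using R_moments(4) D_pos unfolding moment_le_def by (auto intro: order_trans)
qed

definition envelope where
  "envelope \<omega> = r * norm (U m \<omega>) + (r\<^sup>2 * v \<omega> + \<rho> \<omega>)"

lemma envelope_nonneg: "0 \<le> envelope \<omega>"
  using radius_pos by (simp add: envelope_def v_nonneg rho_nonneg)

lemma U_feature_bound: "t \<in> \<Theta> \<Longrightarrow> \<bar>U m \<omega> \<bullet> \<eta> m t\<bar> \<le> r * norm (U m \<omega>)"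
  using Cauchy_Schwarz_ineq2[of "U m \<omega>" "\<eta> m t"] mult_left_mono[OF feature_norm[of t] norm_ge_zero[of "U m \<omega>"]]
  by (simp add: mult.commute)

lemma S_feature_bound: "t \<in> \<Theta> \<Longrightarrow> \<bar>S m \<omega> \<bullet> \<eta> m t\<bar> \<le> r * norm (S m \<omega>)"
  using Cauchy_Schwarz_ineq2[of "S m \<omega>" "\<eta> m t"] mult_left_mono[OF feature_norm[of t] norm_ge_zero[of "S m \<omega>"]]
  by (simp add: mult.commute)

lemma X_le_envelope:
  assumes "\<omega> \<in> space (P0 m)" "t \<in> T"
  shows "\<bar>X t \<omega>\<bar> \<le> envelope \<omega>"
  using U_feature_bound[OF T_Theta[OF assms(2)], of \<omega>] quadratic_bound[OF assms] R_le_rho[OF assms]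
  unfolding local_component_def envelope_def by linarith

text \<open>
  Each sum costs a factor 4 by the convexity inequality for cubes, and the three terms are grouped as
  in the definition: \<open>4 * (1 + 4 * (1 + 1)) = 36\<close>.
\<close>

lemma envelope_cube: "moment_le 3 (P \<theta> m) envelope (36 * (r\<^sup>2 * D))"
  using moment3_add[OF U_cubes(2) moment3_add[OF V_moments(3) rho_cube]]
  unfolding envelope_def[abs_def] by (simp add: algebra_simps)

abbreviation a where "a t \<omega> \<equiv> U m \<omega> \<bullet> \<eta> m t"
abbreviation w where "w t \<omega> \<equiv> - (1 / 2) * (V m \<omega> (\<eta> m t) \<bullet> \<eta> m t) + R m t \<omega>"

lemma X_split: "X t \<omega> = a t \<omega> + w t \<omega>"
  by (simp add: local_component_def)

lemma quadratic_measurable: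
  assumes "t \<in> T"
  shows "(\<lambda>\<omega>. V m \<omega> (\<eta> m t) \<bullet> \<eta> m t) \<in> borel_measurable (P0 m)"
  using V_measurable[OF m feature_H[OF T_Theta[OF assms]]] by measurable

text \<open>
  The levels 8 and 2 are what the remainder of the component needs, a sum of a curvature and a
  remainder term; they are generous for the scores and for the density error.
\<close>

sublocale tilt: local_moments "P0 m" "P \<theta> m" "\<lambda>\<omega>. S m \<omega> \<bullet> \<eta> m \<theta>" "\<Delta> m \<theta>" "8 * (r\<^sup>2 * D)" "2 * r * D" "r * sqrt L"
proof (intro local_moments.intro log_likelihood_tilt.intro log_likelihood_tilt_axioms.intro
    local_moments_axioms.intro prob_at_P0 prob_at_P)
  note [measurable] = S_measurable[OF m] Delta_measurable[OF m theta]
  have le: "r\<^sup>2 * D \<le> 8 * (r\<^sup>2 * D)" using D_pos by simp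
  show "(\<lambda>\<omega>. S m \<omega> \<bullet> \<eta> m \<theta> + \<Delta> m \<theta> \<omega>) \<in> borel_measurable (P0 m)" by measurable
  show "P \<theta> m = density (P0 m) (\<lambda>\<omega>. ennreal (exp (S m \<omega> \<bullet> \<eta> m \<theta> + \<Delta> m \<theta> \<omega>)))"
    by (rule P_density[OF theta m])
  have Sm: "(\<lambda>\<omega>. S m \<omega> \<bullet> \<eta> m \<theta>) \<in> borel_measurable (P0 m)" by measurable
  have Sb: "\<bar>S m \<omega> \<bullet> \<eta> m \<theta>\<bar> \<le> \<bar>r * norm (S m \<omega>)\<bar>" for \<omega>
    using S_feature_bound[OF theta, of \<omega>] by linarith
  show "moment_le 3 (P0 m) (\<lambda>\<omega>. S m \<omega> \<bullet> \<eta> m \<theta>) (8 * (r\<^sup>2 * D))"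
    by (rule moment_le_bound[OF moment_le_mono[OF S_cubes(1) le] Sm Sb])
  show "moment_le 3 (P \<theta> m) (\<lambda>\<omega>. S m \<omega> \<bullet> \<eta> m \<theta>) (8 * (r\<^sup>2 * D))"
    by (rule moment_le_bound[OF moment_le_mono[OF S_cubes(2) le] measurable_P[OF Sm] Sb])
  show "moment_le 2 (P0 m) (\<lambda>\<omega>. S m \<omega> \<bullet> \<eta> m \<theta>) ((r * sqrt L)\<^sup>2)"
    by (rule moment_le_bound[OF score_squares(2) Sm Sb])
  show "moment_le 3 (P0 m) (\<Delta> m \<theta>) (8 * (r\<^sup>2 * D))" "moment_le 3 (P \<theta> m) (\<Delta> m \<theta>) (8 * (r\<^sup>2 * D))"
    by (rule moment_le_mono[OF Delta_moments(2) le], rule moment_le_mono[OF Delta_moments(3) le])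
  show "moment_le 2 (P0 m) (\<Delta> m \<theta>) ((2 * r * D)\<^sup>2)"
    by (rule moment_le_mono[OF Delta_moments(1)]) (simp add: power_mult_distrib)
qed (use D_pos radius_pos L_nonneg in auto)

lemma component_admissible:
  assumes t: "t \<in> T"
  shows "tilt.admissible (a t) (w t)"
proof -
  note [measurable] = U_measurable[OF m] quadratic_measurable[OF t] R_measurable[OF m t]
  have le: "r\<^sup>2 * D \<le> 8 * (r\<^sup>2 * D)" using D_pos by simp
  have am: "a t \<in> borel_measurable (P0 m)" by measurable
  have ab: "\<bar>a t \<omega>\<bar> \<le> \<bar>r * norm (U m \<omega>)\<bar>" for \<omega>
    using U_feature_bound[OF T_Theta[OF t], of \<omega>] by linarith
  have wm: "w t \<in> borel_measurable (P0 m)" by measurable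
  have wb: "\<bar>w t \<omega>\<bar> \<le> \<bar>r\<^sup>2 * v \<omega> + \<bar>R m t \<omega>\<bar>\<bar>" if "\<omega> \<in> space (P0 m)" for \<omega>
    using quadratic_bound[OF that t] by linarith
  have wb': "\<bar>w t \<omega>\<bar> \<le> \<bar>r\<^sup>2 * v \<omega> + \<rho> \<omega>\<bar>" if "\<omega> \<in> space (P \<theta> m)" for \<omega>
    using quadratic_bound[OF _ t, of \<omega>] R_le_rho[OF _ t, of \<omega>] that unfolding space_P by linarith
  have Rabs: "moment_le k (P0 m) (\<lambda>\<omega>. \<bar>R m t \<omega>\<bar>) c" if "moment_le k (P0 m) (R m t) c" for k c
    by (rule moment_le_bound[OF that]) simp_all
  have "moment_le 3 (P0 m) (a t) (8 * (r\<^sup>2 * D))"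
    by (rule moment_le_bound[OF moment_le_mono[OF U_cubes(1) le] am ab])
  moreover have "moment_le 3 (P \<theta> m) (a t) (8 * (r\<^sup>2 * D))"
    by (rule moment_le_bound[OF moment_le_mono[OF U_cubes(2) le] measurable_P[OF am] ab])
  moreover have "moment_le 2 (P0 m) (a t) ((r * sqrt L)\<^sup>2)"
    by (rule moment_le_bound[OF score_squares(1) am ab])
  moreover have "moment_le 3 (P0 m) (w t) (8 * (r\<^sup>2 * D))"
    using moment_le_bound[OF moment3_add[OF V_moments(2) Rabs[OF R_moments(3)[OF t]]] wm wb]
    by (simp add: algebra_simps)
  moreover have "moment_le 3 (P \<theta> m) (w t) (8 * (r\<^sup>2 * D))"
    using moment_le_bound[OF moment3_add[OF V_moments(3) rho_cube] measurable_P[OF wm] wb']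
    by (simp add: algebra_simps)
  moreover have "moment_le 2 (P0 m) (w t) ((2 * r * D)\<^sup>2)"
    using moment_le_bound[OF moment2_add[OF V_moments(1) Rabs[OF R_moments(2)[OF t]]] wm wb]
    by (simp add: power_mult_distrib algebra_simps)
  moreover have "(\<integral>\<omega>. a t \<omega> \<partial>P0 m) = 0"
  proof -
    have "integrable (P0 m) (\<lambda>\<omega>. r * norm (U m \<omega>))"
      by (rule prob_space.moment3_lower_integrable(1)[OF prob_at_P0 U_cubes(1)])
    then have "integrable (P0 m) (U m)"
      using radius_pos by (simp add: integrable_norm_iff)
    then show ?thesis using U_mean by simp
  qed
  ultimately show ?thesis unfolding tilt.admissible_def by blast
qed


section \<open>Centring a local component\<close>

lemma X_measurable: "t \<in> T \<Longrightarrow> X t \<in> borel_measurable (P \<theta> m)"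
proof -
  assume t: "t \<in> T"
  note [measurable] = U_measurable[OF m] quadratic_measurable[OF t] R_measurable[OF m t]
  have "(\<lambda>\<omega>. a t \<omega> + w t \<omega>) \<in> borel_measurable (P0 m)" by measurable
  then show ?thesis by (intro measurable_P) (simp add: X_split[abs_def])
qed

abbreviation mean where "mean t \<equiv> \<integral>\<omega>. X t \<omega> \<partial>P \<theta> m"

lemma envelope_integrable: "integrable (P \<theta> m) envelope"
  by (rule prob_space.moment3_lower_integrable(1)[OF prob_at_P envelope_cube])

lemma X_cube: "t \<in> T \<Longrightarrow> moment_le 3 (P \<theta> m) (X t) (36 * (r\<^sup>2 * D))"
  by (rule moment_le_bound[OF envelope_cube X_measurable])
    (simp_all add: space_P X_le_envelope abs_of_nonneg[OF envelope_nonneg])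

lemma X_integrable: "t \<in> T \<Longrightarrow> integrable (P \<theta> m) (X t)"
  by (rule prob_space.moment3_lower_integrable(1)[OF prob_at_P X_cube])

definition mean_envelope where "mean_envelope = (\<integral>\<omega>. envelope \<omega> \<partial>P \<theta> m)"

lemma mean_le_envelope: "t \<in> T \<Longrightarrow> \<bar>mean t\<bar> \<le> mean_envelope"
proof -
  assume t: "t \<in> T"
  have "\<bar>mean t\<bar> \<le> (\<integral>\<omega>. \<bar>X t \<omega>\<bar> \<partial>P \<theta> m)" by (rule integral_abs_bound)
  also have "\<dots> \<le> mean_envelope"
    unfolding mean_envelope_def
    by (rule integral_mono) (use X_integrable[OF t] envelope_integrable X_le_envelope t in \<open>auto simp: space_P\<close>)
  finally show ?thesis .
qed

lemma mean_envelope_cube: "0 \<le> mean_envelope" "mean_envelope ^ 3 \<le> 36 * (r\<^sup>2 * D)"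
proof -
  interpret N: prob_space "P \<theta> m" by (rule prob_at_P)
  note env = moment_leD[OF envelope_cube]
  show "0 \<le> mean_envelope"
    unfolding mean_envelope_def by (rule Bochner_Integration.integral_nonneg) (rule envelope_nonneg)
  have "mean_envelope ^ 3 \<le> (\<integral>\<omega>. envelope \<omega> ^ 3 \<partial>P \<theta> m)"
    unfolding mean_envelope_def
    by (rule N.cube_moment_inequalities(1))
      (use envelope_nonneg envelope_integrable N.moment3_lower_integrable(2)[OF envelope_cube] env(3)
        in \<open>simp_all add: abs_of_nonneg\<close>)
  also have "\<dots> \<le> 36 * (r\<^sup>2 * D)" using env(4) by (simp add: abs_of_nonneg[OF envelope_nonneg])
  finally show "mean_envelope ^ 3 \<le> 36 * (r\<^sup>2 * D)" .
qed

text \<open>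
  A single component need not be continuous or even measurable in the parameter: deterministic drifts
  of different components may cancel. Centring removes the drift.
\<close>

definition fluctuation where "fluctuation \<omega> t = X t \<omega> - mean t"

lemma fluctuation_envelope:
  assumes "\<omega> \<in> space (P0 m)" "t \<in> T"
  shows "\<bar>fluctuation \<omega> t\<bar> \<le> envelope \<omega> + mean_envelope"
  using X_le_envelope[OF assms] mean_le_envelope[OF assms(2)] unfolding fluctuation_def by linarith

lemma fluctuation_measurable: "case_prod fluctuation \<in> borel_measurable (P \<theta> m \<Otimes>\<^sub>M \<pi>)"
proof -
  interpret N: prob_space "P \<theta> m" by (rule prob_at_P)
  obtain \<omega>0 where \<omega>0: "\<omega>0 \<in> space (P0 m)" using N.not_empty by (auto simp: space_P)
  let ?k = "\<lambda>\<omega> t. X t \<omega> - X t \<omega>0"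
  have k: "case_prod ?k \<in> borel_measurable (P \<theta> m \<Otimes>\<^sub>M \<pi>)"
  proof (rule base.caratheodory_measurable)
    show "(\<lambda>\<omega>. X t \<omega> - X t \<omega>0) \<in> borel_measurable (P \<theta> m)" if "t \<in> T" for t
      using X_measurable[OF that] by measurable
  qed (use X_difference_continuous \<omega>0 in \<open>auto simp: space_P\<close>)
  note [measurable] = base.mean_measurable[OF prob_at_P k]
  have "(\<lambda>(\<omega>, t). ?k \<omega> t - (\<integral>\<omega>. ?k \<omega> t \<partial>P \<theta> m)) \<in> borel_measurable (P \<theta> m \<Otimes>\<^sub>M \<pi>)"
    using k unfolding split_beta' by measurable
  then show ?thesis
  proof (rule measurable_cong[THEN iffD1, rotated])
    fix p assume "p \<in> space (P \<theta> m \<Otimes>\<^sub>M \<pi>)"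
    then have t: "snd p \<in> T" by (auto simp: space_pair_measure base.space_\<tau>)
    have "(\<integral>\<omega>. ?k \<omega> (snd p) \<partial>P \<theta> m) = mean (snd p) - X (snd p) \<omega>0"
      using X_integrable[OF t] by (simp add: N.prob_space)
    then show "(case p of (\<omega>, t) \<Rightarrow> ?k \<omega> t - (\<integral>\<omega>. ?k \<omega> t \<partial>P \<theta> m)) = case_prod fluctuation p"
      by (simp add: split_beta' fluctuation_def)
  qed
qed

lemma shifted_envelope_cube: "moment_le 3 (P \<theta> m) (\<lambda>\<omega>. envelope \<omega> + mean_envelope) (288 * (r\<^sup>2 * D))"
proof -
  have c: "moment_le 3 (P \<theta> m) (\<lambda>_. mean_envelope) (36 * (r\<^sup>2 * D))"
    using moment_le_mono[OF tilt.const_moment(2)[of mean_envelope]] mean_envelope_cube by simp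
  show ?thesis using moment3_add[OF envelope_cube c] by (simp add: algebra_simps)
qed

lemma fluctuation_centred: "centred_field (P \<theta> m) \<pi> fluctuation (1 + 288 * (r\<^sup>2 * D))"
proof (intro centred_field.intro centred_field_axioms.intro prob_at_P fluctuation_measurable)
  interpret N: prob_space "P \<theta> m" by (rule prob_at_P)
  show "bounded_on_space \<pi> (fluctuation \<omega>)" if "\<omega> \<in> space (P \<theta> m)" for \<omega>
    by (rule bounded_on_spaceI[where B="envelope \<omega> + mean_envelope"])
      (use that fluctuation_envelope in \<open>auto simp: space_P base.space_\<tau>\<close>)
  fix t assume "t \<in> space \<pi>"
  then have t: "t \<in> T" by (simp add: base.space_\<tau>)
  show "(\<integral>\<omega>. fluctuation \<omega> t \<partial>P \<theta> m) = 0"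
    unfolding fluctuation_def using X_integrable[OF t] by (simp add: N.prob_space)
  note cube = moment_leD[OF shifted_envelope_cube]
  have "(\<integral>\<^sup>+\<omega>. ennreal ((fluctuation \<omega> t)\<^sup>2) \<partial>P \<theta> m)
      \<le> (\<integral>\<^sup>+\<omega>. ennreal (1 + \<bar>envelope \<omega> + mean_envelope\<bar> ^ 3) \<partial>P \<theta> m)"
  proof (intro nn_integral_mono ennreal_leI)
    fix \<omega> assume "\<omega> \<in> space (P \<theta> m)"
    then have b: "\<bar>fluctuation \<omega> t\<bar> \<le> \<bar>envelope \<omega> + mean_envelope\<bar>"
      using fluctuation_envelope[OF _ t, of \<omega>] unfolding space_P by linarith
    then have "(fluctuation \<omega> t)\<^sup>2 \<le> \<bar>envelope \<omega> + mean_envelope\<bar>\<^sup>2"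
      using power_mono[OF b, of 2] by simp
    also have "\<dots> \<le> 1 + \<bar>envelope \<omega> + mean_envelope\<bar> ^ 3"
    proof (cases "\<bar>envelope \<omega> + mean_envelope\<bar> \<le> 1")
      case True
      then have "\<bar>envelope \<omega> + mean_envelope\<bar>\<^sup>2 \<le> 1" by (intro power_le_one) auto
      then show ?thesis using zero_le_power[of "\<bar>envelope \<omega> + mean_envelope\<bar>" 3] by linarith
    next
      case False
      then have "\<bar>envelope \<omega> + mean_envelope\<bar>\<^sup>2 \<le> \<bar>envelope \<omega> + mean_envelope\<bar> ^ 3"
        by (intro power_increasing) auto
      then show ?thesis by linarith
    qed
    finally show "(fluctuation \<omega> t)\<^sup>2 \<le> 1 + \<bar>envelope \<omega> + mean_envelope\<bar> ^ 3" .
  qed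
  also have "\<dots> = ennreal (\<integral>\<omega>. 1 + \<bar>envelope \<omega> + mean_envelope\<bar> ^ 3 \<partial>P \<theta> m)"
    by (rule nn_integral_eq_integral) (use cube(3) in auto)
  also have "\<dots> \<le> ennreal (1 + 288 * (r\<^sup>2 * D))"
    using cube(3,4) by (intro ennreal_leI) (simp add: N.prob_space)
  finally show "(\<integral>\<^sup>+\<omega>. ennreal ((fluctuation \<omega> t)\<^sup>2) \<partial>P \<theta> m) \<le> ennreal (1 + 288 * (r\<^sup>2 * D))" .
qed (use D_pos in simp)

lemma fluctuation_remainder:
  assumes \<nu>: "prob_space \<nu>" "sets \<nu> = sets \<pi>"
  shows "(\<integral>\<^sup>+\<omega>. ennreal \<bar>cumulant_remainder \<nu> (fluctuation \<omega>)\<bar> \<partial>P \<theta> m) \<le> ennreal (576 * exp 4 * (r\<^sup>2 * D))"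
proof -
  interpret F: centred_field "P \<theta> m" \<pi> fluctuation "1 + 288 * (r\<^sup>2 * D)" by (rule fluctuation_centred)
  let ?e = "\<lambda>\<omega>. envelope \<omega> + mean_envelope"
  note cube = moment_leD[OF shifted_envelope_cube]
  have e0: "0 \<le> ?e \<omega>" for \<omega> using envelope_nonneg mean_envelope_cube(1) by (simp add: add_nonneg_nonneg)
  have "(\<integral>\<^sup>+\<omega>. ennreal \<bar>cumulant_remainder \<nu> (fluctuation \<omega>)\<bar> \<partial>P \<theta> m)
      \<le> (\<integral>\<^sup>+\<omega>. ennreal (2 * exp 4 * \<bar>?e \<omega>\<bar> ^ 3) \<partial>P \<theta> m)"
  proof (intro nn_integral_mono ennreal_leI)
    fix \<omega> assume \<omega>: "\<omega> \<in> space (P \<theta> m)"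
    have "\<bar>cumulant_remainder \<nu> (fluctuation \<omega>)\<bar> \<le> 2 * exp 4 * ?e \<omega> ^ 3"
      by (rule prob_space.cumulant_remainder_le_cube[OF \<nu>(1) F.path_properties(1)[OF \<nu> \<omega>]])
        (use fluctuation_envelope \<omega> in \<open>simp add: F.space_base[OF \<nu>] space_P base.space_\<tau>\<close>)
    then show "\<bar>cumulant_remainder \<nu> (fluctuation \<omega>)\<bar> \<le> 2 * exp 4 * \<bar>?e \<omega>\<bar> ^ 3"
      by (simp only: abs_of_nonneg[OF e0])
  qed
  also have "\<dots> = ennreal (\<integral>\<omega>. 2 * exp 4 * \<bar>?e \<omega>\<bar> ^ 3 \<partial>P \<theta> m)"
    by (rule nn_integral_eq_integral) (use cube(3) in auto)
  also have "\<dots> \<le> ennreal (576 * exp 4 * (r\<^sup>2 * D))"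
    using mult_left_mono[OF cube(4), of "2 * exp 4"] by (intro ennreal_leI) (simp add: mult_ac)
  finally show ?thesis .
qed

lemma fluctuation_covariance:
  assumes "s \<in> T" "t \<in> T"
  shows "\<bar>centred_field.covariance (P \<theta> m) fluctuation s t - (\<integral>\<omega>. a s \<omega> * a t \<omega> \<partial>P0 m)\<bar>
    \<le> (944 + 12 * sqrt L) * (r\<^sup>2 * (D * (1 + D)))"
proof -
  interpret N: prob_space "P \<theta> m" by (rule prob_at_P)
  interpret F: centred_field "P \<theta> m" \<pi> fluctuation "1 + 288 * (r\<^sup>2 * D)" by (rule fluctuation_centred)
  have prod: "integrable (P \<theta> m) (\<lambda>\<omega>. X s \<omega> * X t \<omega>)"
    using moment3_product(1)[OF X_cube[OF assms(1)] X_cube[OF assms(2)] tilt.const_moment(2)[of 1]] by simp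
  have "F.covariance s t = (\<integral>\<omega>. X s \<omega> * X t \<omega> - X s \<omega> * mean t - mean s * X t \<omega> + mean s * mean t \<partial>P \<theta> m)"
    unfolding F.covariance_def fluctuation_def by (simp add: algebra_simps)
  also have "\<dots> = (\<integral>\<omega>. X s \<omega> * X t \<omega> \<partial>P \<theta> m) - mean s * mean t"
    using prod X_integrable[OF assms(1)] X_integrable[OF assms(2)] by (simp add: N.prob_space)
  finally have "\<bar>F.covariance s t - (\<integral>\<omega>. a s \<omega> * a t \<omega> \<partial>P0 m)\<bar>
      \<le> 116 * (8 * (r\<^sup>2 * D)) + 6 * (r * sqrt L) * (2 * r * D) + 4 * (2 * r * D)\<^sup>2"
    using tilt.covariance_expansion[OF component_admissible[OF assms(1)] component_admissible[OF assms(2)]]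
    by (simp only: X_split)
  also have "\<dots> = (928 + 12 * sqrt L) * (r\<^sup>2 * D) + 16 * (r\<^sup>2 * (D * D))"
    by (simp add: power2_eq_square algebra_simps)
  also have "\<dots> \<le> (944 + 12 * sqrt L) * (r\<^sup>2 * (D * (1 + D)))"
  proof -
    have "0 \<le> r\<^sup>2 * D" "0 \<le> r\<^sup>2 * (D * D)" "0 \<le> sqrt L * (r\<^sup>2 * (D * D))"
      using D_pos L_nonneg by simp_all
    then show ?thesis by (simp add: algebra_simps)
  qed
  finally show ?thesis .
qed

lemma mean_drift:
  assumes t: "t \<in> T"
  shows "\<bar>mean t - ((\<integral>\<omega>. (S m \<omega> \<bullet> \<eta> m \<theta>) * (U m \<omega> \<bullet> \<eta> m t) \<partial>P0 m)
      - 1 / 2 * (\<integral>\<omega>. V m \<omega> (\<eta> m t) \<bullet> \<eta> m t \<partial>P0 m))\<bar>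
    \<le> (197 + 4 * sqrt L) * (r\<^sup>2 * (D * (1 + D)))"
proof -
  let ?e = "\<integral>\<omega>. (S m \<omega> \<bullet> \<eta> m \<theta>) * (U m \<omega> \<bullet> \<eta> m t) \<partial>P0 m"
    and ?k = "\<integral>\<omega>. V m \<omega> (\<eta> m t) \<bullet> \<eta> m t \<partial>P0 m" and ?R = "\<integral>\<omega>. R m t \<omega> \<partial>P0 m"
  have qi: "integrable (P0 m) (\<lambda>\<omega>. V m \<omega> (\<eta> m t) \<bullet> \<eta> m t)"
  proof (rule tilt.moment3_lower_integrable(1))
    show "moment_le 3 (P0 m) (\<lambda>\<omega>. V m \<omega> (\<eta> m t) \<bullet> \<eta> m t) (r\<^sup>2 * D)"
      by (rule moment_le_bound[OF V_moments(2) quadratic_measurable[OF t]])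
        (use quadratic_bound[OF _ t] in \<open>force intro: order_trans\<close>)
  qed
  have Ri: "integrable (P0 m) (R m t)" by (rule tilt.moment3_lower_integrable(1)[OF R_moments(3)[OF t]])
  have w: "(\<integral>\<omega>. w t \<omega> \<partial>P0 m) = - (1 / 2) * ?k + ?R" using qi Ri by simp
  have "\<bar>mean t - ?e - (- (1 / 2) * ?k + ?R)\<bar>
      \<le> 24 * (8 * (r\<^sup>2 * D)) + 2 * (r * sqrt L) * (2 * r * D) + (2 * r * D)\<^sup>2"
    using tilt.mean_expansion[OF component_admissible[OF t]] unfolding w by (simp only: X_split)
  moreover have "\<bar>?R\<bar> \<le> r\<^sup>2 * D" by (rule R_moments(1)[OF t])
  ultimately have "\<bar>mean t - (?e - 1 / 2 * ?k)\<bar>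
      \<le> 24 * (8 * (r\<^sup>2 * D)) + 2 * (r * sqrt L) * (2 * r * D) + (2 * r * D)\<^sup>2 + r\<^sup>2 * D" by linarith
  also have "\<dots> = (193 + 4 * sqrt L) * (r\<^sup>2 * D) + 4 * (r\<^sup>2 * (D * D))"
    by (simp add: power2_eq_square algebra_simps)
  also have "\<dots> \<le> (197 + 4 * sqrt L) * (r\<^sup>2 * (D * (1 + D)))"
  proof -
    have "0 \<le> r\<^sup>2 * D" "0 \<le> r\<^sup>2 * (D * D)" "0 \<le> sqrt L * (r\<^sup>2 * (D * D))"
      using D_pos L_nonneg by simp_all
    then show ?thesis by (simp add: algebra_simps)
  qed
  finally show ?thesis .
qed

text \<open>
  The bound expresses the standard deviation by the third moment; its cube is then within the target.
\<close>

lemma score_variance: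
  assumes t: "t \<in> T"
  shows "(\<integral>\<omega>. a t \<omega> * a t \<omega> \<partial>P0 m) \<le> (root 3 (r\<^sup>2 * D))\<^sup>2"
proof -
  define x where "x = root 3 (r\<^sup>2 * D)"
  have x: "0 < x" "x ^ 3 = r\<^sup>2 * D" using D_pos radius_pos by (simp_all add: x_def)
  have cube: "moment_le 3 (P0 m) (a t) (r\<^sup>2 * D)"
  proof (rule moment_le_bound[OF U_cubes(1)])
    show "a t \<in> borel_measurable (P0 m)" using U_measurable[OF m] by measurable
    show "\<bar>a t \<omega>\<bar> \<le> \<bar>r * norm (U m \<omega>)\<bar>" for \<omega>
      using U_feature_bound[OF T_Theta[OF t], of \<omega>] by linarith
  qed
  note c = moment_leD[OF cube]
  \<comment> \<open>Tangent form of the inequality between second and third moments, at the point \<open>x\<close>.\<close>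
  have "(\<integral>\<omega>. 3 * x * (a t \<omega>)\<^sup>2 \<partial>P0 m) \<le> (\<integral>\<omega>. x ^ 3 + 2 * \<bar>a t \<omega>\<bar> ^ 3 \<partial>P0 m)"
  proof (rule integral_mono)
    show "3 * x * (a t \<omega>)\<^sup>2 \<le> x ^ 3 + 2 * \<bar>a t \<omega>\<bar> ^ 3" for \<omega>
      using cubic_tangent[of x "\<bar>a t \<omega>\<bar>"] x(1) by (simp add: mult_ac)
  qed (use c(3) tilt.moment3_lower_integrable(2)[OF cube] in auto)
  also have "\<dots> \<le> 3 * x ^ 3" using c(3) c(4)[folded x(2)] by (simp add: tilt.prob_space)
  finally have "x * (\<integral>\<omega>. (a t \<omega>)\<^sup>2 \<partial>P0 m) \<le> x * x\<^sup>2" by (simp add: power2_eq_square power3_eq_cube)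
  then show ?thesis using x(1) unfolding x_def[symmetric] by (simp add: power2_eq_square)
qed

end


section \<open>Comparison of the free energies\<close>

definition comparison_constant :: "real \<Rightarrow> real" where
  "comparison_constant L = 1442 * exp 25 + 576 * exp 4 + 1141 + 16 * sqrt L"

text \<open>
  Adding the Gaussian mean to the centred component gives a field that differs from the component by
  a small deterministic drift and has exactly the mean of its Gaussian counterpart. The exchange
  argument compares these fields; the drifts are summed up separately, in supremum norm.
\<close>

lemma free_energy_comparison:
  assumes model: "local_likelihood_model \<Theta> T \<pi> M H \<eta> P0 P U V R S \<Delta>"
    and counterpart: "gaussian_counterpart \<Theta> T M H \<eta> P0 U V S A \<Sigma> K Q Y"
    and theta: "\<theta> \<in> \<Theta>" and D: "0 < D" and L: "0 \<le> L"
    and centred: "\<And>m. m \<in> {1..M} \<Longrightarrow> (\<integral>\<omega>. U m \<omega> \<partial>P0 m) = 0"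
    and second: "\<And>m. m \<in> {1..M} \<Longrightarrow> second_moments (P0 m) (U m) (S m) \<le> ennreal L"
    and errors: "\<And>m. m \<in> {1..M} \<Longrightarrow> score_error (feature_radius \<Theta> M \<eta>) (P0 m) (P \<theta> m) (U m)
      + score_error (feature_radius \<Theta> M \<eta>) (P0 m) (P \<theta> m) (S m)
      + curvature_error (feature_radius \<Theta> M \<eta>) (P0 m) (P \<theta> m) (H m) (V m)
      + remainder_error (feature_radius \<Theta> M \<eta>) (P0 m) (P \<theta> m) T (R m)
      + density_error (feature_radius \<Theta> M \<eta>) (P0 m) (P \<theta> m) (\<Delta> m \<theta>) \<le> ennreal D"
  shows "\<bar>(\<integral>\<omega>. log_partition \<pi> (\<lambda>t. likelihood_process M U V R \<eta> t \<omega>) \<partial>PiM {1..M} (P \<theta>))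
      - (\<integral>\<omega>. log_partition \<pi> (\<lambda>t. \<Sum>m\<in>{1..M}. Y m t \<omega>) \<partial>Q \<theta>)\<bar>
    \<le> real M * (comparison_constant L * ((feature_radius \<Theta> M \<eta>)\<^sup>2 * (D * (1 + D))))"
proof -
  interpret model: local_likelihood_model \<Theta> T \<pi> M H \<eta> P0 P U V R S \<Delta> by fact
  interpret G: gaussian_counterpart \<Theta> T M H \<eta> P0 U V S A \<Sigma> K Q Y by fact
  interpret base: compact_metrizable_base T \<pi>
    by unfold_locales (fact model.compact_T model.metrizable_T model.sets_prior)+
  interpret prior: prob_space \<pi> by (rule model.prob_prior)
  interpret Q: prob_space "Q \<theta>" by (rule G.prob_Q[OF theta])
  have component: "bounded_local_component \<Theta> T \<pi> M H \<eta> P0 P U V R S \<Delta> \<theta> m D L" if "m \<in> {1..M}" for m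
    by (intro bounded_local_component.intro bounded_local_component_axioms.intro model
        theta that D L centred second errors)
  let ?I = "{1..M}" and ?r = "feature_radius \<Theta> M \<eta>"
  define E where "E = ?r\<^sup>2 * (D * (1 + D))"
  define x where "x = root 3 (?r\<^sup>2 * D)"
  let ?X = "local_component U V R \<eta>"
  define \<mu> where "\<mu> m t = (\<integral>\<omega>. ?X m t \<omega> \<partial>P \<theta> m)" for m t
  define b where "b m t = (\<integral>\<omega>. Y m t \<omega> \<partial>Q \<theta>)" for m t
  define F where "F m \<omega> t = ?X m t \<omega> - \<mu> m t" for m \<omega> t
  have x: "0 < x" "x ^ 3 \<le> E"
    using D model.radius_pos by (simp_all add: x_def E_def)
  have E0: "?r\<^sup>2 * D \<le> E" using D by (simp add: E_def algebra_simps)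
  have drift: "\<bar>\<mu> m t - b m t\<bar> \<le> (197 + 4 * sqrt L) * E" if m: "m \<in> ?I" and t: "t \<in> T" for m t
  proof -
    interpret c: bounded_local_component \<Theta> T \<pi> M H \<eta> P0 P U V R S \<Delta> \<theta> m D L
      by (rule component[OF m])
    have "b m t = (\<integral>\<omega>. (S m \<omega> \<bullet> \<eta> m \<theta>) * (U m \<omega> \<bullet> \<eta> m t) \<partial>P0 m)
        - 1 / 2 * (\<integral>\<omega>. V m \<omega> (\<eta> m t) \<bullet> \<eta> m t \<partial>P0 m)"
      unfolding b_def G.Y_mean[OF theta m t]
      using G.A_form[OF m c.feature_H[OF theta] c.feature_H[OF c.T_Theta[OF t]]]
        G.K_form[OF m c.feature_H[OF c.T_Theta[OF t]] c.feature_H[OF c.T_Theta[OF t]]] by simp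
    then show ?thesis using c.mean_drift[OF t] unfolding \<mu>_def E_def by (simp only:)
  qed
  have Y_meas: "Y m t \<in> borel_measurable (Q \<theta>)" if "m \<in> ?I" "t \<in> T" for m t
    using gaussian_process_at[OF G.Y_gaussian[OF theta that(1)] that(2)] by (simp add: gaussian_rv_def)
  have b_bounded: "bounded_on_space \<pi> (b m)" if m: "m \<in> ?I" for m
  proof -
    interpret c: bounded_local_component \<Theta> T \<pi> M H \<eta> P0 P U V R S \<Delta> \<theta> m D L
      by (rule component[OF m])
    show ?thesis
    proof (rule bounded_on_spaceI)
      fix t assume "t \<in> space \<pi>"
      then have t: "t \<in> T" by (simp add: base.space_\<tau>)
      show "\<bar>b m t\<bar> \<le> c.mean_envelope + (197 + 4 * sqrt L) * E"
        using drift[OF m t] c.mean_le_envelope[OF t] unfolding \<mu>_def by linarith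
    qed
  qed
  have gaussian: "subgaussian_field (base.path_space (Q \<theta>) (Y m)) \<pi> (\<lambda>\<omega> t. Y m t \<omega> - b m t) x"
    "b m \<in> borel_measurable \<pi>"
    "\<And>s t. s \<in> T \<Longrightarrow> t \<in> T \<Longrightarrow>
      centred_field.covariance (base.path_space (Q \<theta>) (Y m)) (\<lambda>\<omega> t. Y m t \<omega> - b m t) s t
        = (\<integral>\<omega>. (U m \<omega> \<bullet> \<eta> m s) * (U m \<omega> \<bullet> \<eta> m t) \<partial>P0 m)"
    if m: "m \<in> ?I" for m
  proof -
    interpret c: bounded_local_component \<Theta> T \<pi> M H \<eta> P0 P U V R S \<Delta> \<theta> m D L
      by (rule component[OF m])
    have cov: "(\<integral>\<omega>. (Y m s \<omega> - b m s) * (Y m t \<omega> - b m t) \<partial>Q \<theta>)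
        = (\<integral>\<omega>. (U m \<omega> \<bullet> \<eta> m s) * (U m \<omega> \<bullet> \<eta> m t) \<partial>P0 m)" if "s \<in> T" "t \<in> T" for s t
      unfolding b_def G.Y_cov[OF theta m that]
      by (rule G.Sigma_form[OF m c.feature_H[OF c.T_Theta[OF that(1)]] c.feature_H[OF c.T_Theta[OF that(2)]]])
    have var: "(\<integral>\<omega>. (Y m t \<omega> - (\<integral>\<omega>. Y m t \<omega> \<partial>Q \<theta>))\<^sup>2 \<partial>Q \<theta>) \<le> x\<^sup>2" if "t \<in> T" for t
      using cov[OF that that] c.score_variance[OF that] unfolding b_def x_def power2_eq_square by simp
    note gc = base.gaussian_centred_field[OF G.prob_Q[OF theta] G.Y_gaussian[OF theta m]
        G.Y_continuous[OF theta m] var x(1) b_bounded[OF m, unfolded b_def[abs_def]]]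
    show "subgaussian_field (base.path_space (Q \<theta>) (Y m)) \<pi> (\<lambda>\<omega> t. Y m t \<omega> - b m t) x"
      unfolding b_def by (rule gc(1))
    show "b m \<in> borel_measurable \<pi>" unfolding b_def[abs_def] by (rule gc(2))
    show "centred_field.covariance (base.path_space (Q \<theta>) (Y m)) (\<lambda>\<omega> t. Y m t \<omega> - b m t) s t
        = (\<integral>\<omega>. (U m \<omega> \<bullet> \<eta> m s) * (U m \<omega> \<bullet> \<eta> m t) \<partial>P0 m)" if "s \<in> T" "t \<in> T" for s t
      using gc(3)[OF _ _ that] cov[OF that] unfolding b_def by simp
  qed
  have tameY: "tame_field \<pi> (base.path_space (Q \<theta>) (Y m)) (\<lambda>\<omega> t. Y m t \<omega> - b m t)" if "m \<in> ?I" for m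
    by (rule subgaussian_field.tame[OF gaussian(1)[OF that]])
  have tameF: "tame_field \<pi> (P \<theta> m) (F m)" if m: "m \<in> ?I" for m
  proof -
    interpret c: bounded_local_component \<Theta> T \<pi> M H \<eta> P0 P U V R S \<Delta> \<theta> m D L
      by (rule component[OF m])
    have F: "F m = c.fluctuation" by (simp add: fun_eq_iff F_def \<mu>_def c.fluctuation_def)
    show ?thesis unfolding F
      by (rule centred_field.tame_if_remainder[OF c.fluctuation_centred c.fluctuation_remainder])
        (use D in auto)
  qed
  let ?\<epsilon> = "576 * exp 4 * E + 1442 * exp 25 * E + (944 + 12 * sqrt L) * E"
  have cost: "\<bar>(\<integral>\<omega>. log_partition \<nu> (\<lambda>t. b m t + F m \<omega> t) \<partial>P \<theta> m)
      - (\<integral>\<omega>. log_partition \<nu> (\<lambda>t. b m t + (Y m t \<omega> - b m t)) \<partial>base.path_space (Q \<theta>) (Y m))\<bar> \<le> ?\<epsilon>"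
    if m: "m \<in> ?I" and \<nu>: "prob_space \<nu>" "sets \<nu> = sets \<pi>" for m \<nu>
  proof -
    interpret c: bounded_local_component \<Theta> T \<pi> M H \<eta> P0 P U V R S \<Delta> \<theta> m D L
      by (rule component[OF m])
    have F: "F m = c.fluctuation" by (simp add: fun_eq_iff F_def \<mu>_def c.fluctuation_def)
    interpret g: subgaussian_field "base.path_space (Q \<theta>) (Y m)" \<pi> "\<lambda>\<omega> t. Y m t \<omega> - b m t" x
      by (rule gaussian(1)[OF m])
    show ?thesis
    proof (rule component_exchange_cost[OF c.fluctuation_centred[folded F] tameF[OF m]
          g.centred_field_axioms tameY[OF m] _ _ _ gaussian(2)[OF m] b_bounded[OF m] \<nu>])
      fix \<nu> assume \<nu>: "prob_space \<nu>" "sets \<nu> = sets \<pi>"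
      have "\<bar>(\<integral>\<omega>. log_partition \<nu> (F m \<omega>) \<partial>P \<theta> m) - half_variance \<nu> (centred_field.covariance (P \<theta> m) (F m))\<bar>
          \<le> 576 * exp 4 * (?r\<^sup>2 * D)"
        unfolding F
        by (rule centred_field.log_partition_expansion(1)[OF c.fluctuation_centred \<nu> c.fluctuation_remainder[OF \<nu>]])
          (use D in simp)
      also have "\<dots> \<le> 576 * exp 4 * E" by (rule mult_left_mono[OF E0]) simp
      finally show "\<bar>(\<integral>\<omega>. log_partition \<nu> (F m \<omega>) \<partial>P \<theta> m)
          - half_variance \<nu> (centred_field.covariance (P \<theta> m) (F m))\<bar> \<le> 576 * exp 4 * E" .
      have "1442 * exp 25 * x ^ 3 \<le> 1442 * exp 25 * E" by (rule mult_left_mono[OF x(2)]) simp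
      then show "\<bar>(\<integral>\<omega>. log_partition \<nu> (\<lambda>t. Y m t \<omega> - b m t) \<partial>base.path_space (Q \<theta>) (Y m))
          - half_variance \<nu> (centred_field.covariance (base.path_space (Q \<theta>) (Y m)) (\<lambda>\<omega> t. Y m t \<omega> - b m t))\<bar>
          \<le> 1442 * exp 25 * E"
        using g.expansion[OF \<nu>] by linarith
    next
      fix s t assume "s \<in> space \<pi>" "t \<in> space \<pi>"
      then have st: "s \<in> T" "t \<in> T" by (simp_all add: base.space_\<tau>)
      show "\<bar>centred_field.covariance (P \<theta> m) (F m) s t
          - centred_field.covariance (base.path_space (Q \<theta>) (Y m)) (\<lambda>\<omega> t. Y m t \<omega> - b m t) s t\<bar>
          \<le> (944 + 12 * sqrt L) * E"
        unfolding gaussian(3)[OF m st] F E_def by (rule c.fluctuation_covariance[OF st])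
    qed
  qed
  define f where "f m \<omega> t = b m t + F m \<omega> t" for m \<omega> t
  have f_tame: "tame_field \<pi> (P \<theta> m) (f m)" if "m \<in> ?I" for m
    unfolding f_def by (rule tame_field_shift(1)[OF tameF[OF that] gaussian(2)[OF that] b_bounded[OF that]])
  have Y_tame: "tame_field \<pi> (base.path_space (Q \<theta>) (Y m)) (\<lambda>\<omega> t. Y m t \<omega>)" if "m \<in> ?I" for m
    using tame_field_shift(1)[OF tameY[OF that] gaussian(2)[OF that] b_bounded[OF that]] by simp
  have lindeberg: "\<bar>(\<integral>\<omega>. log_partition \<pi> (sum_field ?I f \<omega>) \<partial>PiM ?I (P \<theta>))
      - (\<integral>\<omega>. log_partition \<pi> (sum_field ?I (\<lambda>m \<omega> t. Y m t \<omega>) \<omega>) \<partial>PiM ?I (\<lambda>m. base.path_space (Q \<theta>) (Y m)))\<bar>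
      \<le> (\<Sum>m\<in>?I. ?\<epsilon>)"
    by (rule lindeberg_exchange[OF _ f_tame Y_tame _ model.prob_prior refl])
      (use cost in \<open>simp_all add: f_def[abs_def]\<close>)
  have gauss_sum: "(\<integral>\<omega>. log_partition \<pi> (sum_field ?I (\<lambda>m \<omega> t. Y m t \<omega>) \<omega>) \<partial>PiM ?I (\<lambda>m. base.path_space (Q \<theta>) (Y m)))
      = (\<integral>\<omega>. log_partition \<pi> (\<lambda>t. \<Sum>m\<in>?I. Y m t \<omega>) \<partial>Q \<theta>)"
    by (rule base.independent_sum_integral[OF G.prob_Q[OF theta] _ Y_meas G.Y_indep[OF theta] _ Y_tame
          model.prob_prior refl]) (use model.M_pos in auto)
  let ?PP = "PiM ?I (P \<theta>)"
  have sum_tame: "tame_field \<pi> ?PP (sum_field ?I f)" by (rule tame_field_sum[OF _ f_tame]) simp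
  interpret PP: prob_space ?PP using sum_tame by (simp add: tame_field_def)
  have space_PP: "space ?PP = space (PiM ?I P0)"
    unfolding space_PiM by (rule PiE_cong) (simp add: model.P_density[OF theta])
  \<comment> \<open>What centring removed: a sum of deterministic differences, small and, unlike its summands,
    measurable in the parameter.\<close>
  define d where "d t = (\<Sum>m\<in>?I. \<mu> m t - b m t)" for t
  have split: "(\<lambda>t. likelihood_process M U V R \<eta> t \<omega>) = (\<lambda>t. d t + sum_field ?I f \<omega> t)" for \<omega>
    by (simp add: fun_eq_iff likelihood_process_def d_def sum_field_def f_def F_def
        sum.distrib[symmetric] sum_subtractf[symmetric])
  have d_small: "\<bar>d t\<bar> \<le> real M * ((197 + 4 * sqrt L) * E)" if "t \<in> T" for t
  proof -
    have "\<bar>d t\<bar> \<le> (\<Sum>m\<in>?I. \<bar>\<mu> m t - b m t\<bar>)" unfolding d_def by (rule sum_abs)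
    also have "\<dots> \<le> (\<Sum>m\<in>?I. (197 + 4 * sqrt L) * E)" by (rule sum_mono) (rule drift[OF _ that])
    finally show ?thesis by simp
  qed
  have d_meas: "d \<in> borel_measurable \<pi>"
  proof -
    obtain \<omega>0 where \<omega>0: "\<omega>0 \<in> space ?PP" using PP.not_empty by blast
    have "(\<lambda>t. likelihood_process M U V R \<eta> t \<omega>0) \<in> borel_measurable (restrict_space borel T)"
      by (rule borel_measurable_continuous_on_restrict[OF model.X_continuous[OF \<omega>0[unfolded space_PP]]])
    then have [measurable]: "(\<lambda>t. likelihood_process M U V R \<eta> t \<omega>0) \<in> borel_measurable \<pi>"
      by (simp add: measurable_cong_sets[OF model.sets_prior refl])
    note [measurable] = tame_field_section(1)[OF sum_tame \<omega>0 refl]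
    have "d = (\<lambda>t. likelihood_process M U V R \<eta> t \<omega>0 - sum_field ?I f \<omega>0 t)"
      using split[of \<omega>0] by (auto simp: fun_eq_iff)
    moreover have "(\<lambda>t. likelihood_process M U V R \<eta> t \<omega>0 - sum_field ?I f \<omega>0 t) \<in> borel_measurable \<pi>"
      by measurable
    ultimately show ?thesis by (simp only:)
  qed
  have d_bounded: "bounded_on_space \<pi> d"
    by (rule bounded_on_spaceI[OF d_small]) (simp add: base.space_\<tau>)
  have lik: "\<bar>(\<integral>\<omega>. log_partition \<pi> (\<lambda>t. likelihood_process M U V R \<eta> t \<omega>) \<partial>?PP)
      - (\<integral>\<omega>. log_partition \<pi> (sum_field ?I f \<omega>) \<partial>?PP)\<bar> \<le> real M * ((197 + 4 * sqrt L) * E)"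
  proof -
    let ?l = "\<lambda>\<omega>. log_partition \<pi> (\<lambda>t. d t + sum_field ?I f \<omega> t)" and ?s = "\<lambda>\<omega>. log_partition \<pi> (sum_field ?I f \<omega>)"
    let ?c = "real M * ((197 + 4 * sqrt L) * E)"
    have int: "integrable ?PP ?l" "integrable ?PP ?s"
      by (rule tame_field_integrable[OF tame_field_shift(1)[OF sum_tame d_meas d_bounded] model.prob_prior refl],
          rule tame_field_integrable[OF sum_tame model.prob_prior refl])
    have diff: "integrable ?PP (\<lambda>\<omega>. ?l \<omega> - ?s \<omega>)" using int by simp
    have le: "\<bar>?l \<omega> - ?s \<omega>\<bar> \<le> ?c" if \<omega>: "\<omega> \<in> space ?PP" for \<omega>
    proof (rule prior.log_partition_lipschitz)
      note sec = tame_field_section[OF sum_tame \<omega> refl]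
      show "sum_field ?I f \<omega> \<in> borel_measurable \<pi>" "bounded_on_space \<pi> (sum_field ?I f \<omega>)" by (fact sec)+
      show "(\<lambda>t. d t + sum_field ?I f \<omega> t) \<in> borel_measurable \<pi>" using d_meas sec(1) by measurable
    qed (use d_small in \<open>simp add: base.space_\<tau>\<close>)
    then have "- ?c \<le> ?l \<omega> - ?s \<omega>" "?l \<omega> - ?s \<omega> \<le> ?c" if "\<omega> \<in> space ?PP" for \<omega>
      using le[OF that] unfolding abs_le_iff by linarith+
    from PP.integral_between[OF diff this]
    show ?thesis unfolding split Bochner_Integration.integral_diff[OF int] abs_le_iff by linarith
  qed
  have "real M * ((197 + 4 * sqrt L) * E) + (\<Sum>m\<in>?I. ?\<epsilon>) = real M * (comparison_constant L * E)"
    by (simp add: comparison_constant_def algebra_simps)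
  then show ?thesis using lik lindeberg unfolding gauss_sum E_def[symmetric] by linarith
qed

theorem theorem8:
  fixes \<Theta> T :: "nat \<Rightarrow> 'p::topological_space set"
    and \<pi> :: "nat \<Rightarrow> 'p measure"
    and M :: "nat \<Rightarrow> nat"
    and H :: "nat \<Rightarrow> nat \<Rightarrow> 'h::{real_inner, banach, second_countable_topology} set"
    and \<eta> :: "nat \<Rightarrow> nat \<Rightarrow> 'p \<Rightarrow> 'h"
    and P0 :: "nat \<Rightarrow> nat \<Rightarrow> 'w measure"
    and P :: "nat \<Rightarrow> 'p \<Rightarrow> nat \<Rightarrow> 'w measure"
    and U S :: "nat \<Rightarrow> nat \<Rightarrow> 'w \<Rightarrow> 'h"
    and V :: "nat \<Rightarrow> nat \<Rightarrow> 'w \<Rightarrow> 'h \<Rightarrow> 'h"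
    and R \<Delta> :: "nat \<Rightarrow> nat \<Rightarrow> 'p \<Rightarrow> 'w \<Rightarrow> real"
    and A \<Sigma> K :: "nat \<Rightarrow> nat \<Rightarrow> 'h \<Rightarrow> 'h"
    and Q :: "nat \<Rightarrow> 'p \<Rightarrow> 'y measure"
    and Y :: "nat \<Rightarrow> nat \<Rightarrow> 'p \<Rightarrow> 'y \<Rightarrow> real"
    and \<delta> :: "nat \<Rightarrow> 'p \<Rightarrow> real"
    and r :: "nat \<Rightarrow> real"
  defines "r \<equiv> \<lambda>n. feature_radius (\<Theta> n) (M n) (\<eta> n)"
  assumes model: "\<And>n. n \<ge> 1 \<Longrightarrow>
      local_likelihood_model (\<Theta> n) (T n) (\<pi> n) (M n) (H n) (\<eta> n) (P0 n) (P n)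
        (U n) (V n) (R n) (S n) (\<Delta> n)"
    and counterpart: "\<And>n. n \<ge> 1 \<Longrightarrow>
      gaussian_counterpart (\<Theta> n) (T n) (M n) (H n) (\<eta> n) (P0 n) (U n) (V n) (S n)
        (A n) (\<Sigma> n) (K n) (Q n) (Y n)"
    and delta_nonneg: "\<And>n \<theta>. n \<ge> 1 \<Longrightarrow> \<theta> \<in> \<Theta> n \<Longrightarrow> \<delta> n \<theta> \<ge> 0"
    and U_centered: "\<And>n m. n \<ge> 1 \<Longrightarrow> m \<in> {1..M n} \<Longrightarrow> (\<integral>\<omega>. U n m \<omega> \<partial>P0 n m) = 0"
    and L_bound: "\<exists>C. \<forall>n\<ge>1. \<forall>m\<in>{1..M n}.
      second_moments (P0 n m) (U n m) (S n m) \<le> ennreal C"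
    and E_bound: "\<exists>C. \<forall>n\<ge>1. \<forall>m\<in>{1..M n}. \<forall>\<theta>\<in>\<Theta> n.
      score_error (r n) (P0 n m) (P n \<theta> m) (U n m)
      + score_error (r n) (P0 n m) (P n \<theta> m) (S n m)
      + curvature_error (r n) (P0 n m) (P n \<theta> m) (H n m) (V n m)
      + remainder_error (r n) (P0 n m) (P n \<theta> m) (T n) (R n m)
      + density_error (r n) (P0 n m) (P n \<theta> m) (\<Delta> n m \<theta>)
      \<le> ennreal (C * \<delta> n \<theta>)"
    and radius_bound: "\<exists>C. \<forall>n\<ge>1. r n \<le> C * sqrt (real n / real (M n))"
  shows "\<exists>C. \<forall>n\<ge>1. \<forall>\<theta>\<in>\<Theta> n.
      \<bar>free_energy n (\<pi> n) (PiM {1..M n} (P n \<theta>))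
          (likelihood_process (M n) (U n) (V n) (R n) (\<eta> n))
        - free_energy n (\<pi> n) (Q n \<theta>) (\<lambda>t \<omega>. \<Sum>m\<in>{1..M n}. Y n m t \<omega>)\<bar>
      \<le> C * (\<delta> n \<theta> * (1 + \<delta> n \<theta>))"
proof -
  obtain C1 where C1: "\<And>n m. n \<ge> 1 \<Longrightarrow> m \<in> {1..M n} \<Longrightarrow>
      second_moments (P0 n m) (U n m) (S n m) \<le> ennreal C1"
    using L_bound by blast
  obtain C2 where C2: "\<And>n m \<theta>. n \<ge> 1 \<Longrightarrow> m \<in> {1..M n} \<Longrightarrow> \<theta> \<in> \<Theta> n \<Longrightarrow>
      score_error (r n) (P0 n m) (P n \<theta> m) (U n m)
      + score_error (r n) (P0 n m) (P n \<theta> m) (S n m)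
      + curvature_error (r n) (P0 n m) (P n \<theta> m) (H n m) (V n m)
      + remainder_error (r n) (P0 n m) (P n \<theta> m) (T n) (R n m)
      + density_error (r n) (P0 n m) (P n \<theta> m) (\<Delta> n m \<theta>) \<le> ennreal (C2 * \<delta> n \<theta>)"
    using E_bound by blast
  obtain C3 where C3: "\<And>n. n \<ge> 1 \<Longrightarrow> r n \<le> C3 * sqrt (real n / real (M n))"
    using radius_bound by blast
  define L where "L = max 0 C1"
  define c where "c = max 0 C2"
  define K' where "K' = comparison_constant L * C3\<^sup>2"
  have L0: "0 \<le> L" and c0: "0 \<le> c" by (simp_all add: L_def c_def)
  have K0: "0 \<le> comparison_constant L" "0 \<le> K'"
    using L0 by (simp_all add: K'_def comparison_constant_def add_nonneg_nonneg)
  show ?thesis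
  proof (intro exI[of _ "K' * (c * (1 + c))"] allI impI ballI)
    fix n \<theta> assume n: "1 \<le> n" and \<theta>: "\<theta> \<in> \<Theta> n"
    interpret model: local_likelihood_model "\<Theta> n" "T n" "\<pi> n" "M n" "H n" "\<eta> n" "P0 n" "P n"
        "U n" "V n" "R n" "S n" "\<Delta> n" by (rule model[OF n])
    let ?gap = "\<bar>free_energy n (\<pi> n) (PiM {1..M n} (P n \<theta>))
          (likelihood_process (M n) (U n) (V n) (R n) (\<eta> n))
        - free_energy n (\<pi> n) (Q n \<theta>) (\<lambda>t \<omega>. \<Sum>m\<in>{1..M n}. Y n m t \<omega>)\<bar>"
    have \<delta>0: "0 \<le> \<delta> n \<theta>" by (rule delta_nonneg[OF n \<theta>])
    have M: "1 \<le> real (M n)" using model.M_pos by simp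
    have rad: "real (M n) * (r n)\<^sup>2 \<le> C3\<^sup>2 * real n"
    proof -
      have "(r n)\<^sup>2 \<le> (C3 * sqrt (real n / real (M n)))\<^sup>2"
        using C3[OF n] model.radius_pos by (intro power_mono) (simp_all add: r_def)
      also have "\<dots> = C3\<^sup>2 * (real n / real (M n))" by (simp add: power_mult_distrib)
      finally show ?thesis using M by (simp add: field_simps)
    qed
    have bound: "?gap \<le> K' * (D * (1 + D))" if D: "c * \<delta> n \<theta> < D" for D
    proof -
      have D0: "0 < D" using D c0 \<delta>0 by (meson mult_nonneg_nonneg order_le_less_trans)
      have "C2 * \<delta> n \<theta> \<le> D"
        using D mult_right_mono[of C2 c "\<delta> n \<theta>"] \<delta>0 by (simp add: c_def)
      then have err: "score_error (r n) (P0 n m) (P n \<theta> m) (U n m)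
          + score_error (r n) (P0 n m) (P n \<theta> m) (S n m)
          + curvature_error (r n) (P0 n m) (P n \<theta> m) (H n m) (V n m)
          + remainder_error (r n) (P0 n m) (P n \<theta> m) (T n) (R n m)
          + density_error (r n) (P0 n m) (P n \<theta> m) (\<Delta> n m \<theta>) \<le> ennreal D" if "m \<in> {1..M n}" for m
        using C2[OF n that \<theta>] by (meson ennreal_leI order_trans)
      have sec: "second_moments (P0 n m) (U n m) (S n m) \<le> ennreal L" if "m \<in> {1..M n}" for m
        using C1[OF n that] by (simp add: L_def ennreal_leI order_trans[OF _ ennreal_leI])
      let ?F = "\<integral>\<omega>. log_partition (\<pi> n) (\<lambda>t. likelihood_process (M n) (U n) (V n) (R n) (\<eta> n) t \<omega>) \<partial>PiM {1..M n} (P n \<theta>)"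
      let ?G = "\<integral>\<omega>. log_partition (\<pi> n) (\<lambda>t. \<Sum>m\<in>{1..M n}. Y n m t \<omega>) \<partial>Q n \<theta>"
      have cmp: "\<bar>?F - ?G\<bar> \<le> real (M n) * (comparison_constant L * ((r n)\<^sup>2 * (D * (1 + D))))"
        unfolding r_def
        by (rule free_energy_comparison[OF model[OF n] counterpart[OF n] \<theta> D0 L0 U_centered[OF n] sec
              err[unfolded r_def]])
      also have "\<dots> = (real (M n) * (r n)\<^sup>2) * (comparison_constant L * (D * (1 + D)))" by (simp add: mult_ac)
      also have "\<dots> \<le> (C3\<^sup>2 * real n) * (comparison_constant L * (D * (1 + D)))"
        by (rule mult_right_mono[OF rad]) (use K0 D0 in simp)
      also have "\<dots> = real n * (K' * (D * (1 + D)))" by (simp add: K'_def mult_ac)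
      finally have "\<bar>?F - ?G\<bar> / real n \<le> real n * (K' * (D * (1 + D))) / real n"
        by (rule divide_right_mono) simp
      moreover have "?gap = \<bar>?F - ?G\<bar> / real n"
        unfolding free_energy_def log_partition_def by (simp add: diff_divide_distrib[symmetric] abs_divide)
      ultimately show ?thesis using n by simp
    qed
    \<comment> \<open>The comparison needs a positive error level; \<open>\<delta>\<close> may vanish, so the level decreases to it.\<close>
    have "((\<lambda>D. K' * (D * (1 + D))) \<longlongrightarrow> K' * (c * \<delta> n \<theta> * (1 + c * \<delta> n \<theta>))) (at_right (c * \<delta> n \<theta>))"
      by (intro tendsto_intros)
    then have "?gap \<le> K' * (c * \<delta> n \<theta> * (1 + c * \<delta> n \<theta>))"
    proof (rule tendsto_lowerbound)
      show "eventually (\<lambda>D. ?gap \<le> K' * (D * (1 + D))) (at_right (c * \<delta> n \<theta>))"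
        using eventually_at_right_less by eventually_elim (rule bound)
    qed simp
    also have "\<dots> \<le> K' * ((c * (1 + c)) * (\<delta> n \<theta> * (1 + \<delta> n \<theta>)))"
    proof (rule mult_left_mono[OF _ K0(2)])
      have "0 \<le> c * \<delta> n \<theta> * (c + \<delta> n \<theta>)" using c0 \<delta>0 by simp
      then show "c * \<delta> n \<theta> * (1 + c * \<delta> n \<theta>) \<le> (c * (1 + c)) * (\<delta> n \<theta> * (1 + \<delta> n \<theta>))"
        by (simp add: algebra_simps)
    qed
    finally show "?gap \<le> K' * (c * (1 + c)) * (\<delta> n \<theta> * (1 + \<delta> n \<theta>))" by (simp add: mult.assoc)
  qed
qed

end
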